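(* Let $p\ge 1$ and let $f:\mathbb R^p\to\mathbb R$ be convex and twice differentiable, with $\int_{\mathbb R^p} e^{-f}<\infty$, such that for some $M,M_2>0$ and all $\theta,\theta'\in\mathbb R^p$, $\|\nabla f(\theta)-\nabla f(\theta')\|_2\le M\|\theta-\theta'\|_2$ and $\|\nabla^2 f(\theta)-\nabla^2 f(\theta')\|\le M_2\|\theta-\theta'\|_2$ (spectral norm on matrices). Let $\pi(\theta)=e^{-f(\theta)}/\int_{\mathbb R^p}e^{-f(v)}dv$ and $\mu_2=\big(\int_{\mathbb R^p}\|\theta\|_2^2\,\pi(\theta)\,d\theta\big)^{1/2}$. Let $q\in[1,2]$. For every $0<\alpha\le M/20$, every $0<h\le 1/(M+\alpha)$ and every $K\in\mathbb N$, the distribution $\nu_K$ of the $K$-th iterate $\vartheta_K$ of the $\alpha$-LMC algorithm (with parameters $\alpha,h$, started at $\vartheta_0=0$) satisfies $$W_q(\nu_K,\pi)\le \mu_2(1-\alpha h)^{K}+\frac{M_2hp}{2\alpha}+\frac{2.8\,M^{3/2}hp^{1/2}}{\alpha}+\big(C_q\,\alpha\,\mu_2^{q+2}\big)^{1/q},$$ where $C_q$ is the dimension-free constant defined in the context.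
   Context: Wasserstein distance: $W_q(\nu,\nu')=\inf\{\mathbf E[\|\vartheta-\vartheta'\|_2^q]^{1/q}:\vartheta\sim\nu,\ \vartheta'\sim\nu'\}$, the infimum being over all couplings. $\alpha$-LMC algorithm with step-size $h$: $\vartheta_0=0$ and $$\vartheta_{k+1}=(1-\alpha h)\vartheta_k-h\nabla f(\vartheta_k)+\sqrt{2h}\,\xi_{k+1},\qquad k=0,1,2,\dots,$$ where $\xi_1,\xi_2,\dots$ are i.i.d. $\mathcal N(0,I_p)$ vectors. Constant $C_q$: for a log-concave probability density $\pi\propto e^{-f}$ on $\mathbb R^p$ and $\alpha\ge 0$, let $\pi_\alpha(\theta)\propto e^{-f(\theta)-\alpha\|\theta\|_2^2/2}$ be the corresponding probability density, and let $\mu_2(\pi)=(\int\|\theta\|_2^2\pi(\theta)d\theta)^{1/2}$. Then $C_q$ is the infimum of all $C$ such that $W_q^q(\pi,\pi_\alpha)\le C\,\alpha\,\mu_2(\pi)^{q+2}$ for all log-concave $\pi$ (in any dimension $p$) and all $\alpha\ge 0$. *)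

theory Defs
  imports "HOL-Probability.Probability"
begin

text \<open>
  All quantities of the statement (Wasserstein distances, moments, the constant) take values in
  \<open>[0, \<infinity>]\<close>, rendered as \<^typ>\<open>ennreal\<close>.
\<close>

text \<open>Power of an extended nonnegative real; only meant for exponents \<open>a > 0\<close>.\<close>

definition epowr :: "ennreal \<Rightarrow> real \<Rightarrow> ennreal" (infixr \<open>epowr\<close> 80) where
  "x epowr a = (if x = \<top> then \<top> else ennreal (enn2real x powr a))"

definition couplings :: "'a measure \<Rightarrow> 'a measure \<Rightarrow> ('a \<times> 'a) measure set" where
  "couplings \<mu> \<nu> =
    {\<gamma>. sets \<gamma> = sets (\<mu> \<Otimes>\<^sub>M \<nu>) \<and> distr \<gamma> \<mu> fst = \<mu> \<and> distr \<gamma> \<nu> snd = \<nu>}"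

text \<open>
  The metric \<open>d\<close> is an explicit argument because Euclidean space occurs below in two forms: as
  the type \<^typ>\<open>real ^ 'n\<close>, and, where the dimension has to be quantified, as a space of functions
  on \<open>{..<p}\<close>.
\<close>

definition wasserstein :: "('a \<Rightarrow> 'a \<Rightarrow> real) \<Rightarrow> real \<Rightarrow> 'a measure \<Rightarrow> 'a measure \<Rightarrow> ennreal" where
  "wasserstein d q \<mu> \<nu> =
    (INF \<gamma> \<in> couplings \<mu> \<nu>. (\<integral>\<^sup>+ z. ennreal (d (fst z) (snd z) powr q) \<partial>\<gamma>) epowr (1 / q))"

text \<open>The probability measure with density proportional to \<open>u\<close> with respect to \<open>L\<close>.\<close>

definition proportional :: "'a measure \<Rightarrow> ('a \<Rightarrow> real) \<Rightarrow> 'a measure" where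
  "proportional L u = density L (\<lambda>\<theta>. ennreal (u \<theta>) / (\<integral>\<^sup>+ v. ennreal (u v) \<partial>L))"

definition moment2 :: "('a \<Rightarrow> real) \<Rightarrow> 'a measure \<Rightarrow> ennreal" where
  "moment2 nrm \<mu> = (\<integral>\<^sup>+ \<theta>. ennreal ((nrm \<theta>)\<^sup>2) \<partial>\<mu>) epowr (1 / 2)"

text \<open>
  \<open>\<real>\<^sup>p\<close> with the dimension \<open>p\<close> a term: extensional functions on \<open>{..<p}\<close> with Lebesgue
  measure and the Euclidean norm.
\<close>

definition leb :: "nat \<Rightarrow> (nat \<Rightarrow> real) measure" where
  "leb p = (\<Pi>\<^sub>M i\<in>{..<p}. lborel)"

definition nrm :: "nat \<Rightarrow> (nat \<Rightarrow> real) \<Rightarrow> real" where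
  "nrm p x = L2_set x {..<p}"

definition dst :: "nat \<Rightarrow> (nat \<Rightarrow> real) \<Rightarrow> (nat \<Rightarrow> real) \<Rightarrow> real" where
  "dst p x y = L2_set (\<lambda>i. x i - y i) {..<p}"

text \<open>
  Log-concave probability densities on \<open>\<real>\<^sup>p\<close>, i.e. \<open>g = exp (- f)\<close> with \<open>f\<close> convex and allowed
  to take the value \<open>\<infinity>\<close> (where \<open>g\<close> vanishes). The range of \<open>t\<close> is the open interval because
  \<open>0 powr 0 = 0\<close>.
\<close>

definition log_concave_density :: "nat \<Rightarrow> ((nat \<Rightarrow> real) \<Rightarrow> real) \<Rightarrow> bool" where
  "log_concave_density p g \<longleftrightarrow>
    g \<in> borel_measurable (leb p) \<and>
    (\<forall>x \<in> space (leb p). 0 \<le> g x) \<and>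
    (\<integral>\<^sup>+ x. ennreal (g x) \<partial>leb p) = 1 \<and>
    (\<forall>x \<in> space (leb p). \<forall>y \<in> space (leb p). \<forall>t \<in> {0<..<1}.
       g x powr (1 - t) * g y powr t \<le> g (\<lambda>i\<in>{..<p}. (1 - t) * x i + t * y i))"

text \<open>
  With \<open>g = exp (- f)\<close>, the function \<open>\<lambda>\<theta>. g \<theta> * exp (- \<alpha> * (nrm p \<theta>)\<^sup>2 / 2)\<close> is
  \<open>exp (- f - \<alpha> \<parallel>\<cdot>\<parallel>\<^sup>2 / 2)\<close>.
\<close>

definition C_const :: "real \<Rightarrow> ennreal" where
  "C_const q = Inf {C. \<forall>p \<ge> 1. \<forall>g. \<forall>\<alpha> \<ge> 0. log_concave_density p g \<longrightarrow>
     (let \<pi> = density (leb p) (\<lambda>\<theta>. ennreal (g \<theta>));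
          \<pi>\<^sub>\<alpha> = proportional (leb p) (\<lambda>\<theta>. g \<theta> * exp (- \<alpha> * (nrm p \<theta>)\<^sup>2 / 2))
      in wasserstein (dst p) q \<pi> \<pi>\<^sub>\<alpha> epowr q
           \<le> C * ennreal \<alpha> * moment2 (nrm p) \<pi> epowr (q + 2))}"

definition std_gaussian_density :: "real ^ 'n \<Rightarrow> real" where
  "std_gaussian_density x = (\<Prod>i\<in>UNIV. std_normal_density (x $ i))"

primrec lmc ::
  "real \<Rightarrow> real \<Rightarrow> (real ^ 'n \<Rightarrow> real ^ 'n) \<Rightarrow> (nat \<Rightarrow> 'w \<Rightarrow> real ^ 'n) \<Rightarrow> nat \<Rightarrow> 'w \<Rightarrow> real ^ 'n"
where
  "lmc \<alpha> h G \<xi> 0 = (\<lambda>\<omega>. 0)"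
| "lmc \<alpha> h G \<xi> (Suc k) = (\<lambda>\<omega>. (1 - \<alpha> * h) *\<^sub>R lmc \<alpha> h G \<xi> k \<omega> - h *\<^sub>R G (lmc \<alpha> h G \<xi> k \<omega>)
      + sqrt (2 * h) *\<^sub>R \<xi> (Suc k) \<omega>)"

end

theory Submission
  imports Defs "HOL-Real_Asymp.Real_Asymp"
begin

text \<open>
  The triangle inequality splits the error at \<open>\<pi>\<^sub>\<alpha>\<close>; by definition of the constant \<open>C_const\<close>, only
  the distance between the LMC iterate and \<open>\<pi>\<^sub>\<alpha>\<close> is left. The usual synchronous coupling with the
  stationary Langevin diffusion is replaced by a coupling with a Metropolis-adjusted Langevin
  chain (MALA), which leaves \<open>\<pi>\<^sub>\<alpha>\<close> exactly invariant: one LMC step of size \<open>h\<close> is compared with \<open>N\<close>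
  MALA steps of size \<open>\<eta> = h / N\<close> driven by the same Gaussian vectors. Linearising the gradient along
  each fine step leaves a martingale part, whose contributions add up in square, and a drift of
  order \<open>\<eta>^2\<close>; a rejection has probability of order \<open>\<eta>\<close>, which makes its effect vanish as
  \<open>N\<close> tends to infinity. The limit is taken only in the resulting numerical bounds, never for measures.
\<close>

section \<open>Wasserstein distances\<close>

text \<open>A stationary diffusion in continuous time would call for stochastic integrals; for MALA,
  stationarity is the symmetry of an explicit density, and each step involves finitely many random
  variables. The linearisation decides the order in \<open>h\<close>: the root mean square error of
  one step is about \<open>L * h powr (3 / 2) * sqrt p\<close>, and adding these linearly would
  leave an error of order \<open>sqrt h\<close>. With the centred part kept in square, one step
  costs a bias \<open>h^2 / 2 * (L * sqrt (L * p) + M2 * p)\<close> and a variance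
  \<open>4 * h ^ 3 * L^2 * p\<close>. Contraction by \<open>1 - \<alpha> * h\<close> turns them into
  bias / (\<alpha> h) and the root of variance / (\<alpha> h), both of order \<open>h\<close>. The
  \<open>M2\<close> part of the bias is exactly the second term of the theorem; the rest, with
  \<open>L = M + \<alpha>\<close>, stays below 1.08 times
  \<open>M powr (3 / 2) * h * sqrt p / \<alpha>\<close>, so that 2.8 leaves room. A rejected move
  has size of order \<open>sqrt \<eta>\<close>, hence a mean effect of order
  \<open>\<eta> * sqrt \<eta>\<close> per fine step and \<open>h * sqrt \<eta>\<close> after all
  \<open>N\<close> of them.\<close>

lemma top_epowr [simp]: "\<top> epowr a = \<top>"
  by (simp add: epowr_def)

lemma ennreal_epowr: "0 \<le> x \<Longrightarrow> ennreal x epowr a = ennreal (x powr a)"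
  by (simp add: epowr_def)

lemma epowr_inverse_le_iff:
  assumes "0 < q" "0 \<le> A"
  shows "x epowr (1 / q) \<le> ennreal A \<longleftrightarrow> x \<le> ennreal (A powr q)"
proof (cases x)
  case (real r)
  have "r powr (1 / q) \<le> A \<longleftrightarrow> r \<le> A powr q"
  proof
    assume "r powr (1 / q) \<le> A"
    then have "(r powr (1 / q)) powr q \<le> A powr q"
      using assms by (intro powr_mono2) auto
    then show "r \<le> A powr q"
      using assms real by (simp add: powr_powr)
  next
    assume "r \<le> A powr q"
    then have "r powr (1 / q) \<le> (A powr q) powr (1 / q)"
      using assms real by (intro powr_mono2) auto
    then show "r powr (1 / q) \<le> A"
      using assms real by (simp add: powr_powr)
  qed
  then show ?thesis
    using assms real by (simp add: ennreal_epowr)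
qed (auto simp: top_unique)

lemma epowr_half_le_iff:
  assumes "0 \<le> A"
  shows "x epowr (1 / 2) \<le> ennreal A \<longleftrightarrow> x \<le> ennreal (A^2)"
  using epowr_inverse_le_iff[of 2 A x] assms by simp

lemma le_epowr_inverse:
  assumes "0 < q" "x epowr q \<le> y"
  shows "x \<le> y epowr (1 / q)"
proof (cases y)
  case (real r)
  with assms have "x \<noteq> \<top>"
    by (auto simp: top_unique)
  then obtain s where s: "x = ennreal s" "0 \<le> s"
    by (cases x) auto
  with assms real have "s powr q \<le> r"
    by (simp add: ennreal_epowr)
  then have "(s powr q) powr (1 / q) \<le> r powr (1 / q)"
    using assms by (intro powr_mono2) auto
  then show ?thesis
    using s real assms by (simp add: ennreal_epowr powr_powr)
qed simp

text \<open>Convexity of \<open>t powr q\<close>, applied to \<open>u / l\<close> and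
  \<open>v / m\<close> with weights \<open>l\<close> and \<open>m\<close>; Minkowski's inequality
  rests on it.\<close>

lemma powr_add_le_weighted:
  fixes u v :: real
  assumes "1 \<le> q" "0 \<le> u" "0 \<le> v" "0 < l" "0 < m" "l + m = 1"
  shows "(u + v) powr q \<le> l * (u / l) powr q + m * (v / m) powr q"
proof -
  have scale: "w powr q \<le> k * (w / k) powr q" if "0 \<le> w" "0 < k" "k \<le> 1" for w k :: real
  proof -
    have "k powr q \<le> k powr 1"
      using that assms by (intro powr_mono') auto
    then have "w powr q * k powr q \<le> w powr q * k"
      using that by (intro mult_left_mono) auto
    then show ?thesis
      using that by (simp add: powr_divide field_simps)
  qed
  \<comment> \<open>Convexity is applied to strictly positive arguments; if one of them vanishes,
    \<open>scale\<close> alone gives the bound.\<close>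
  consider "u = 0" | "v = 0" | "0 < u" "0 < v"
    using assms by linarith
  then show ?thesis
  proof cases
    case 3
    have "((1 - m) *\<^sub>R (u / l) + m *\<^sub>R (v / m)) powr q
        \<le> (1 - m) * (u / l) powr q + m * (v / m) powr q"
      by (rule convex_onD[OF powr_convex[OF assms(1)]]) (use assms 3 in auto)
    moreover have "1 - m = l"
      using assms by simp
    ultimately show ?thesis
      using assms by simp
  qed (use scale[of v m] scale[of u l] assms in auto)
qed

text \<open>Minkowski's inequality with bounds in place of norms: for \<open>l = A / (A + B)\<close>
  and \<open>m = B / (A + B)\<close> both \<open>u / l\<close> and \<open>v / m\<close> have q-norm
  at most \<open>A + B\<close>, and so has their convex combination.\<close>

lemma nn_integral_powr_add_le_pos:
  assumes [measurable]: "u \<in> borel_measurable M" "v \<in> borel_measurable M"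
    and nonneg: "\<And>x. 0 \<le> u x" "\<And>x. 0 \<le> v x"
    and q: "1 \<le> q" and A: "0 < A" and B: "0 < B"
    and u: "(\<integral>\<^sup>+ x. ennreal (u x powr q) \<partial>M) \<le> ennreal (A powr q)"
    and v: "(\<integral>\<^sup>+ x. ennreal (v x powr q) \<partial>M) \<le> ennreal (B powr q)"
  shows "(\<integral>\<^sup>+ x. ennreal ((u x + v x) powr q) \<partial>M) \<le> ennreal ((A + B) powr q)"
proof -
  define l m where "l = A / (A + B)" and "m = B / (A + B)"
  have lm: "0 < l" "0 < m" "l + m = 1"
    using A B by (auto simp: l_def m_def simp flip: add_divide_distrib)
  define cl cm where "cl = l * (1 / l) powr q" and "cm = m * (1 / m) powr q"
  have c: "0 \<le> cl" "0 \<le> cm"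
    using lm by (auto simp: cl_def cm_def)
  have "(u x + v x) powr q \<le> cl * u x powr q + cm * v x powr q" for x
    using powr_add_le_weighted[OF q nonneg(1)[of x] nonneg(2)[of x] lm] lm nonneg[of x]
    by (simp add: cl_def cm_def powr_divide)
  then have "(\<integral>\<^sup>+ x. ennreal ((u x + v x) powr q) \<partial>M)
      \<le> (\<integral>\<^sup>+ x. ennreal cl * ennreal (u x powr q) + ennreal cm * ennreal (v x powr q) \<partial>M)"
    using c by (intro nn_integral_mono) (simp flip: ennreal_mult ennreal_plus)
  also have "\<dots> = ennreal cl * (\<integral>\<^sup>+ x. ennreal (u x powr q) \<partial>M) + ennreal cm * (\<integral>\<^sup>+ x. ennreal (v x powr q) \<partial>M)"
    by (simp add: nn_integral_add nn_integral_cmult)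
  also have "\<dots> \<le> ennreal cl * ennreal (A powr q) + ennreal cm * ennreal (B powr q)"
    by (intro add_mono mult_left_mono u v) auto
  also have "\<dots> = ennreal (cl * A powr q + cm * B powr q)"
    using c by (simp add: ennreal_mult)
  also have "cl * A powr q + cm * B powr q = l * (A / l) powr q + m * (B / m) powr q"
    using A B lm by (simp add: cl_def cm_def powr_divide)
  also have "\<dots> = (A + B) powr q"
  proof -
    have "A / l = A + B" "B / m = A + B"
      using A B by (simp_all add: l_def m_def)
    then show ?thesis
      using lm(3) by (metis distrib_right mult_1)
  qed
  finally show ?thesis .
qed

text \<open>The weights of the positive case degenerate when a bound is 0; both bounds are therefore
  enlarged by \<open>d\<close>, which then tends to 0.\<close>

lemma nn_integral_powr_add_le:
  assumes [measurable]: "u \<in> borel_measurable M" "v \<in> borel_measurable M"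
    and nonneg: "\<And>x. 0 \<le> u x" "\<And>x. 0 \<le> v x"
    and q: "1 \<le> q" and A: "0 \<le> A" and B: "0 \<le> B"
    and u: "(\<integral>\<^sup>+ x. ennreal (u x powr q) \<partial>M) \<le> ennreal (A powr q)"
    and v: "(\<integral>\<^sup>+ x. ennreal (v x powr q) \<partial>M) \<le> ennreal (B powr q)"
  shows "(\<integral>\<^sup>+ x. ennreal ((u x + v x) powr q) \<partial>M) \<le> ennreal ((A + B) powr q)"
proof -
  let ?f = "\<lambda>d. (A + d + (B + d)) powr q"
  have le: "(\<integral>\<^sup>+ x. ennreal ((u x + v x) powr q) \<partial>M) \<le> ennreal (?f d)" if "0 < d" for d
  proof (rule nn_integral_powr_add_le_pos[OF assms(1,2) nonneg q])
    show "(\<integral>\<^sup>+ x. ennreal (u x powr q) \<partial>M) \<le> ennreal ((A + d) powr q)"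
      using that A q by (intro order.trans[OF u] ennreal_leI powr_mono2) auto
    show "(\<integral>\<^sup>+ x. ennreal (v x powr q) \<partial>M) \<le> ennreal ((B + d) powr q)"
      using that B q by (intro order.trans[OF v] ennreal_leI powr_mono2) auto
  qed (use that A B in auto)
  have lim: "((\<lambda>d. ennreal (?f d)) \<longlongrightarrow> ennreal ((A + 0 + (B + 0)) powr q)) (at_right 0)"
    using A B q by (intro tendsto_ennrealI tendsto_powr' tendsto_intros) (auto simp: eventually_at_right_less eventually_at_filter)
  have "eventually (\<lambda>d. (\<integral>\<^sup>+ x. ennreal ((u x + v x) powr q) \<partial>M) \<le> ennreal (?f d)) (at_right 0)"
    using le by (auto simp: eventually_at_filter)
  from tendsto_lowerbound[OF lim this] show ?thesis
    by simp
qed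

lemma nn_integral_square_add_le:
  fixes u v :: "'a \<Rightarrow> real"
  assumes "u \<in> borel_measurable M" "v \<in> borel_measurable M"
    and "\<And>x. 0 \<le> u x" "\<And>x. 0 \<le> v x" "0 \<le> A" "0 \<le> B"
    and "(\<integral>\<^sup>+ x. ennreal ((u x)^2) \<partial>M) \<le> ennreal (A^2)"
    and "(\<integral>\<^sup>+ x. ennreal ((v x)^2) \<partial>M) \<le> ennreal (B^2)"
  shows "(\<integral>\<^sup>+ x. ennreal ((u x + v x)^2) \<partial>M) \<le> ennreal ((A + B)^2)"
  using nn_integral_powr_add_le[of u M v 2 A B] assms by simp

text \<open>Jensen's inequality for the concave map \<open>t powr (q / 2)\<close> by way of its
  tangent at \<open>t = D^2\<close>, with slope \<open>a\<close> and intercept \<open>b\<close>. The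
  chains are compared in mean square; this brings the result to the exponent
  \<open>q\<close>.\<close>

lemma nn_integral_powr_le_of_square:
  fixes u :: "'a \<Rightarrow> real"
  assumes "prob_space M" and [measurable]: "u \<in> borel_measurable M"
    and nonneg: "\<And>x. 0 \<le> u x"
    and q: "1 \<le> q" "q \<le> 2" and D: "0 < D"
    and u: "(\<integral>\<^sup>+ x. ennreal ((u x)^2) \<partial>M) \<le> ennreal (D^2)"
  shows "(\<integral>\<^sup>+ x. ennreal (u x powr q) \<partial>M) \<le> ennreal (D powr q)"
proof -
  interpret prob_space M by fact
  define a b where "a = q / 2 * D powr (q - 2)" and "b = (1 - q / 2) * D powr q"
  have ab: "0 \<le> a" "0 \<le> b"
    using q by (auto simp: a_def b_def)
  have "u x powr q \<le> a * (u x)^2 + b" for x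
  proof (cases "u x = 0")
    case False
    then have pos: "0 < u x"
      using nonneg[of x] by simp
    have "((u x)^2) powr (q / 2) * (D^2) powr (1 - q / 2) \<le> q / 2 * (u x)^2 + (1 - q / 2) * D^2"
      using q pos D by (intro Youngs_inequality_0) auto
    moreover have "((u x)^2) powr (q / 2) = u x powr q" "(D^2) powr (1 - q / 2) = D powr (2 - q)"
      using pos D by (simp_all flip: powr_numeral add: powr_powr algebra_simps)
    ultimately have "u x powr q * D powr (2 - q) * D powr (q - 2)
        \<le> (q / 2 * (u x)^2 + (1 - q / 2) * D^2) * D powr (q - 2)"
      by (intro mult_right_mono) auto
    moreover have "D powr (2 - q) * D powr (q - 2) = 1" "D^2 * D powr (q - 2) = D powr q"
      using D by (simp_all flip: powr_numeral powr_add)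
    ultimately show ?thesis
      by (simp add: a_def b_def algebra_simps)
  qed (use ab in simp)
  then have "(\<integral>\<^sup>+ x. ennreal (u x powr q) \<partial>M) \<le> (\<integral>\<^sup>+ x. ennreal a * ennreal ((u x)^2) + ennreal b \<partial>M)"
    using ab by (intro nn_integral_mono) (simp flip: ennreal_mult ennreal_plus)
  also have "\<dots> = ennreal a * (\<integral>\<^sup>+ x. ennreal ((u x)^2) \<partial>M) + ennreal b"
    by (simp add: nn_integral_add nn_integral_cmult emeasure_space_1)
  also have "\<dots> \<le> ennreal a * ennreal (D^2) + ennreal b"
    by (intro add_mono mult_left_mono u) auto
  also have "\<dots> = ennreal (a * D^2 + b)"
    using ab by (simp add: ennreal_mult)
  also have "a * D^2 + b = D powr q"
    using D by (simp add: a_def b_def algebra_simps flip: powr_numeral powr_add)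
  finally show ?thesis .
qed

lemma wasserstein_le:
  assumes "\<gamma> \<in> couplings \<mu> \<nu>" "0 < q" "0 \<le> A"
    and "(\<integral>\<^sup>+ z. ennreal (d (fst z) (snd z) powr q) \<partial>\<gamma>) \<le> ennreal (A powr q)"
  shows "wasserstein d q \<mu> \<nu> \<le> ennreal A"
  unfolding wasserstein_def using assms
  by (intro INF_lower2[OF assms(1)]) (simp add: epowr_inverse_le_iff)

lemma wasserstein_lessE:
  assumes "wasserstein d q \<mu> \<nu> < ennreal A" "0 < q" "0 \<le> A"
  obtains \<gamma> where "\<gamma> \<in> couplings \<mu> \<nu>"
    "(\<integral>\<^sup>+ z. ennreal (d (fst z) (snd z) powr q) \<partial>\<gamma>) \<le> ennreal (A powr q)"
proof -
  from assms(1) obtain \<gamma> where "\<gamma> \<in> couplings \<mu> \<nu>"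
    and "(\<integral>\<^sup>+ z. ennreal (d (fst z) (snd z) powr q) \<partial>\<gamma>) epowr (1 / q) < ennreal A"
    unfolding wasserstein_def INF_less_iff by blast
  with that[of \<gamma>] show thesis
    using assms(2,3) epowr_inverse_le_iff[of q A] less_imp_le by metis
qed

lemma couplingsD:
  assumes "\<gamma> \<in> couplings \<mu> \<nu>"
  shows "sets \<gamma> = sets (\<mu> \<Otimes>\<^sub>M \<nu>)" "distr \<gamma> \<mu> fst = \<mu>" "distr \<gamma> \<nu> snd = \<nu>"
  using assms by (auto simp: couplings_def)

lemma distr_eqI_nn_integral:
  assumes \<mu>: "sets \<mu> = sets borel" and [measurable]: "f \<in> borel_measurable \<gamma>"
    and eq: "\<And>F. F \<in> borel_measurable borel \<Longrightarrow> (\<integral>\<^sup>+ s. F (f s) \<partial>\<gamma>) = (\<integral>\<^sup>+ x. F x \<partial>\<mu>)"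
  shows "distr \<gamma> \<mu> f = \<mu>"
proof (rule measure_eqI)
  note [measurable_cong] = \<mu>
  fix A assume A: "A \<in> sets (distr \<gamma> \<mu> f)"
  then have [measurable]: "A \<in> sets borel"
    using \<mu> by simp
  have "emeasure (distr \<gamma> \<mu> f) A = (\<integral>\<^sup>+ s. indicator A (f s) \<partial>\<gamma>)"
    using A by (subst nn_integral_indicator[symmetric]) (simp_all add: nn_integral_distr \<mu> del: nn_integral_indicator)
  also have "\<dots> = emeasure \<mu> A"
    using eq[of "indicator A"] \<mu> by simp
  finally show "emeasure (distr \<gamma> \<mu> f) A = emeasure \<mu> A" .
qed simp

text \<open>Marginals are given through integrals of nonnegative functions, the form in which the
  gluing and the chain constructions deliver them.\<close>

lemma couplingsI:
  fixes \<mu> \<nu> :: "'a :: topological_space measure"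
  assumes [measurable_cong]: "sets \<gamma> = sets (borel \<Otimes>\<^sub>M borel)" and sets: "sets \<mu> = sets borel" "sets \<nu> = sets borel"
    and fst: "\<And>F. F \<in> borel_measurable borel \<Longrightarrow> (\<integral>\<^sup>+ s. F (fst s) \<partial>\<gamma>) = (\<integral>\<^sup>+ x. F x \<partial>\<mu>)"
    and snd: "\<And>F. F \<in> borel_measurable borel \<Longrightarrow> (\<integral>\<^sup>+ s. F (snd s) \<partial>\<gamma>) = (\<integral>\<^sup>+ x. F x \<partial>\<nu>)"
  shows "\<gamma> \<in> couplings \<mu> \<nu>"
proof -
  have "sets \<gamma> = sets (\<mu> \<Otimes>\<^sub>M \<nu>)"
    using assms(1-3) by (metis sets_pair_measure_cong)
  then show ?thesis
    by (simp add: couplings_def distr_eqI_nn_integral sets fst snd)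
qed

section \<open>Gluing of couplings and the triangle inequality\<close>

lemma prob_space_coupling:
  assumes "\<gamma> \<in> couplings \<mu> \<nu>" "prob_space \<mu>"
  shows "prob_space \<gamma>"
proof -
  note [measurable_cong] = couplingsD(1)[OF assms(1)]
  show ?thesis
    using prob_space_distrD[of fst \<gamma> \<mu>] couplingsD(2)[OF assms(1)] assms(2) by simp
qed

text \<open>The cell of \<open>x\<close> is the least index of a point of a countable dense set
  within \<delta> / 2 of \<open>x\<close>; two points with the same index are \<delta>-close by way
  of that point.\<close>

lemma countable_measurable_cells:
  fixes \<delta> :: real
  assumes "0 < \<delta>"
  obtains c :: "'a :: {metric_space, second_countable_topology} \<Rightarrow> nat"
  where "c \<in> measurable borel (count_space UNIV)" "\<And>x y. c x = c y \<Longrightarrow> dist x y \<le> \<delta>"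
proof -
  obtain D :: "'a set" where D: "countable D" "\<And>X. open X \<Longrightarrow> X \<noteq> {} \<Longrightarrow> \<exists>d\<in>D. d \<in> X"
    using countable_dense_setE by blast
  let ?d = "from_nat_into D"
  define c where "c x = (LEAST n. dist x (?d n) < \<delta> / 2)" for x
  have c: "dist x (?d (c x)) < \<delta> / 2" for x
  proof -
    obtain d where "d \<in> D" "d \<in> ball x (\<delta> / 2)"
      using D(2)[of "ball x (\<delta> / 2)"] assms by auto
    then have "dist x (?d (to_nat_on D d)) < \<delta> / 2"
      using D(1) by simp
    then show ?thesis
      unfolding c_def by (rule LeastI)
  qed
  show thesis
  proof
    show "c \<in> measurable borel (count_space UNIV)"
      unfolding c_def by measurable
    show "dist x y \<le> \<delta>" if "c x = c y" for x y
      using c[of x] c[of y] that dist_triangle_half_l[of x "?d (c x)" \<delta> y]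
      by (simp add: dist_commute)
  qed
qed

text \<open>
  Two couplings with a common second marginal are glued only up to the cells of a countable
  partition, so that no disintegration of measures is needed.
\<close>

lemma approximate_gluing:
  fixes \<gamma>\<^sub>1 \<gamma>\<^sub>2 :: "('a :: {metric_space, second_countable_topology} \<times> 'a) measure"
  assumes sets_eq [measurable_cong]: "sets \<gamma>\<^sub>1 = sets (borel \<Otimes>\<^sub>M borel)" "sets \<gamma>\<^sub>2 = sets (borel \<Otimes>\<^sub>M borel)"
    and marginals: "distr \<gamma>\<^sub>1 borel snd = \<nu>" "distr \<gamma>\<^sub>2 borel snd = \<nu>"
    and prob: "prob_space \<gamma>\<^sub>1" "prob_space \<gamma>\<^sub>2" and \<delta>: "0 < \<delta>"
  obtains P where "sets P = sets (\<gamma>\<^sub>1 \<Otimes>\<^sub>M \<gamma>\<^sub>2)"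
    "\<And>F. F \<in> borel_measurable \<gamma>\<^sub>1 \<Longrightarrow> (\<integral>\<^sup>+ z. F (fst z) \<partial>P) = (\<integral>\<^sup>+ x. F x \<partial>\<gamma>\<^sub>1)"
    "\<And>F. F \<in> borel_measurable \<gamma>\<^sub>2 \<Longrightarrow> (\<integral>\<^sup>+ z. F (snd z) \<partial>P) = (\<integral>\<^sup>+ x. F x \<partial>\<gamma>\<^sub>2)"
    "AE z in P. dist (snd (fst z)) (snd (snd z)) \<le> \<delta>"
proof -
  interpret g1: prob_space \<gamma>\<^sub>1 by fact
  interpret g2: prob_space \<gamma>\<^sub>2 by fact
  interpret pair_sigma_finite \<gamma>\<^sub>1 \<gamma>\<^sub>2 ..
  obtain c :: "'a \<Rightarrow> nat" where c [measurable]: "c \<in> measurable borel (count_space UNIV)"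
    and cd: "\<And>x y. c x = c y \<Longrightarrow> dist x y \<le> \<delta>"
    using countable_measurable_cells[OF \<delta>] by metis
  define \<nu>c where "\<nu>c n = emeasure \<nu> {v. c v = n}" for n
  have sets_\<nu> [measurable_cong]: "sets \<nu> = sets borel"
    unfolding marginals(1)[symmetric] by simp
  have cell: "emeasure g {z \<in> space g. c (snd z) = n} = \<nu>c n"
    if "sets g = sets (borel \<Otimes>\<^sub>M borel)" "distr g borel snd = \<nu>" for g :: "('a \<times> 'a) measure" and n
  proof -
    note [measurable_cong] = that(1)
    show ?thesis
      unfolding \<nu>c_def that(2)[symmetric]
      by (subst emeasure_distr) (auto intro!: arg_cong2[where f = emeasure])
  qed
  \<comment> \<open>Division by the mass of a null cell is harmless, since almost every point of
    either coupling avoids such cells.\<close>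
  have pos: "AE z in g. \<nu>c (c (snd z)) \<noteq> 0"
    if "sets g = sets (borel \<Otimes>\<^sub>M borel)" "distr g borel snd = \<nu>" for g :: "('a \<times> 'a) measure"
  proof -
    note [measurable_cong] = that(1)
    have "AE z in g. c (snd z) = n \<longrightarrow> \<nu>c n \<noteq> 0" for n
    proof (cases "\<nu>c n = 0")
      case True
      then show ?thesis
        using cell[OF that, of n] by (subst AE_iff_measurable[OF _ refl]) auto
    qed simp
    then have "AE z in g. \<forall>n. c (snd z) = n \<longrightarrow> \<nu>c n \<noteq> 0"
      unfolding AE_all_countable by blast
    then show ?thesis
      by eventually_elim simp
  qed
  have "\<nu>c n \<noteq> \<top>" for n
    using cell[OF sets_eq(1) marginals(1), of n] g1.emeasure_finite by metis
  then have inv: "1 / \<nu>c n * \<nu>c n = 1" if "\<nu>c n \<noteq> 0" for n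
    using that by (metis ennreal_divide_times ennreal_divide_self mult_1 top.not_eq_extremum)
  \<comment> \<open>The density that makes \<open>\<gamma>\<^sub>1\<close> and
    \<open>\<gamma>\<^sub>2\<close> independent given that their second components share a cell.
    Both give every cell the same mass, so integrating out one of them leaves the weight 1 for the
    other.\<close>
  define w where "w = (\<lambda>z :: ('a \<times> 'a) \<times> ('a \<times> 'a).
      if c (snd (fst z)) = c (snd (snd z)) then 1 / \<nu>c (c (snd (fst z))) else 0)"
  have "(\<lambda>z. 1 / \<nu>c (c (snd (fst z)))) \<in> borel_measurable (\<gamma>\<^sub>1 \<Otimes>\<^sub>M \<gamma>\<^sub>2)"
    by (rule measurable_compose[where f = "\<lambda>z. c (snd (fst z))" and N = "count_space UNIV" and g = "\<lambda>n. 1 / \<nu>c n"]) auto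
  moreover have "Measurable.pred (\<gamma>\<^sub>1 \<Otimes>\<^sub>M \<gamma>\<^sub>2) (\<lambda>z. \<exists>n. c (snd (snd z)) = n \<and> c (snd (fst z)) = n)"
    by measurable
  ultimately have w [measurable]: "w \<in> borel_measurable (\<gamma>\<^sub>1 \<Otimes>\<^sub>M \<gamma>\<^sub>2)"
    unfolding w_def by (intro measurable_If) (auto simp: pred_def)
  define P where "P = density (\<gamma>\<^sub>1 \<Otimes>\<^sub>M \<gamma>\<^sub>2) w"
  show thesis
  proof
    show "sets P = sets (\<gamma>\<^sub>1 \<Otimes>\<^sub>M \<gamma>\<^sub>2)"
      by (simp add: P_def)
    show "AE z in P. dist (snd (fst z)) (snd (snd z)) \<le> \<delta>"
      unfolding P_def using cd by (subst AE_density[OF w]) (auto simp: w_def)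
    have weight: "(\<integral>\<^sup>+ y. (if c (snd y) = n then 1 / \<nu>c n else 0) * A \<partial>g) = A"
      if g [measurable_cong]: "sets g = sets (borel \<Otimes>\<^sub>M borel)" and "distr g borel snd = \<nu>" and n: "\<nu>c n \<noteq> 0"
      for g :: "('a \<times> 'a) measure" and n and A :: ennreal
    proof -
      have "(\<integral>\<^sup>+ y. (if c (snd y) = n then 1 / \<nu>c n else 0) * A \<partial>g)
          = (\<integral>\<^sup>+ y. (1 / \<nu>c n * A) * indicator {z \<in> space g. c (snd z) = n} y \<partial>g)"
        by (intro nn_integral_cong) (auto simp: indicator_def)
      also have "\<dots> = (1 / \<nu>c n * A) * \<nu>c n"
        by (subst nn_integral_cmult_indicator) (auto simp: cell[OF that(1,2)])
      also have "\<dots> = A"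
        using inv[OF n] by (metis mult.commute mult.left_commute mult_1)
      finally show ?thesis .
    qed
    show "(\<integral>\<^sup>+ z. F (fst z) \<partial>P) = (\<integral>\<^sup>+ x. F x \<partial>\<gamma>\<^sub>1)" if [measurable]: "F \<in> borel_measurable \<gamma>\<^sub>1" for F
    proof -
      have "(\<integral>\<^sup>+ z. F (fst z) \<partial>P) = (\<integral>\<^sup>+ x. \<integral>\<^sup>+ y. w (x, y) * F x \<partial>\<gamma>\<^sub>2 \<partial>\<gamma>\<^sub>1)"
        unfolding P_def by (subst nn_integral_density) (auto simp: g2.nn_integral_fst[symmetric])
      also have "\<dots> = (\<integral>\<^sup>+ x. F x \<partial>\<gamma>\<^sub>1)"
      proof (rule nn_integral_cong_AE, use pos[OF sets_eq(1) marginals(1)] in eventually_elim)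
        case (elim x)
        have "w (x, y) = (if c (snd y) = c (snd x) then 1 / \<nu>c (c (snd x)) else 0)" for y
          by (auto simp: w_def)
        then show ?case
          using weight[OF sets_eq(2) marginals(2) elim] by simp
      qed
      finally show ?thesis .
    qed
    show "(\<integral>\<^sup>+ z. F (snd z) \<partial>P) = (\<integral>\<^sup>+ x. F x \<partial>\<gamma>\<^sub>2)" if [measurable]: "F \<in> borel_measurable \<gamma>\<^sub>2" for F
    proof -
      have "(\<integral>\<^sup>+ z. F (snd z) \<partial>P) = (\<integral>\<^sup>+ y. \<integral>\<^sup>+ x. w (x, y) * F y \<partial>\<gamma>\<^sub>1 \<partial>\<gamma>\<^sub>2)"
        unfolding P_def by (subst nn_integral_density) (auto simp: nn_integral_snd[symmetric] split_beta')
      also have "\<dots> = (\<integral>\<^sup>+ y. F y \<partial>\<gamma>\<^sub>2)"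
      proof (rule nn_integral_cong_AE, use pos[OF sets_eq(2) marginals(2)] in eventually_elim)
        case (elim y)
        have "w (x, y) = (if c (snd x) = c (snd y) then 1 / \<nu>c (c (snd y)) else 0)" for x
          by (simp add: w_def)
        then show ?case
          using weight[OF sets_eq(1) marginals(1) elim] by simp
      qed
      finally show ?thesis .
    qed
  qed
qed

text \<open>The second distance is oriented as \<open>wasserstein dist q \<rho> \<nu>\<close>: \<nu>
  is then the second marginal of both couplings, as \<open>approximate_gluing\<close> asks, and
  symmetry of the distance is not invoked.\<close>

lemma wasserstein_triangle:
  fixes \<mu> \<nu> \<rho> :: "'a :: {metric_space, second_countable_topology} measure"
  assumes sets_eq: "sets \<mu> = sets borel" "sets \<nu> = sets borel" "sets \<rho> = sets borel"
    and prob: "prob_space \<mu>" "prob_space \<rho>" and q: "1 \<le> q"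
  shows "wasserstein dist q \<mu> \<rho> \<le> wasserstein dist q \<mu> \<nu> + wasserstein dist q \<rho> \<nu>"
proof (rule ennreal_le_epsilon)
  note [measurable_cong] = sets_eq
  fix e :: real
  assume fin: "wasserstein dist q \<mu> \<nu> + wasserstein dist q \<rho> \<nu> < \<top>" and e: "0 < e"
  obtain a where a: "wasserstein dist q \<mu> \<nu> = ennreal a" "0 \<le> a"
    using fin by (cases "wasserstein dist q \<mu> \<nu>") auto
  obtain b where b: "wasserstein dist q \<rho> \<nu> = ennreal b" "0 \<le> b"
    using fin by (cases "wasserstein dist q \<rho> \<nu>") auto
  \<comment> \<open>The slack \<open>e\<close> covers three losses of \<open>e / 3\<close>: one for
    each near-optimal coupling, and one for the gap between the two copies of the
    \<nu>-component.\<close>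
  let ?A = "a + e / 3" and ?B = "b + e / 3"
  have AB: "0 \<le> ?A" "0 \<le> ?B" "wasserstein dist q \<mu> \<nu> < ennreal ?A" "wasserstein dist q \<rho> \<nu> < ennreal ?B"
    using a b e by (auto simp: ennreal_less_iff simp del: ennreal_plus)
  obtain \<gamma>\<^sub>1 where g1: "\<gamma>\<^sub>1 \<in> couplings \<mu> \<nu>"
      "(\<integral>\<^sup>+ z. ennreal (dist (fst z) (snd z) powr q) \<partial>\<gamma>\<^sub>1) \<le> ennreal (?A powr q)"
    using wasserstein_lessE[OF AB(3)] q AB by auto
  obtain \<gamma>\<^sub>2 where g2: "\<gamma>\<^sub>2 \<in> couplings \<rho> \<nu>"
      "(\<integral>\<^sup>+ z. ennreal (dist (fst z) (snd z) powr q) \<partial>\<gamma>\<^sub>2) \<le> ennreal (?B powr q)"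
    using wasserstein_lessE[OF AB(4)] q AB by auto
  have s1 [measurable_cong]: "sets \<gamma>\<^sub>1 = sets (borel \<Otimes>\<^sub>M borel)"
    using couplingsD(1)[OF g1(1)] sets_eq by (metis sets_pair_measure_cong)
  have s2 [measurable_cong]: "sets \<gamma>\<^sub>2 = sets (borel \<Otimes>\<^sub>M borel)"
    using couplingsD(1)[OF g2(1)] sets_eq by (metis sets_pair_measure_cong)
  have m1: "distr \<gamma>\<^sub>1 borel snd = \<nu>" "distr \<gamma>\<^sub>1 borel fst = \<mu>"
    using couplingsD(2,3)[OF g1(1)] sets_eq by (metis distr_cong)+
  have m2: "distr \<gamma>\<^sub>2 borel snd = \<nu>" "distr \<gamma>\<^sub>2 borel fst = \<rho>"
    using couplingsD(2,3)[OF g2(1)] sets_eq by (metis distr_cong)+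
  obtain P where P [measurable_cong]: "sets P = sets (\<gamma>\<^sub>1 \<Otimes>\<^sub>M \<gamma>\<^sub>2)"
    and P1: "\<And>F. F \<in> borel_measurable \<gamma>\<^sub>1 \<Longrightarrow> (\<integral>\<^sup>+ z. F (fst z) \<partial>P) = (\<integral>\<^sup>+ x. F x \<partial>\<gamma>\<^sub>1)"
    and P2: "\<And>F. F \<in> borel_measurable \<gamma>\<^sub>2 \<Longrightarrow> (\<integral>\<^sup>+ z. F (snd z) \<partial>P) = (\<integral>\<^sup>+ x. F x \<partial>\<gamma>\<^sub>2)"
    and near: "AE z in P. dist (snd (fst z)) (snd (snd z)) \<le> e / 3"
    using approximate_gluing[OF s1 s2 m1(1) m2(1) prob_space_coupling[OF g1(1) prob(1)]
        prob_space_coupling[OF g2(1) prob(2)], of "e / 3"] e by auto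
  have "emeasure P (space P) = 1"
    using P1[of "\<lambda>_. 1"] prob_space.emeasure_space_1[OF prob_space_coupling[OF g1(1) prob(1)]] by simp
  define G where "G = distr P (borel \<Otimes>\<^sub>M borel) (\<lambda>z. (fst (fst z), fst (snd z)))"
  have G: "G \<in> couplings \<mu> \<rho>"
  proof (rule couplingsI)
    fix F :: "'a \<Rightarrow> ennreal" assume [measurable]: "F \<in> borel_measurable borel"
    show "(\<integral>\<^sup>+ s. F (fst s) \<partial>G) = (\<integral>\<^sup>+ x. F x \<partial>\<mu>)"
      by (subst m1(2)[symmetric]) (simp add: G_def nn_integral_distr P1[of "\<lambda>z. F (fst z)"])
    show "(\<integral>\<^sup>+ s. F (snd s) \<partial>G) = (\<integral>\<^sup>+ x. F x \<partial>\<rho>)"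
      by (subst m2(2)[symmetric]) (simp add: G_def nn_integral_distr P2[of "\<lambda>z. F (fst z)"])
  qed (simp_all add: G_def sets_eq)
  have const: "(\<integral>\<^sup>+ z. ennreal ((e / 3) powr q) \<partial>P) \<le> ennreal ((e / 3) powr q)"
    using \<open>emeasure P (space P) = 1\<close> by simp
  have second: "(\<integral>\<^sup>+ z. ennreal ((dist (fst (snd z)) (snd (snd z)) + e / 3) powr q) \<partial>P) \<le> ennreal ((?B + e / 3) powr q)"
    using AB e q g2(2) by (intro nn_integral_powr_add_le const) (auto simp: P2[of "\<lambda>z. ennreal (dist (fst z) (snd z) powr q)"])
  have "(\<integral>\<^sup>+ z. ennreal ((dist (fst (fst z)) (snd (fst z)) + (dist (fst (snd z)) (snd (snd z)) + e / 3)) powr q) \<partial>P)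
      \<le> ennreal ((?A + (?B + e / 3)) powr q)"
    by (rule nn_integral_powr_add_le) (use AB e q g1(2) second in \<open>auto simp: P1[of "\<lambda>z. ennreal (dist (fst z) (snd z) powr q)"]\<close>)
  moreover have "(\<integral>\<^sup>+ z. ennreal (dist (fst z) (snd z) powr q) \<partial>G)
      \<le> (\<integral>\<^sup>+ z. ennreal ((dist (fst (fst z)) (snd (fst z)) + (dist (fst (snd z)) (snd (snd z)) + e / 3)) powr q) \<partial>P)"
    unfolding G_def
  proof (subst nn_integral_distr, measurable, rule nn_integral_mono_AE, use near in eventually_elim)
    fix z :: "('a \<times> 'a) \<times> ('a \<times> 'a)"
    assume "dist (snd (fst z)) (snd (snd z)) \<le> e / 3"
    then have "dist (fst (fst z)) (fst (snd z))
        \<le> dist (fst (fst z)) (snd (fst z)) + (dist (fst (snd z)) (snd (snd z)) + e / 3)"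
      using dist_triangle[of "fst (fst z)" "fst (snd z)" "snd (fst z)"]
        dist_triangle[of "snd (fst z)" "fst (snd z)" "snd (snd z)"]
      by (simp add: dist_commute)
    then show "ennreal (dist (fst (fst (fst z), fst (snd z))) (snd (fst (fst z), fst (snd z))) powr q)
        \<le> ennreal ((dist (fst (fst z)) (snd (fst z)) + (dist (fst (snd z)) (snd (snd z)) + e / 3)) powr q)"
      using q by (intro ennreal_leI powr_mono2) auto
  qed
  ultimately have "wasserstein dist q \<mu> \<rho> \<le> ennreal (?A + (?B + e / 3))"
    using AB e q by (intro wasserstein_le[OF G]) (auto intro: order.trans)
  also have "\<dots> = wasserstein dist q \<mu> \<nu> + wasserstein dist q \<rho> \<nu> + ennreal e"
    using a b e by (simp flip: ennreal_plus)
  finally show "wasserstein dist q \<mu> \<rho> \<le> wasserstein dist q \<mu> \<nu> + wasserstein dist q \<rho> \<nu> + ennreal e" .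
qed

section \<open>Gibbs measures and Gaussian vectors\<close>

lemma nn_integral_lborel_affine:
  fixes F :: "'a :: euclidean_space \<Rightarrow> ennreal"
  assumes [measurable]: "F \<in> borel_measurable borel" and c: "c \<noteq> 0"
  shows "(\<integral>\<^sup>+ x. F (t + c *\<^sub>R x) \<partial>lborel) = (\<integral>\<^sup>+ x. ennreal (1 / \<bar>c\<bar> ^ DIM('a)) * F x \<partial>lborel)"
proof -
  have "(\<integral>\<^sup>+ x. ennreal (1 / \<bar>c\<bar> ^ DIM('a)) * F x \<partial>lborel)
      = (\<integral>\<^sup>+ x. ennreal (1 / \<bar>c\<bar> ^ DIM('a)) * F x \<partial>density (distr lborel borel (\<lambda>x. t + c *\<^sub>R x)) (\<lambda>_. \<bar>c\<bar> ^ DIM('a)))"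
    using lborel_affine[of c t] c by simp
  also have "\<dots> = (\<integral>\<^sup>+ x. ennreal (\<bar>c\<bar> ^ DIM('a)) * (ennreal (1 / \<bar>c\<bar> ^ DIM('a)) * F (t + c *\<^sub>R x)) \<partial>lborel)"
    using c by (simp add: nn_integral_density nn_integral_distr)
  also have "\<dots> = (\<integral>\<^sup>+ x. F (t + c *\<^sub>R x) \<partial>lborel)"
    using c by (simp add: mult.assoc[symmetric] flip: ennreal_mult)
  finally show ?thesis ..
qed

lemma nn_integral_lborel_translate:
  fixes F :: "'a :: euclidean_space \<Rightarrow> ennreal"
  assumes "F \<in> borel_measurable borel"
  shows "(\<integral>\<^sup>+ x. F (t + x) \<partial>lborel) = (\<integral>\<^sup>+ x. F x \<partial>lborel)"
  using nn_integral_lborel_affine[OF assms, of 1 t] by simp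

text \<open>Because \<open>(exp (y / 2) - exp (- y / 2))^2 = exp y + exp (- y) - 2\<close>, the
  claim reduces to 2 sinh z >= 2 z at \<open>z = \<bar>y / 2\<bar>\<close>.\<close>

lemma square_plus_2_le_exp:
  fixes y :: real
  shows "y^2 + 2 \<le> exp y + exp (- y)"
proof -
  have sinh: "2 * z \<le> exp z - exp (- z)" if "0 \<le> z" for z :: real
  proof -
    \<comment> \<open>The quadratic Taylor polynomial is precise enough:
      \<open>s * s - 1 - 2 * z * s\<close> equals \<open>z ^ 4 / 4\<close>.\<close>
    define s where "s = 1 + z + z^2 / 2"
    have s: "0 < s" "s \<le> exp z"
      using exp_lower_Taylor_quadratic[OF that] that by (auto simp: s_def intro!: add_pos_nonneg)
    have "2 * z * s \<le> s * s - 1"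
      using that unfolding s_def by (simp add: field_simps power2_eq_square)
    then have "2 * z \<le> s - 1 / s"
      using s by (simp add: field_simps)
    also have "\<dots> \<le> exp z - exp (- z)"
      using s by (simp add: exp_minus inverse_eq_divide frac_le diff_mono)
    finally show ?thesis .
  qed
  have "(2 * \<bar>y / 2\<bar>)^2 \<le> (exp \<bar>y / 2\<bar> - exp (- \<bar>y / 2\<bar>))^2"
    by (intro power_mono sinh) auto
  also have "\<dots> = exp \<bar>y\<bar> + exp (- \<bar>y\<bar>) - 2"
    by (simp add: power2_eq_square algebra_simps flip: exp_add)
  finally show ?thesis
    by (cases "0 \<le> y") auto
qed

text \<open>
  Translation invariance of Lebesgue measure bounds the exponential moments of the gradient
  of the potential and replaces integration by parts. The Gaussian measure is the instance
  \<open>U x = norm x ^ 2 / 2\<close>, \<open>g x = x\<close>.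
\<close>

locale gibbs_measure =
  fixes U :: "'a :: euclidean_space \<Rightarrow> real" and g :: "'a \<Rightarrow> 'a" and L k :: real
  assumes U_measurable [measurable]: "U \<in> borel_measurable borel"
    and g_measurable: "g \<in> borel_measurable borel"
    and quadratic_upper: "U y \<le> U x + g x \<bullet> (y - x) + L / 2 * (norm (y - x))^2"
    and L_nonneg: "0 \<le> L" and k_nonneg: "0 \<le> k"
    and total_mass: "(\<integral>\<^sup>+ x. ennreal (k * exp (- U x)) \<partial>lborel) = 1"
begin

definition gibbs :: "'a measure" where
  "gibbs = density lborel (\<lambda>x. ennreal (k * exp (- U x)))"

lemma sets_gibbs [simp, measurable_cong]: "sets gibbs = sets borel"
  by (simp add: gibbs_def)

lemma space_gibbs [simp]: "space gibbs = UNIV"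
  by (simp add: gibbs_def)

sublocale prob_space gibbs
  by standard (simp add: gibbs_def emeasure_density total_mass)

text \<open>\<open>quadratic_upper\<close> at \<open>y = x - v\<close> bounds the integrand by a
  constant times the Gibbs density translated by \<open>v\<close>, whose mass is still 1. The
  gradient is thus sub-Gaussian with variance factor \<open>L\<close>.\<close>

lemma nn_integral_exp_gradient_le:
  "(\<integral>\<^sup>+ x. ennreal (exp (g x \<bullet> v)) \<partial>gibbs) \<le> ennreal (exp (L * (norm v)^2 / 2))"
proof -
  note [measurable] = g_measurable
  let ?c = "exp (L * (norm v)^2 / 2)"
  have le: "k * exp (- U x) * exp (g x \<bullet> v) \<le> ?c * (k * exp (- U (- v + x)))" for x
  proof -
    have "- U x + g x \<bullet> v \<le> L * (norm v)^2 / 2 + (- U (- v + x))"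
      using quadratic_upper[of "- v + x" x] by simp
    then have "exp (- U x) * exp (g x \<bullet> v) \<le> ?c * exp (- U (- v + x))"
      by (simp flip: exp_add)
    then have "k * (exp (- U x) * exp (g x \<bullet> v)) \<le> k * (?c * exp (- U (- v + x)))"
      using k_nonneg by (rule mult_left_mono)
    then show ?thesis
      by (simp add: mult_ac)
  qed
  have "(\<integral>\<^sup>+ x. ennreal (exp (g x \<bullet> v)) \<partial>gibbs)
      = (\<integral>\<^sup>+ x. ennreal (k * exp (- U x) * exp (g x \<bullet> v)) \<partial>lborel)"
    using k_nonneg unfolding gibbs_def by (subst nn_integral_density) (auto simp: ennreal_mult)
  also have "\<dots> \<le> (\<integral>\<^sup>+ x. ennreal ?c * ennreal (k * exp (- U (- v + x))) \<partial>lborel)"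
    using k_nonneg le by (intro nn_integral_mono) (simp flip: ennreal_mult)
  also have "\<dots> = ennreal ?c * (\<integral>\<^sup>+ x. ennreal (k * exp (- U (- v + x))) \<partial>lborel)"
    by (simp add: nn_integral_cmult)
  also have "\<dots> = ennreal ?c"
    by (subst nn_integral_lborel_translate) (auto simp: total_mass)
  finally show ?thesis .
qed

text \<open>Second-order expansion at \<open>t = 0\<close> of the exponential moments in the
  directions \<open>t *\<^sub>R b\<close> and \<open>- t *\<^sub>R b\<close>;
  \<open>square_plus_2_le_exp\<close> extracts the square from their sum.\<close>

lemma nn_integral_gradient_component_square_le:
  assumes "norm b = 1"
  shows "(\<integral>\<^sup>+ x. ennreal ((g x \<bullet> b)^2) \<partial>gibbs) \<le> ennreal L"
proof -
  note [measurable] = g_measurable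
  define I where "I = (\<integral>\<^sup>+ x. ennreal ((g x \<bullet> b)^2) \<partial>gibbs)"
  have bound: "ennreal (t^2) * I + 2 \<le> ennreal (2 * exp (L * t^2 / 2))" for t
  proof -
    have "ennreal (t^2) * I + 2 = (\<integral>\<^sup>+ x. ennreal (t^2) * ennreal ((g x \<bullet> b)^2) + 2 \<partial>gibbs)"
      unfolding I_def by (simp add: nn_integral_add nn_integral_cmult emeasure_space_1[simplified])
    also have "\<dots> \<le> (\<integral>\<^sup>+ x. ennreal (exp (g x \<bullet> (t *\<^sub>R b))) + ennreal (exp (g x \<bullet> (- t *\<^sub>R b))) \<partial>gibbs)"
    proof (rule nn_integral_mono)
      fix x
      have "ennreal (t^2) * ennreal ((g x \<bullet> b)^2) + 2 = ennreal ((t * (g x \<bullet> b))^2 + 2)"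
        by (simp add: power_mult_distrib ennreal_mult)
      also have "\<dots> \<le> ennreal (exp (t * (g x \<bullet> b)) + exp (- (t * (g x \<bullet> b))))"
        by (intro ennreal_leI square_plus_2_le_exp)
      finally show "ennreal (t^2) * ennreal ((g x \<bullet> b)^2) + 2
          \<le> ennreal (exp (g x \<bullet> (t *\<^sub>R b))) + ennreal (exp (g x \<bullet> (- t *\<^sub>R b)))"
        by simp
    qed
    also have "\<dots> \<le> ennreal (exp (L * t^2 / 2)) + ennreal (exp (L * t^2 / 2))"
      using nn_integral_exp_gradient_le[of "t *\<^sub>R b"] nn_integral_exp_gradient_le[of "- t *\<^sub>R b"] assms
      by (subst nn_integral_add) (auto intro!: add_mono)
    finally show ?thesis
      by (simp flip: ennreal_plus)
  qed
  \<comment> \<open>Finiteness comes first, since the division by \<open>t^2\<close> below takes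
    place in the reals.\<close>
  have "I < \<top>"
    using bound[of 1] by (cases I) (auto simp: top_unique)
  then obtain i where i: "I = ennreal i" "0 \<le> i"
    by (cases I) auto
  have "i \<le> (exp (L / 2 * t^2) - 1) * 2 / t^2" if "t \<noteq> 0" for t
  proof -
    have "ennreal (t^2 * i + 2) \<le> ennreal (2 * exp (L * t^2 / 2))"
      using bound[of t] i by (simp add: ennreal_mult)
    then have "t^2 * i + 2 \<le> 2 * exp (L * t^2 / 2)"
      by (subst (asm) ennreal_le_iff) auto
    then show ?thesis
      using that by (simp add: field_simps)
  qed
  then have "eventually (\<lambda>t. i \<le> (exp (L / 2 * t^2) - 1) * 2 / t^2) (at_right 0)"
    by (auto simp: eventually_at_filter)
  moreover have "((\<lambda>t :: real. (exp (L / 2 * t^2) - 1) * 2 / t^2) \<longlongrightarrow> L) (at_right 0)"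
    by real_asymp
  ultimately have "i \<le> L"
    by (intro tendsto_lowerbound[of _ L "at_right (0 :: real)"]) auto
  then show ?thesis
    using i by (simp add: I_def)
qed

text \<open>Source of the factor \<open>sqrt (L * CARD('n))\<close> in the bias of one step: the
  root mean square of the gradient under its own Gibbs measure.\<close>

lemma nn_integral_norm_gradient_square_le:
  "(\<integral>\<^sup>+ x. ennreal ((norm (g x))^2) \<partial>gibbs) \<le> ennreal (L * DIM('a))"
proof -
  note [measurable] = g_measurable
  have "(\<integral>\<^sup>+ x. ennreal ((norm (g x))^2) \<partial>gibbs) = (\<integral>\<^sup>+ x. (\<Sum>b\<in>Basis. ennreal ((g x \<bullet> b)^2)) \<partial>gibbs)"
    by (intro nn_integral_cong)
      (simp add: power2_norm_eq_inner euclidean_inner[of "g _" "g _"] flip: power2_eq_square)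
  also have "\<dots> = (\<Sum>b\<in>Basis. \<integral>\<^sup>+ x. ennreal ((g x \<bullet> b)^2) \<partial>gibbs)"
    by (rule nn_integral_sum) measurable
  also have "\<dots> \<le> (\<Sum>b\<in>(Basis :: 'a set). ennreal L)"
    by (intro sum_mono nn_integral_gradient_component_square_le) auto
  also have "\<dots> = ennreal (L * DIM('a))"
    using L_nonneg by (simp add: ennreal_mult mult.commute ennreal_of_nat_eq_real_of_nat)
  finally show ?thesis .
qed

text \<open>By \<open>1 + y \<le> exp y\<close> the power is at most
  \<open>exp (m * c * norm (g x))\<close>. The norm is at most the dimension times the largest
  coordinate, so the exponential along \<open>t *\<^sub>R b\<close> or
  \<open>- t *\<^sub>R b\<close> for that coordinate is a majorant.\<close>

lemma nn_integral_norm_gradient_moment_finite: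
  assumes "0 \<le> c"
  shows "(\<integral>\<^sup>+ x. ennreal ((1 + c * norm (g x)) ^ m) \<partial>gibbs) < \<top>"
proof -
  note [measurable] = g_measurable
  define t where "t = m * c * DIM('a)"
  have t: "0 \<le> t"
    using assms by (simp add: t_def)
  have le: "(1 + c * norm (g x)) ^ m \<le> (\<Sum>b\<in>Basis. exp (g x \<bullet> (t *\<^sub>R b)) + exp (g x \<bullet> (- t *\<^sub>R b)))" for x
  proof -
    have "Max ((\<lambda>b. \<bar>g x \<bullet> b\<bar>) ` Basis) \<in> (\<lambda>b. \<bar>g x \<bullet> b\<bar>) ` Basis"
      by (intro Max_in) auto
    then obtain b where b: "b \<in> Basis" "Max ((\<lambda>b. \<bar>g x \<bullet> b\<bar>) ` Basis) = \<bar>g x \<bullet> b\<bar>"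
      by blast
    have "norm (g x) \<le> (\<Sum>b\<in>Basis. \<bar>g x \<bullet> b\<bar>)"
      by (rule norm_le_l1)
    also have "\<dots> \<le> DIM('a) * \<bar>g x \<bullet> b\<bar>"
      using b(2) by (intro sum_bounded_above) (metis Max_ge finite_Basis finite_imageI imageI)
    finally have "m * c * norm (g x) \<le> m * c * (DIM('a) * \<bar>g x \<bullet> b\<bar>)"
      using assms by (intro mult_left_mono) auto
    then have bd: "m * (c * norm (g x)) \<le> \<bar>t * (g x \<bullet> b)\<bar>"
      using assms by (simp add: t_def abs_mult mult_ac)
    have "(1 + c * norm (g x)) ^ m \<le> exp (c * norm (g x)) ^ m"
      using assms by (intro power_mono exp_ge_add_one_self) auto
    also have "\<dots> = exp (m * (c * norm (g x)))"
      by (rule exp_of_nat_mult[symmetric])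
    also have "\<dots> \<le> exp \<bar>t * (g x \<bullet> b)\<bar>"
      using bd by simp
    also have "\<dots> \<le> exp (g x \<bullet> (t *\<^sub>R b)) + exp (g x \<bullet> (- t *\<^sub>R b))"
      by (cases "0 \<le> t * (g x \<bullet> b)") auto
    also have "\<dots> \<le> (\<Sum>b\<in>Basis. exp (g x \<bullet> (t *\<^sub>R b)) + exp (g x \<bullet> (- t *\<^sub>R b)))"
      using b(1) by (intro member_le_sum) auto
    finally show ?thesis .
  qed
  have "(\<integral>\<^sup>+ x. ennreal ((1 + c * norm (g x)) ^ m) \<partial>gibbs)
      \<le> (\<integral>\<^sup>+ x. (\<Sum>b\<in>Basis. ennreal (exp (g x \<bullet> (t *\<^sub>R b))) + ennreal (exp (g x \<bullet> (- t *\<^sub>R b)))) \<partial>gibbs)"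
    by (intro nn_integral_mono) (use le in \<open>simp add: add_nonneg_nonneg ennreal_leI flip: ennreal_plus\<close>)
  also have "\<dots> = (\<Sum>b\<in>Basis. (\<integral>\<^sup>+ x. ennreal (exp (g x \<bullet> (t *\<^sub>R b))) \<partial>gibbs)
      + (\<integral>\<^sup>+ x. ennreal (exp (g x \<bullet> (- t *\<^sub>R b))) \<partial>gibbs))"
    by (simp add: nn_integral_sum nn_integral_add)
  also have "\<dots> < \<top>"
    by (simp del: inner_scaleR_right scaleR_minus_left
        add: order.strict_trans1[OF nn_integral_exp_gradient_le ennreal_less_top])
  finally show ?thesis .
qed

lemma norm_gradient_moment_bound:
  obtains S where "0 < S" "(\<integral>\<^sup>+ x. ennreal ((1 + norm (g x)) ^ m) \<partial>gibbs) \<le> ennreal S"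
proof -
  obtain S where "(\<integral>\<^sup>+ x. ennreal ((1 + norm (g x)) ^ m) \<partial>gibbs) = ennreal S" "0 \<le> S"
    using nn_integral_norm_gradient_moment_finite[of 1 m]
    by (cases "\<integral>\<^sup>+ x. ennreal ((1 + norm (g x)) ^ m) \<partial>gibbs") auto
  then show thesis
    by (intro that[of "S + 1"]) (auto simp del: ennreal_plus intro: ennreal_leI)
qed

end

section \<open>The standard Gaussian measure\<close>

definition gaussian :: "(real ^ 'n) measure" where
  "gaussian = density lborel (\<lambda>x. ennreal (std_gaussian_density x))"

lemma std_gaussian_density_eq:
  "std_gaussian_density (x :: real ^ 'n) = (1 / sqrt (2 * pi)) ^ CARD('n) * exp (- ((norm x)^2 / 2))"
proof -
  have "(\<Prod>i\<in>UNIV. exp (- ((x $ i)^2) / 2)) = exp (- ((norm x)^2 / 2))"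
    by (simp add: norm_vec_def L2_set_def sum_nonneg sum_negf sum_divide_distrib flip: exp_sum)
  then show ?thesis
    by (simp add: std_gaussian_density_def std_normal_density_def prod.distrib prod_dividef power_divide)
qed

lemma std_gaussian_density_nonneg: "0 \<le> std_gaussian_density x"
  by (simp add: std_gaussian_density_eq)

lemma std_gaussian_density_measurable [measurable]: "std_gaussian_density \<in> borel_measurable borel"
  unfolding std_gaussian_density_eq[abs_def] by measurable

lemma nn_integral_std_gaussian_density:
  "(\<integral>\<^sup>+ x. ennreal (std_gaussian_density (x :: real ^ 'n)) \<partial>lborel) = 1"
proof -
  have Basis: "Basis = range (\<lambda>i :: 'n. axis i (1 :: real))" and inj: "inj (\<lambda>i :: 'n. axis i (1 :: real))"
    by (auto simp: Basis_vec_def inj_on_def axis_eq_axis)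
  have "(\<integral>\<^sup>+ x. ennreal (std_gaussian_density (x :: real ^ 'n)) \<partial>lborel)
      = (\<integral>\<^sup>+ x. (\<Prod>b\<in>Basis. ennreal (std_normal_density ((x :: real ^ 'n) \<bullet> b))) \<partial>lborel)"
    unfolding Basis by (simp add: prod.reindex[OF inj] std_gaussian_density_def prod_ennreal inner_axis)
  also have "\<dots> = (\<Prod>b\<in>(Basis :: (real ^ 'n) set). \<integral>\<^sup>+ x. ennreal (std_normal_density x) \<partial>lborel)"
    by (subst nn_integral_lborel_prod[where f = "\<lambda>_ x. ennreal (std_normal_density x)"]) auto
  also have "(\<integral>\<^sup>+ x. ennreal (std_normal_density x) \<partial>lborel) = 1"
    by (subst nn_integral_eq_integral) auto
  finally show ?thesis
    by simp
qed

interpretation gaussian: gibbs_measure "\<lambda>x :: real ^ 'n. (norm x)^2 / 2" "\<lambda>x. x" 1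
  "(1 / sqrt (2 * pi)) ^ CARD('n)"
  rewrites "gibbs_measure.gibbs (\<lambda>x :: real ^ 'n. (norm x)^2 / 2) ((1 / sqrt (2 * pi)) ^ CARD('n)) = gaussian"
proof -
  show *: "gibbs_measure (\<lambda>x :: real ^ 'n. (norm x)^2 / 2) (\<lambda>x. x) 1 ((1 / sqrt (2 * pi)) ^ CARD('n))"
  proof
    show "(norm y)^2 / 2 \<le> (norm x)^2 / 2 + x \<bullet> (y - x) + 1 / 2 * (norm (y - x))^2" for x y :: "real ^ 'n"
      by (simp add: power2_norm_eq_inner inner_diff_left inner_diff_right inner_commute field_simps)
    show "(\<integral>\<^sup>+ x. ennreal ((1 / sqrt (2 * pi)) ^ CARD('n) * exp (- ((norm (x :: real ^ 'n))^2 / 2))) \<partial>lborel) = 1"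
      using nn_integral_std_gaussian_density[where 'n = 'n] by (simp add: std_gaussian_density_eq)
  qed (auto simp: )
  show "gibbs_measure.gibbs (\<lambda>x :: real ^ 'n. (norm x)^2 / 2) ((1 / sqrt (2 * pi)) ^ CARD('n)) = gaussian"
    unfolding gibbs_measure.gibbs_def[OF *] gaussian_def std_gaussian_density_eq ..
qed

lemma integrable_gaussian_moment:
  assumes "0 \<le> c"
  shows "integrable gaussian (\<lambda>z :: real ^ 'n. (1 + c * norm z) ^ m)"
  using gaussian.nn_integral_norm_gradient_moment_finite[OF assms] assms
  by (intro integrableI_bounded) auto

lemma integrable_gaussian_id: "integrable gaussian (\<lambda>z :: real ^ 'n. z)"
proof (rule Bochner_Integration.integrable_bound[OF integrable_gaussian_moment[of 1 1]])
  show "(\<lambda>z. z) \<in> borel_measurable (gaussian :: (real ^ 'n) measure)"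
    by (simp add: gaussian_def)
  show "AE z in (gaussian :: (real ^ 'n) measure). norm z \<le> norm ((1 + 1 * norm z) ^ 1)"
    by (intro AE_I2) simp
qed simp

lemma integral_gaussian_id: "integral\<^sup>L gaussian (\<lambda>z :: real ^ 'n. z) = 0"
proof -
  have "distr gaussian borel uminus = (gaussian :: (real ^ 'n) measure)"
  proof (rule measure_eqI)
    fix A :: "(real ^ 'n) set" assume "A \<in> sets (distr gaussian borel uminus)"
    then have [measurable]: "A \<in> sets borel"
      by simp
    have "emeasure (distr gaussian borel uminus) A = emeasure gaussian (uminus -` A)"
      by (subst emeasure_distr) (auto simp: gaussian_def)
    moreover have "uminus -` A \<in> sets borel"
      using measurable_sets_borel[of uminus borel A] by simp
    ultimately have "emeasure (distr gaussian borel uminus) A = (\<integral>\<^sup>+ x. ennreal (std_gaussian_density x) * indicator A (- x) \<partial>lborel)"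
      by (simp add: gaussian_def emeasure_density indicator_vimage comp_def)
    also have "\<dots> = (\<integral>\<^sup>+ x. ennreal (std_gaussian_density x) * indicator A x \<partial>lborel)"
      using nn_integral_lborel_affine[where c = "-1" and t = 0
          and F = "\<lambda>x. ennreal (std_gaussian_density x) * indicator A x"]
      by (simp add: std_gaussian_density_eq)
    also have "\<dots> = emeasure gaussian A"
      unfolding gaussian_def by (subst emeasure_density) auto
    finally show "emeasure (distr gaussian borel uminus) A = emeasure gaussian A" .
  qed simp
  then have "integral\<^sup>L gaussian (\<lambda>z :: real ^ 'n. z) = integral\<^sup>L (distr gaussian borel uminus) (\<lambda>z :: real ^ 'n. z)"
    by simp
  also have "\<dots> = integral\<^sup>L gaussian (\<lambda>z :: real ^ 'n. - z)"
    by (rule integral_distr) (simp_all add: gaussian_def)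
  also have "\<dots> = - integral\<^sup>L gaussian (\<lambda>z :: real ^ 'n. z)"
    by (rule Bochner_Integration.integral_minus)
  finally have "2 *\<^sub>R integral\<^sup>L gaussian (\<lambda>z :: real ^ 'n. z) = 0"
    unfolding eq_neg_iff_add_eq_0 scaleR_2 .
  then show ?thesis
    by simp
qed

lemma integral_gaussian_norm_square_le:
  "integrable gaussian (\<lambda>z :: real ^ 'n. (norm z)^2)"
  "integral\<^sup>L gaussian (\<lambda>z :: real ^ 'n. (norm z)^2) \<le> CARD('n)"
proof -
  show int: "integrable gaussian (\<lambda>z :: real ^ 'n. (norm z)^2)"
    using order.strict_trans1[OF gaussian.nn_integral_norm_gradient_square_le[where 'n = 'n] ennreal_less_top]
    by (intro integrableI_bounded) auto
  have "ennreal (integral\<^sup>L gaussian (\<lambda>z :: real ^ 'n. (norm z)^2)) \<le> ennreal (CARD('n))"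
    using gaussian.nn_integral_norm_gradient_square_le[where 'n = 'n] int
    by (subst nn_integral_eq_integral[symmetric]) auto
  then show "integral\<^sup>L gaussian (\<lambda>z :: real ^ 'n. (norm z)^2) \<le> CARD('n)"
    by (subst (asm) ennreal_le_iff) auto
qed

text \<open>Change of variables to the density of N(t, c^2 I). With
  \<open>t = x - \<eta> *\<^sub>R g x\<close> and \<open>c = sqrt (2 * \<eta>)\<close> it becomes
  the transition density of the Langevin proposal.\<close>

lemma nn_integral_gaussian_affine:
  fixes F :: "real ^ 'n \<Rightarrow> ennreal"
  assumes [measurable]: "F \<in> borel_measurable borel" and c: "0 < c"
  shows "(\<integral>\<^sup>+ z. F (t + c *\<^sub>R z) \<partial>gaussian)
      = (\<integral>\<^sup>+ y. ennreal (std_gaussian_density ((1 / c) *\<^sub>R (y - t)) / c ^ CARD('n)) * F y \<partial>lborel)"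
proof -
  have "(\<integral>\<^sup>+ z. F (t + c *\<^sub>R z) \<partial>gaussian)
      = (\<integral>\<^sup>+ z. ennreal (std_gaussian_density ((1 / c) *\<^sub>R ((t + c *\<^sub>R z) - t))) * F (t + c *\<^sub>R z) \<partial>lborel)"
    unfolding gaussian_def using c by (subst nn_integral_density) auto
  also have "\<dots> = (\<integral>\<^sup>+ y. ennreal (1 / c ^ CARD('n)) * (ennreal (std_gaussian_density ((1 / c) *\<^sub>R (y - t))) * F y) \<partial>lborel)"
    using c by (subst nn_integral_lborel_affine) auto
  also have "\<dots> = (\<integral>\<^sup>+ y. ennreal (std_gaussian_density ((1 / c) *\<^sub>R (y - t)) / c ^ CARD('n)) * F y \<partial>lborel)"
    using c by (intro nn_integral_cong)
      (simp add: std_gaussian_density_nonneg mult.assoc[symmetric] flip: ennreal_mult)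
  finally show ?thesis .
qed

lemma nn_integral_std_gaussian_density_scaled:
  fixes v :: "real ^ 'n"
  assumes b: "0 < b" and c: "0 < c"
  shows "(\<integral>\<^sup>+ x. ennreal (std_gaussian_density ((c / b) *\<^sub>R (x - v))) \<partial>lborel) = ennreal ((b / c) ^ CARD('n))"
proof -
  let ?I = "\<integral>\<^sup>+ y. ennreal (std_gaussian_density ((c / b) *\<^sub>R (y - v))) \<partial>lborel"
  define r where "r = (b / c) ^ CARD('n)"
  have r: "0 < r"
    using b c by (simp add: r_def)
  have bc: "0 < b / c" "1 / (b / c) = c / b"
    using b c by auto
  have "(\<integral>\<^sup>+ y. ennreal (std_gaussian_density ((c / b) *\<^sub>R (y - v)) / r) * 1 \<partial>lborel)
      = (\<integral>\<^sup>+ z. 1 \<partial>(gaussian :: (real ^ 'n) measure))"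
    using nn_integral_gaussian_affine[where F = "\<lambda>_. 1" and t = v, OF _ bc(1)] unfolding bc(2) r_def by simp
  moreover have "(\<integral>\<^sup>+ z. 1 \<partial>(gaussian :: (real ^ 'n) measure)) = 1"
    using gaussian.emeasure_space_1 by simp
  moreover have "(\<integral>\<^sup>+ y. ennreal (std_gaussian_density ((c / b) *\<^sub>R (y - v)) / r) * 1 \<partial>lborel)
      = (\<integral>\<^sup>+ y. ennreal (1 / r) * ennreal (std_gaussian_density ((c / b) *\<^sub>R (y - v))) \<partial>lborel)"
    using r by (intro nn_integral_cong) (subst ennreal_mult[symmetric], auto simp: std_gaussian_density_nonneg)
  moreover have "(\<integral>\<^sup>+ y. ennreal (1 / r) * ennreal (std_gaussian_density ((c / b) *\<^sub>R (y - v))) \<partial>lborel) = ennreal (1 / r) * ?I"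
    by (subst nn_integral_cmult) auto
  ultimately have one: "ennreal (1 / r) * ?I = 1"
    by metis
  have "?I = (ennreal r * ennreal (1 / r)) * ?I"
    using r by (simp flip: ennreal_mult)
  also have "\<dots> = ennreal r"
    unfolding mult.assoc one by simp
  finally show ?thesis
    unfolding r_def .
qed

text \<open>Completing the square: integrating out \<open>x\<close> for fixed
  \<open>u = a *\<^sub>R x + b *\<^sub>R y\<close> leaves the density of N(0, c^2 I). The
  coefficient \<open>a\<close> may be 0, which happens at the first fine step.\<close>

lemma nn_integral_gaussian_add:
  fixes F :: "real ^ 'n \<Rightarrow> ennreal"
  assumes [measurable]: "F \<in> borel_measurable borel"
    and b: "0 < b" and c: "0 < c" and abc: "a^2 + b^2 = c^2"
  shows "(\<integral>\<^sup>+ x. \<integral>\<^sup>+ y. F (t + a *\<^sub>R x + b *\<^sub>R y) \<partial>gaussian \<partial>gaussian) = (\<integral>\<^sup>+ z. F (t + c *\<^sub>R z) \<partial>gaussian)"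
proof -
  let ?\<gamma> = "std_gaussian_density :: real ^ 'n \<Rightarrow> real" and ?n = "CARD('n)"
  \<comment> \<open>The joint density of \<open>x\<close> and \<open>u\<close>, rewritten as the
    density of \<open>u\<close> times that of \<open>x\<close> given \<open>u\<close>: mean
    \<open>(a / c^2) *\<^sub>R u\<close>, standard deviation \<open>b / c\<close>.\<close>
  have key: "?\<gamma> x * ?\<gamma> ((1 / b) *\<^sub>R (u - a *\<^sub>R x)) = ?\<gamma> ((1 / c) *\<^sub>R u) * ?\<gamma> ((c / b) *\<^sub>R (x - (a / c^2) *\<^sub>R u))" for x u
  proof -
    have "(norm x)^2 + (norm ((1 / b) *\<^sub>R (u - a *\<^sub>R x)))^2
        = (norm ((1 / c) *\<^sub>R u))^2 + (norm ((c / b) *\<^sub>R (x - (a / c^2) *\<^sub>R u)))^2"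
    proof -
      have nd: "(norm (y - s *\<^sub>R z))^2 = (norm y)^2 - 2 * s * (y \<bullet> z) + s^2 * (norm z)^2" for y z :: "real ^ 'n" and s
        unfolding power2_norm_eq_inner
        by (simp add: inner_diff_left inner_diff_right inner_commute power2_eq_square algebra_simps)
      have alg: "X + (1 / b)^2 * (W - 2 * a * V + a^2 * X)
          = (1 / c)^2 * W + (c / b)^2 * (X - 2 * (a / c^2) * V + (a / c^2)^2 * W)" for X V W
      proof -
        have a: "a^2 = c^2 - b^2"
          using abc by simp
        show ?thesis
          using b c by (simp add: power_divide a) (simp add: field_simps eval_nat_numeral)
      qed
      have ns: "(norm (s *\<^sub>R y))^2 = s^2 * (norm y)^2" for y :: "real ^ 'n" and s
        by (simp add: power_mult_distrib)
      show ?thesis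
        unfolding ns nd inner_commute[of x u] by (rule alg)
    qed
    then have e: "exp (- ((norm x)^2 / 2)) * exp (- ((norm ((1 / b) *\<^sub>R (u - a *\<^sub>R x)))^2 / 2))
        = exp (- ((norm ((1 / c) *\<^sub>R u))^2 / 2)) * exp (- ((norm ((c / b) *\<^sub>R (x - (a / c^2) *\<^sub>R u)))^2 / 2))"
      unfolding exp_add[symmetric] by (intro arg_cong[where f = exp]) (simp add: field_simps)
    have m: "(k * p) * (k * q) = (k * r) * (k * s)" if "p * q = r * s" for k p q r s :: real
    proof -
      have "(k * p) * (k * q) = k * k * (p * q)" by (simp add: mult_ac)
      also have "\<dots> = (k * r) * (k * s)" unfolding that by (simp add: mult_ac)
      finally show ?thesis .
    qed
    show ?thesis
      unfolding std_gaussian_density_eq by (rule m[OF e])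
  qed
  let ?V = "\<lambda>x u. ennreal (?\<gamma> ((1 / b) *\<^sub>R (u - a *\<^sub>R x)) / b ^ ?n)"
  let ?E = "\<lambda>u. ennreal (?\<gamma> ((1 / c) *\<^sub>R u) / b ^ ?n) * F (t + u)"
  let ?R = "\<lambda>x u. ennreal (?\<gamma> ((c / b) *\<^sub>R (x - (a / c^2) *\<^sub>R u)))"
  have "(\<integral>\<^sup>+ x. \<integral>\<^sup>+ y. F (t + a *\<^sub>R x + b *\<^sub>R y) \<partial>gaussian \<partial>gaussian)
      = (\<integral>\<^sup>+ x. \<integral>\<^sup>+ u. ?V x u * F (t + u) \<partial>lborel \<partial>gaussian)"
    using nn_integral_gaussian_affine[where F = "\<lambda>u. F (t + u)" and t = "a *\<^sub>R _", OF _ b]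
    by (simp add: add.assoc)
  also have "\<dots> = (\<integral>\<^sup>+ x. ennreal (?\<gamma> x) * (\<integral>\<^sup>+ u. ?V x u * F (t + u) \<partial>lborel) \<partial>lborel)"
    unfolding gaussian_def by (subst nn_integral_density) auto
  also have "\<dots> = (\<integral>\<^sup>+ x. \<integral>\<^sup>+ u. ?E u * ?R x u \<partial>lborel \<partial>lborel)"
  proof (rule nn_integral_cong)
    fix x :: "real ^ 'n"
    have "ennreal (?\<gamma> x) * (?V x u * F (t + u)) = ?E u * ?R x u" for u
    proof -
      have "ennreal (?\<gamma> x) * ?V x u = ennreal (?\<gamma> ((1 / c) *\<^sub>R u) / b ^ ?n) * ?R x u"
        using b key[of x u] by (simp add: std_gaussian_density_nonneg flip: ennreal_mult)
      then have "ennreal (?\<gamma> x) * ?V x u * F (t + u) = ennreal (?\<gamma> ((1 / c) *\<^sub>R u) / b ^ ?n) * ?R x u * F (t + u)"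
        by simp
      then show ?thesis
        by (simp only: mult_ac)
    qed
    then show "ennreal (?\<gamma> x) * (\<integral>\<^sup>+ u. ?V x u * F (t + u) \<partial>lborel) = (\<integral>\<^sup>+ u. ?E u * ?R x u \<partial>lborel)"
      by (subst nn_integral_cmult[symmetric]) auto
  qed
  also have "\<dots> = (\<integral>\<^sup>+ u. \<integral>\<^sup>+ x. ?E u * ?R x u \<partial>lborel \<partial>lborel)"
    by (rule lborel_pair.Fubini') measurable
  also have "\<dots> = (\<integral>\<^sup>+ u. ennreal (?\<gamma> ((1 / c) *\<^sub>R (u - 0)) / c ^ ?n) * F (t + u) \<partial>lborel)"
  proof (rule nn_integral_cong)
    fix u :: "real ^ 'n"
    have "p / b ^ ?n * (b / c) ^ ?n = p / c ^ ?n" for p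
      using b c by (simp add: power_divide)
    then have eq0: "ennreal (?\<gamma> ((1 / c) *\<^sub>R u) / b ^ ?n) * ennreal ((b / c) ^ ?n) = ennreal (?\<gamma> ((1 / c) *\<^sub>R (u - 0)) / c ^ ?n)"
      using b c by (subst ennreal_mult[symmetric]) (auto simp: std_gaussian_density_nonneg)
    have eq: "?E u * ennreal ((b / c) ^ ?n) = ennreal (?\<gamma> ((1 / c) *\<^sub>R (u - 0)) / c ^ ?n) * F (t + u)"
      unfolding eq0[symmetric] by (simp only: mult_ac)
    show "(\<integral>\<^sup>+ x. ?E u * ?R x u \<partial>lborel) = ennreal (?\<gamma> ((1 / c) *\<^sub>R (u - 0)) / c ^ ?n) * F (t + u)"
      unfolding eq[symmetric] by (subst nn_integral_cmult, simp, simp only: nn_integral_std_gaussian_density_scaled[OF b c])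
  qed
  also have "\<dots> = (\<integral>\<^sup>+ z. F (t + c *\<^sub>R z) \<partial>gaussian)"
    using nn_integral_gaussian_affine[where F = "\<lambda>u. F (t + u)" and t = 0, OF _ c] by (simp only: add_0) simp
  finally show ?thesis .
qed

section \<open>The Metropolis-adjusted Langevin chain\<close>

lemma integral_le_of_nn_integral:
  fixes f :: "'a \<Rightarrow> real"
  assumes "integrable M f" "\<And>x. 0 \<le> f x" "0 \<le> c" "(\<integral>\<^sup>+ x. ennreal (f x) \<partial>M) \<le> ennreal c"
  shows "integral\<^sup>L M f \<le> c"
  using assms nn_integral_eq_integral[OF assms(1)] by simp

text \<open>Only the mean of the increment meets the fixed \<open>v\<close>: the centred part
  \<open>n\<close> drops out of the cross term, and \<rho> contributes at most
  \<open>2 * (norm v * B)\<close>. Hence \<open>n\<close> acts through the second moment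
  \<open>T\<close> alone, and such contributions add up in square.\<close>

lemma (in prob_space) nn_integral_norm_add_square_le:
  fixes n \<rho> :: "'a \<Rightarrow> 'b :: euclidean_space"
  assumes n: "integrable M n" "integral\<^sup>L M n = 0"
    and \<rho>: "integrable M \<rho>" "integral\<^sup>L M (\<lambda>x. norm (\<rho> x)) \<le> B"
    and sq: "integrable M (\<lambda>x. (norm (n x + \<rho> x))^2)" "integral\<^sup>L M (\<lambda>x. (norm (n x + \<rho> x))^2) \<le> T"
  shows "(\<integral>\<^sup>+ x. ennreal ((norm (v + (n x + \<rho> x)))^2) \<partial>M) \<le> ennreal ((norm v + B)^2 + T)"
proof -
  have expand: "(norm (v + (n x + \<rho> x)))^2 = ((norm v)^2 + 2 * (v \<bullet> (n x + \<rho> x))) + (norm (n x + \<rho> x))^2" for x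
    unfolding power2_norm_eq_inner by (simp add: inner_add_left inner_add_right inner_commute algebra_simps)
  have int: "integrable M (\<lambda>x. v \<bullet> (n x + \<rho> x))"
    using n \<rho> by (intro integrable_inner_right Bochner_Integration.integrable_add) auto
  have "integral\<^sup>L M (\<lambda>x. v \<bullet> (n x + \<rho> x)) = v \<bullet> integral\<^sup>L M \<rho>"
    using n \<rho> by (subst integral_inner_right) auto
  also have "\<dots> \<le> norm v * norm (integral\<^sup>L M \<rho>)"
    by (rule norm_cauchy_schwarz)
  also have "\<dots> \<le> norm v * B"
    by (intro mult_left_mono order.trans[OF integral_norm_bound \<rho>(2)]) auto
  finally have cross: "integral\<^sup>L M (\<lambda>x. v \<bullet> (n x + \<rho> x)) \<le> norm v * B" .
  have "integral\<^sup>L M (\<lambda>x. (norm (v + (n x + \<rho> x)))^2)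
      = (norm v)^2 + 2 * integral\<^sup>L M (\<lambda>x. v \<bullet> (n x + \<rho> x)) + integral\<^sup>L M (\<lambda>x. (norm (n x + \<rho> x))^2)"
    unfolding expand using int sq(1) by (simp add: prob_space)
  also have "\<dots> \<le> (norm v)^2 + 2 * (norm v * B) + T"
    using cross sq(2) by simp
  \<comment> \<open>The missing \<open>B^2\<close> is added to complete the square.\<close>
  also have "\<dots> \<le> (norm v + B)^2 + T"
    by (simp add: power2_sum)
  finally have "integral\<^sup>L M (\<lambda>x. (norm (v + (n x + \<rho> x)))^2) \<le> (norm v + B)^2 + T" .
  moreover have "integrable M (\<lambda>x. (norm (v + (n x + \<rho> x)))^2)"
    unfolding expand using int sq(1) by simp
  ultimately show ?thesis
    by (subst nn_integral_eq_integral) (auto intro: ennreal_leI)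
qed

section \<open>The noise behind one MALA step\<close>

abbreviation unif01 :: "real measure" where
  "unif01 \<equiv> uniform_measure lborel {0..1}"

interpretation unif01: prob_space unif01
  by (rule prob_space_uniform_measure) auto

lemma nn_integral_unif01_threshold:
  assumes "0 \<le> a" "a \<le> 1"
  shows "(\<integral>\<^sup>+ u. (if u \<le> a then A else B) \<partial>unif01) = ennreal a * A + ennreal (1 - a) * B"
proof -
  have "{0..1} \<inter> {..a} = {0..a}" "{0..1} \<inter> {a<..} = {a<..1}"
    using assms by auto
  then have e: "emeasure unif01 {..a} = ennreal a" "emeasure unif01 {a<..} = ennreal (1 - a)"
    using assms by (simp_all add: emeasure_uniform_measure divide_ennreal_def)
  have "(\<integral>\<^sup>+ u. (if u \<le> a then A else B) \<partial>unif01)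
      = (\<integral>\<^sup>+ u. A * indicator {..a} u + B * indicator {a<..} u \<partial>unif01)"
    by (intro nn_integral_cong) (auto simp: indicator_def)
  also have "\<dots> = A * emeasure unif01 {..a} + B * emeasure unif01 {a<..}"
    by (subst nn_integral_add) (auto simp: nn_integral_cmult_indicator)
  finally show ?thesis
    by (simp add: e mult.commute)
qed

definition noise :: "((real ^ 'n) \<times> real) measure" where
  "noise = gaussian \<Otimes>\<^sub>M unif01"

lemma sets_noise [simp, measurable_cong]: "sets noise = sets (borel \<Otimes>\<^sub>M borel)"
  unfolding noise_def by (intro sets_pair_measure_cong) auto

interpretation noise: prob_space "noise :: ((real ^ 'n) \<times> real) measure"
  unfolding noise_def by (rule prob_space_pair[OF gaussian.prob_space_axioms unif01.prob_space_axioms])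

lemma nn_integral_noise:
  assumes "F \<in> borel_measurable (borel \<Otimes>\<^sub>M borel)"
  shows "(\<integral>\<^sup>+ r. F r \<partial>noise) = (\<integral>\<^sup>+ z. \<integral>\<^sup>+ u. F (z, u) \<partial>unif01 \<partial>gaussian)"
proof -
  have "F \<in> borel_measurable (gaussian \<Otimes>\<^sub>M unif01)"
    using assms sets_noise unfolding noise_def by (metis measurable_cong_sets)
  then show ?thesis
    unfolding noise_def by (rule unif01.nn_integral_fst[symmetric])
qed

lemma distr_noise_fst: "distr noise borel fst = gaussian"
proof -
  have "distr noise gaussian fst = gaussian"
    unfolding noise_def by (rule unif01.distr_pair_fst)
  then show ?thesis
    by (metis distr_cong gaussian.sets_gibbs)
qed

lemma integrable_noise_fst:
  fixes f :: "real ^ 'n \<Rightarrow> 'b :: {banach, second_countable_topology}"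
  assumes "integrable gaussian f"
  shows "integrable noise (\<lambda>r. f (fst r))" "integral\<^sup>L noise (\<lambda>r. f (fst r)) = integral\<^sup>L gaussian f"
proof -
  have f: "f \<in> borel_measurable borel"
    using assms by (auto simp: measurable_cong_sets[OF gaussian.sets_gibbs refl] dest: borel_measurable_integrable)
  show "integrable noise (\<lambda>r. f (fst r))"
    by (rule integrable_distr[of fst noise borel]) (use assms in \<open>auto simp: distr_noise_fst\<close>)
  show "integral\<^sup>L noise (\<lambda>r. f (fst r)) = integral\<^sup>L gaussian f"
    using integral_distr[of fst noise borel f] f by (simp add: distr_noise_fst)
qed

text \<open>The \<open>itself\<close> argument carries the dimension; the factor 2 is the one in
  \<open>norm_step_le\<close>.\<close>

definition gmoment :: "'n :: finite itself \<Rightarrow> nat \<Rightarrow> real" where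
  "gmoment _ m = integral\<^sup>L gaussian (\<lambda>z :: real ^ 'n. (1 + 2 * norm z) ^ m)"

lemma gmoment_nonneg: "0 \<le> gmoment t m"
  unfolding gmoment_def by (intro Bochner_Integration.integral_nonneg) auto

text \<open>
  \<open>step\<close> is the Langevin proposal and \<open>accept\<close> the Metropolis-Hastings acceptance probability of
  MALA; a move is rejected when the uniform component of the noise exceeds it.
\<close>

locale langevin = gibbs_measure U g L k
  for U :: "real ^ 'n \<Rightarrow> real" and g :: "real ^ 'n \<Rightarrow> real ^ 'n" and L k :: real +
  fixes H :: "real ^ 'n \<Rightarrow> real ^ 'n \<Rightarrow> real ^ 'n" and M2 :: real
  assumes L_pos: "0 < L" and M2_nonneg: "0 \<le> M2"
    and lipschitz: "norm (g y - g x) \<le> L * norm (y - x)"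
    and H_linear: "bounded_linear (H x)"
    and H_bound: "norm (H x v) \<le> L * norm v"
    and taylor: "norm (g y - g x - H x (y - x)) \<le> M2 / 2 * (norm (y - x))^2"
begin

declare g_measurable [measurable]

definition step :: "real \<Rightarrow> real ^ 'n \<Rightarrow> real ^ 'n \<Rightarrow> real ^ 'n" where
  "step \<eta> x z = - (\<eta> *\<^sub>R g x) + sqrt (2 * \<eta>) *\<^sub>R z"

text \<open>The proposal density from \<open>x\<close> to \<open>y\<close> is proportional to
  \<open>exp (- (norm (y - x + \<eta> *\<^sub>R g x))^2 / (4 * \<eta>))\<close>. The exponent is
  therefore the logarithm of target density times proposal density of the reverse move, divided by
  the same product for the forward move.\<close>

definition accept :: "real \<Rightarrow> real ^ 'n \<Rightarrow> real ^ 'n \<Rightarrow> real" where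
  "accept \<eta> x y = min 1 (exp (U x - U y
      + ((norm (y - x + \<eta> *\<^sub>R g x))^2 - (norm (x - y + \<eta> *\<^sub>R g y))^2) / (4 * \<eta>)))"

definition mala :: "real \<Rightarrow> real ^ 'n \<Rightarrow> (real ^ 'n) \<times> real \<Rightarrow> real ^ 'n" where
  "mala \<eta> x r = (if snd r \<le> accept \<eta> x (x + step \<eta> x (fst r)) then x + step \<eta> x (fst r) else x)"

lemma step_measurable [measurable]:
  assumes [measurable]: "a \<in> borel_measurable M" "b \<in> borel_measurable M"
  shows "(\<lambda>x. step \<eta> (a x) (b x)) \<in> borel_measurable M"
  unfolding step_def by measurable

lemma accept_measurable [measurable]:
  assumes [measurable]: "a \<in> borel_measurable M" "b \<in> borel_measurable M"
  shows "(\<lambda>x. accept \<eta> (a x) (b x)) \<in> borel_measurable M"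
  unfolding accept_def by measurable

lemma mala_measurable [measurable]:
  assumes [measurable]: "a \<in> borel_measurable M" "b \<in> measurable M (borel \<Otimes>\<^sub>M borel)"
  shows "(\<lambda>x. mala \<eta> (a x) (b x)) \<in> borel_measurable M"
  unfolding mala_def by measurable

lemma accept_range: "0 \<le> accept \<eta> x y" "accept \<eta> x y \<le> 1"
  by (auto simp: accept_def)

lemma nn_integral_noise_mala:
  assumes [measurable]: "case_prod F \<in> borel_measurable (borel \<Otimes>\<^sub>M borel)"
  shows "(\<integral>\<^sup>+ r. F (fst r) (mala \<eta> x r) \<partial>noise)
    = (\<integral>\<^sup>+ z. ennreal (accept \<eta> x (x + step \<eta> x z)) * F z (x + step \<eta> x z)
        + ennreal (1 - accept \<eta> x (x + step \<eta> x z)) * F z x \<partial>gaussian)"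
proof -
  have "(\<integral>\<^sup>+ r. F (fst r) (mala \<eta> x r) \<partial>noise)
      = (\<integral>\<^sup>+ z. \<integral>\<^sup>+ u. F (fst (z, u)) (mala \<eta> x (z, u)) \<partial>unif01 \<partial>gaussian)"
    by (rule nn_integral_noise) measurable
  also have "\<dots> = (\<integral>\<^sup>+ z. \<integral>\<^sup>+ u. (if u \<le> accept \<eta> x (x + step \<eta> x z) then F z (x + step \<eta> x z) else F z x) \<partial>unif01 \<partial>gaussian)"
    by (intro nn_integral_cong) (simp add: mala_def)
  finally show ?thesis
    by (simp add: nn_integral_unif01_threshold accept_range)
qed

text \<open>The flow from \<open>x\<close> to \<open>y\<close> is a constant times
  \<open>min (exp (- P x y)) (exp (- P y x))\<close>, because the acceptance probability is
  \<open>min 1 (exp (P x y - P y x))\<close>; this minimum is symmetric.\<close>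

lemma accept_detailed_balance:
  fixes x y :: "real ^ 'n"
  assumes "0 < \<eta>"
  defines "S \<equiv> \<lambda>x y. exp (- U x) * std_gaussian_density ((1 / sqrt (2 * \<eta>)) *\<^sub>R (y - (x - \<eta> *\<^sub>R g x))) * accept \<eta> x y"
  shows "S x y = S y x"
proof -
  define P where "P = (\<lambda>x y. U x + (norm (y - x + \<eta> *\<^sub>R g x))^2 / (4 * \<eta>))"
  have S: "S x y = (1 / sqrt (2 * pi)) ^ CARD('n) * min (exp (- P x y)) (exp (- P y x))" for x y
  proof -
    have "(norm ((1 / sqrt (2 * \<eta>)) *\<^sub>R (y - (x - \<eta> *\<^sub>R g x))))^2 / 2 = (norm (y - x + \<eta> *\<^sub>R g x))^2 / (4 * \<eta>)"
    proof -
      have "(norm ((1 / sqrt (2 * \<eta>)) *\<^sub>R w))^2 / 2 = (norm w)^2 / (4 * \<eta>)" for w :: "real ^ 'n"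
        using assms(1) by (simp add: power_divide)
      from this[of "y - x + \<eta> *\<^sub>R g x"] show ?thesis
        by (simp add: algebra_simps)
    qed
    then have "S x y = (1 / sqrt (2 * pi)) ^ CARD('n) * (exp (- P x y) * accept \<eta> x y)"
      unfolding S_def std_gaussian_density_eq P_def by (simp add: exp_add exp_minus exp_diff field_simps)
    also have "accept \<eta> x y = min 1 (exp (P x y - P y x))"
      by (simp add: accept_def P_def diff_divide_distrib algebra_simps)
    also have "exp (- P x y) * min 1 (exp (P x y - P y x)) = min (exp (- P x y)) (exp (- P y x))"
      by (auto simp: min_def simp flip: exp_add)
    finally show ?thesis .
  qed
  show ?thesis
    unfolding S by (simp add: min.commute)
qed

lemma nn_integral_gibbs: "F \<in> borel_measurable borel \<Longrightarrow> (\<integral>\<^sup>+ x. F x \<partial>gibbs) = (\<integral>\<^sup>+ x. ennreal (k * exp (- U x)) * F x \<partial>lborel)"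
  unfolding gibbs_def by (subst nn_integral_density) auto

text \<open>Accepted moves integrate against the symmetric kernel \<open>S\<close>, so exchanging
  source and target replaces \<phi> at the new point by \<phi> at the old one. Rejected moves keep
  the old point and complete the weight to 1.\<close>

lemma nn_integral_mala_invariant:
  assumes [measurable]: "\<phi> \<in> borel_measurable borel" and \<eta>: "0 < \<eta>"
  shows "(\<integral>\<^sup>+ x. \<integral>\<^sup>+ r. \<phi> (mala \<eta> x r) \<partial>noise \<partial>gibbs) = (\<integral>\<^sup>+ x. \<phi> x \<partial>gibbs)"
proof -
  define c where "c = sqrt (2 * \<eta>)"
  have c: "0 < c"
    using \<eta> by (simp add: c_def)
  define A where "A x z = ennreal (accept \<eta> x (x + step \<eta> x z))" for x z
  define A' where "A' x z = ennreal (1 - accept \<eta> x (x + step \<eta> x z))" for x z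
  have [measurable]: "case_prod A \<in> borel_measurable (borel \<Otimes>\<^sub>M borel)" "case_prod A' \<in> borel_measurable (borel \<Otimes>\<^sub>M borel)"
    unfolding A_def A'_def by measurable
  let ?q = "\<lambda>x y. std_gaussian_density ((1 / c) *\<^sub>R (y - (x - \<eta> *\<^sub>R g x)))"
  define S where "S x y = ennreal (k / c ^ CARD('n) * (exp (- U x)
      * ?q x y * accept \<eta> x y))" for x y
  have [measurable]: "case_prod S \<in> borel_measurable (borel \<Otimes>\<^sub>M borel)"
    unfolding S_def by measurable
  have S_sym: "S x y = S y x" for x y
    unfolding S_def c_def by (subst accept_detailed_balance[OF \<eta>]) rule
  have via_S: "(\<integral>\<^sup>+ x. \<integral>\<^sup>+ z. A x z * \<psi> x (x + step \<eta> x z) \<partial>gaussian \<partial>gibbs)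
      = (\<integral>\<^sup>+ x. \<integral>\<^sup>+ y. S x y * \<psi> x y \<partial>lborel \<partial>lborel)"
    if [measurable]: "case_prod \<psi> \<in> borel_measurable (borel \<Otimes>\<^sub>M borel)" for \<psi>
  proof -
    have "ennreal (k * exp (- U x)) * (\<integral>\<^sup>+ z. A x z * \<psi> x (x + step \<eta> x z) \<partial>gaussian)
        = (\<integral>\<^sup>+ y. S x y * \<psi> x y \<partial>lborel)" for x
    proof -
      have "(\<integral>\<^sup>+ z. A x z * \<psi> x (x + step \<eta> x z) \<partial>gaussian)
          = (\<integral>\<^sup>+ z. ennreal (accept \<eta> x ((x - \<eta> *\<^sub>R g x) + c *\<^sub>R z)) * \<psi> x ((x - \<eta> *\<^sub>R g x) + c *\<^sub>R z) \<partial>gaussian)"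
        by (simp add: A_def step_def c_def algebra_simps)
      also have "\<dots> = (\<integral>\<^sup>+ y. ennreal (?q x y / c ^ CARD('n))
          * (ennreal (accept \<eta> x y) * \<psi> x y) \<partial>lborel)"
        by (rule nn_integral_gaussian_affine[OF _ c]) measurable
      finally have eq: "ennreal (k * exp (- U x)) * (\<integral>\<^sup>+ z. A x z * \<psi> x (x + step \<eta> x z) \<partial>gaussian)
          = (\<integral>\<^sup>+ y. ennreal (k * exp (- U x)) * (ennreal (?q x y / c ^ CARD('n))
          * (ennreal (accept \<eta> x y) * \<psi> x y)) \<partial>lborel)"
        by (simp only:) (subst nn_integral_cmult, auto)
      have "ennreal (k * exp (- U x)) * (ennreal (?q x y / c ^ CARD('n))
          * (ennreal (accept \<eta> x y) * \<psi> x y)) = S x y * \<psi> x y" for y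
      proof -
        have *: "ennreal a * (ennreal r * (ennreal b * q)) = ennreal (a * r * b) * q"
          if "0 \<le> a" "0 \<le> r" "0 \<le> b" for a b r q
          using that by (simp add: ennreal_mult mult.assoc)
        show ?thesis
          unfolding S_def using c k_nonneg
          by (subst *) (auto simp: accept_range std_gaussian_density_nonneg mult_ac)
      qed
      then show ?thesis
        unfolding eq by simp
    qed
    then show ?thesis
      by (subst nn_integral_gibbs) auto
  qed
  have "(\<integral>\<^sup>+ x. \<integral>\<^sup>+ z. A x z * \<phi> (x + step \<eta> x z) \<partial>gaussian \<partial>gibbs) = (\<integral>\<^sup>+ x. \<integral>\<^sup>+ y. S x y * \<phi> y \<partial>lborel \<partial>lborel)"
    using via_S[of "\<lambda>x y. \<phi> y"] by simp
  also have "\<dots> = (\<integral>\<^sup>+ y. \<integral>\<^sup>+ x. S x y * \<phi> y \<partial>lborel \<partial>lborel)"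
    by (rule lborel_pair.Fubini') measurable
  also have "\<dots> = (\<integral>\<^sup>+ x. \<integral>\<^sup>+ y. S x y * \<phi> x \<partial>lborel \<partial>lborel)"
    by (subst S_sym) rule
  also have "\<dots> = (\<integral>\<^sup>+ x. \<integral>\<^sup>+ z. A x z * \<phi> x \<partial>gaussian \<partial>gibbs)"
    using via_S[of "\<lambda>x y. \<phi> x"] by simp
  finally have balance: "(\<integral>\<^sup>+ x. \<integral>\<^sup>+ z. A x z * \<phi> (x + step \<eta> x z) \<partial>gaussian \<partial>gibbs)
      = (\<integral>\<^sup>+ x. \<integral>\<^sup>+ z. A x z * \<phi> x \<partial>gaussian \<partial>gibbs)" .
  have split: "(\<integral>\<^sup>+ x. \<integral>\<^sup>+ z. A x z * \<psi> x z + A' x z * \<phi> x \<partial>gaussian \<partial>gibbs)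
      = (\<integral>\<^sup>+ x. \<integral>\<^sup>+ z. A x z * \<psi> x z \<partial>gaussian \<partial>gibbs) + (\<integral>\<^sup>+ x. \<integral>\<^sup>+ z. A' x z * \<phi> x \<partial>gaussian \<partial>gibbs)"
    if [measurable]: "case_prod \<psi> \<in> borel_measurable (borel \<Otimes>\<^sub>M borel)" for \<psi>
    by (subst nn_integral_add[symmetric]) (auto intro!: nn_integral_cong nn_integral_add)
  have "(\<integral>\<^sup>+ x. \<integral>\<^sup>+ r. \<phi> (mala \<eta> x r) \<partial>noise \<partial>gibbs)
      = (\<integral>\<^sup>+ x. \<integral>\<^sup>+ z. A x z * \<phi> (x + step \<eta> x z) + A' x z * \<phi> x \<partial>gaussian \<partial>gibbs)"
    using nn_integral_noise_mala[of "\<lambda>_ y. \<phi> y"] by (simp add: A_def A'_def)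
  also have "\<dots> = (\<integral>\<^sup>+ x. \<integral>\<^sup>+ z. A x z * \<phi> x + A' x z * \<phi> x \<partial>gaussian \<partial>gibbs)"
    by (subst (1 2) split) (auto simp: balance)
  also have "\<dots> = (\<integral>\<^sup>+ x. \<phi> x \<partial>gibbs)"
  proof -
    have "A x z + A' x z = 1" for x z
      unfolding A_def A'_def using accept_range by (simp flip: ennreal_plus)
    then show ?thesis
      by (simp flip: distrib_right add: gaussian.emeasure_space_1[simplified])
  qed
  finally show ?thesis .
qed

text \<open>The product form separates \<open>x\<close> from \<open>z\<close>, so that powers
  integrate to a gradient moment times a Gaussian moment.\<close>

lemma norm_step_le:
  assumes "0 < \<eta>" "\<eta> \<le> 1"
  shows "norm (step \<eta> x z) \<le> sqrt \<eta> * ((1 + norm (g x)) * (1 + 2 * norm z))"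
proof -
  have s: "0 \<le> sqrt \<eta>" "sqrt \<eta> \<le> 1" "\<eta> = sqrt \<eta> * sqrt \<eta>"
    using assms by auto
  have "norm (step \<eta> x z) \<le> \<eta> * norm (g x) + sqrt (2 * \<eta>) * norm z"
    unfolding step_def using assms by (intro order.trans[OF norm_triangle_ineq]) simp
  also have "\<dots> \<le> sqrt \<eta> * norm (g x) + sqrt \<eta> * (2 * norm z)"
  proof (intro add_mono)
    have "\<eta> \<le> sqrt \<eta> * 1"
      using s by (metis mult_left_mono)
    then show "\<eta> * norm (g x) \<le> sqrt \<eta> * norm (g x)"
      by (intro mult_right_mono) auto
    have "sqrt 2 \<le> 2"
      by (rule real_le_lsqrt) auto
    then have "sqrt \<eta> * (sqrt 2 * norm z) \<le> sqrt \<eta> * (2 * norm z)"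
      using s by (intro mult_left_mono mult_right_mono) auto
    then show "sqrt (2 * \<eta>) * norm z \<le> sqrt \<eta> * (2 * norm z)"
      by (simp add: real_sqrt_mult mult_ac)
  qed
  also have "\<dots> \<le> sqrt \<eta> * ((1 + norm (g x)) * (1 + 2 * norm z))"
    using s by (simp add: distrib_left distrib_right add_increasing2)
  finally show ?thesis .
qed

text \<open>With \<open>r\<close> the negative logarithm of the acceptance ratio,
  \<open>1 - min 1 (exp (- r))\<close> is at most the positive part of \<open>r\<close>. Here
  \<open>r\<close> is the error of the trapezoidal rule for the increment of \<open>U\<close> along
  \<open>s\<close>, at most \<open>L * (norm s)^2\<close>, plus \<eta> / 4 times the increment of
  the squared gradient norm.\<close>

lemma one_minus_accept_le:
  assumes \<eta>: "0 < \<eta>" "\<eta> \<le> 1" "\<eta> * L \<le> 1"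
  shows "1 - accept \<eta> x (x + step \<eta> x z) \<le> 2 * L * \<eta> * ((1 + norm (g x)) * (1 + 2 * norm z))^2"
proof -
  define s y where "s = step \<eta> x z" and "y = x + s"
  define Q where "Q = (1 + norm (g x)) * (1 + 2 * norm z)"
  have sQ: "norm s \<le> sqrt \<eta> * Q"
    unfolding s_def Q_def by (rule norm_step_le[OF \<eta>(1,2)])
  have Q1: "1 + norm (g x) \<le> Q"
    using mult_left_mono[of 1 "1 + 2 * norm z" "1 + norm (g x)"] by (simp add: Q_def)
  have Q: "1 \<le> Q" "norm (g x) \<le> Q"
    using Q1 norm_ge_zero[of "g x"] by linarith+
  have sq: "sqrt \<eta> \<le> 1" "0 \<le> sqrt \<eta>"
    using \<eta> by auto
  have s2: "(norm s)^2 \<le> \<eta> * Q^2"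
    using power_mono[OF sQ, of 2] \<eta> by (simp add: power_mult_distrib)
  have lip: "norm (g y - g x) \<le> L * norm s"
    using lipschitz[of y x] by (simp add: y_def)
  define r where "r = U y - U x - ((norm (y - x + \<eta> *\<^sub>R g x))^2 - (norm (x - y + \<eta> *\<^sub>R g y))^2) / (4 * \<eta>)"
  have r_eq: "r = U y - U x - 1 / 2 * (s \<bullet> (g x + g y)) + \<eta> / 4 * ((norm (g y))^2 - (norm (g x))^2)"
  proof -
    have "(norm (y - x + \<eta> *\<^sub>R g x))^2 - (norm (x - y + \<eta> *\<^sub>R g y))^2
        = 2 * \<eta> * (s \<bullet> (g x + g y)) + \<eta>^2 * ((norm (g x))^2 - (norm (g y))^2)"
      unfolding power2_norm_eq_inner y_def
      by (simp add: inner_add_left inner_add_right inner_commute power2_eq_square algebra_simps)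
    then show ?thesis
      unfolding r_def using \<eta> by (simp add: field_simps power2_eq_square)
  qed
  have t1: "U y - U x \<le> g x \<bullet> s + L / 2 * (norm s)^2"
    using quadratic_upper[of y x] by (simp add: y_def)
  have t2: "- (1 / 2 * (s \<bullet> (g x + g y))) \<le> - (g x \<bullet> s) + L / 2 * (norm s)^2"
  proof -
    have "- (s \<bullet> (g y - g x)) \<le> norm s * norm (g y - g x)"
      using Cauchy_Schwarz_ineq2[of s "g y - g x"] by linarith
    also have "\<dots> \<le> norm s * (L * norm s)"
      by (intro mult_left_mono lip) auto
    finally have "s \<bullet> g x - s \<bullet> g y \<le> L * (norm s)^2"
      by (simp add: inner_diff_right power2_eq_square mult_ac)
    moreover have "- (1 / 2 * (a + b)) \<le> - a + L / 2 * X" if "a - b \<le> L * X" for a b X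
      using that by (simp add: field_simps)
    ultimately show ?thesis
      unfolding inner_add_right inner_commute[of "g x" s] by blast
  qed
  have t3: "(norm (g y))^2 - (norm (g x))^2 \<le> 2 * norm (g x) * (L * norm s) + (L * norm s)^2"
  proof -
    have "norm (g y) \<le> norm (g x) + L * norm s"
      using norm_triangle_ineq2[of "g y" "g x"] lip by linarith
    then have "(norm (g y))^2 \<le> (norm (g x) + L * norm s)^2"
      by (intro power_mono) auto
    then show ?thesis
      by (simp add: power2_sum)
  qed
  have t4: "\<eta> * (2 * norm (g x) * (L * norm s)) \<le> 2 * L * (\<eta> * Q^2)"
  proof -
    have "norm (g x) * norm s \<le> Q * (1 * Q)"
      using sQ Q sq by (intro mult_mono order.trans[OF sQ] mult_right_mono) auto
    then have "2 * L * \<eta> * (norm (g x) * norm s) \<le> 2 * L * \<eta> * (Q * (1 * Q))"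
      using L_pos \<eta> by (intro mult_left_mono) auto
    then show ?thesis
      by (simp add: power2_eq_square mult_ac)
  qed
  have t5: "\<eta> * (L * norm s)^2 \<le> L * (\<eta> * Q^2)"
  proof -
    have "(\<eta> * L) * (L * (norm s)^2) \<le> 1 * (L * (\<eta> * Q^2))"
      using \<eta> L_pos s2 by (intro mult_mono mult_left_mono) auto
    then show ?thesis
      by (simp add: power2_eq_square mult_ac)
  qed
  have "\<eta> * ((norm (g y))^2 - (norm (g x))^2) \<le> \<eta> * (2 * norm (g x) * (L * norm s) + (L * norm s)^2)"
    using \<eta> t3 by (intro mult_left_mono) auto
  also have "\<dots> \<le> 3 * L * (\<eta> * Q^2)"
    unfolding distrib_left using t4 t5 by linarith
  finally have t6: "\<eta> / 4 * ((norm (g y))^2 - (norm (g x))^2) \<le> 3 / 4 * L * (\<eta> * Q^2)"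
    by simp
  have "L * (norm s)^2 \<le> L * (\<eta> * Q^2)"
    using L_pos s2 by (intro mult_left_mono) auto
  \<comment> \<open>The contribution is 1 from \<open>t1\<close> and \<open>t2\<close> together and
    3 / 4 from \<open>t6\<close>.\<close>
  then have "r \<le> 7 / 4 * L * (\<eta> * Q^2)"
    unfolding r_eq using t1 t2 t6 by linarith
  also have "\<dots> \<le> 2 * L * (\<eta> * Q^2)"
    using L_pos \<eta> by (intro mult_right_mono) auto
  finally have r: "r \<le> 2 * L * \<eta> * Q^2"
    by (simp add: mult_ac)
  have "accept \<eta> x y = min 1 (exp (- r))"
    unfolding accept_def r_def by (intro arg_cong2[where f = min] arg_cong[where f = exp] refl) linarith
  moreover have "1 - r \<le> exp (- r)"
    using exp_ge_add_one_self[of "- r"] by simp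
  moreover have "0 \<le> 2 * L * \<eta> * Q^2"
    using L_pos \<eta> by simp
  ultimately have "1 - accept \<eta> x y \<le> 2 * L * \<eta> * Q^2"
    using r by (auto simp: min_def)
  then show ?thesis
    by (simp add: y_def s_def Q_def)
qed

text \<open>Zero after an accepted move and \<open>- step \<eta> x (fst r)\<close> after a rejected
  one: a MALA move is the plain Langevin move plus this correction.\<close>

definition rejection :: "real \<Rightarrow> real ^ 'n \<Rightarrow> (real ^ 'n) \<times> real \<Rightarrow> real ^ 'n" where
  "rejection \<eta> x r = mala \<eta> x r - x - step \<eta> x (fst r)"

lemma rejection_measurable [measurable]:
  assumes [measurable]: "a \<in> borel_measurable M" "b \<in> measurable M (borel \<Otimes>\<^sub>M borel)"
  shows "(\<lambda>x. rejection \<eta> (a x) (b x)) \<in> borel_measurable M"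
  unfolding rejection_def by measurable

lemma norm_mala_diff_le: "norm (mala \<eta> x r - x) \<le> norm (step \<eta> x (fst r))"
  by (simp add: mala_def)

lemma norm_rejection_le: "norm (rejection \<eta> x r) \<le> norm (step \<eta> x (fst r))"
  by (simp add: mala_def rejection_def)

text \<open>The probability of a rejection, of order \<eta>, times the power of a step of order
  \<open>sqrt \<eta>\<close>. For \<open>m = 0\<close> accepted moves would count as well, because
  \<open>0 ^ 0 = 1\<close>.\<close>

lemma nn_integral_rejection_power_le:
  assumes \<eta>: "0 < \<eta>" "\<eta> \<le> 1" "\<eta> * L \<le> 1" and m: "m \<noteq> 0"
  shows "(\<integral>\<^sup>+ r. ennreal (norm (rejection \<eta> x r) ^ m) \<partial>noise)
    \<le> ennreal (2 * L * \<eta> * sqrt \<eta> ^ m * (1 + norm (g x)) ^ (m + 2) * gmoment TYPE('n) (m + 2))"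
proof -
  let ?c = "2 * L * \<eta> * sqrt \<eta> ^ m * (1 + norm (g x)) ^ (m + 2)"
  have c: "0 \<le> ?c"
    using L_pos \<eta> by simp
  have "(\<integral>\<^sup>+ r. ennreal (norm (rejection \<eta> x r) ^ m) \<partial>noise)
      = (\<integral>\<^sup>+ r. ennreal (norm (mala \<eta> x r - x - step \<eta> x (fst r)) ^ m) \<partial>noise)"
    by (simp add: rejection_def)
  also have "\<dots> = (\<integral>\<^sup>+ z. ennreal (1 - accept \<eta> x (x + step \<eta> x z)) * ennreal (norm (step \<eta> x z) ^ m) \<partial>gaussian)"
    using m by (subst nn_integral_noise_mala[where F = "\<lambda>z y. ennreal (norm (y - x - step \<eta> x z) ^ m)"]) (simp_all add: zero_power)
  also have "\<dots> \<le> (\<integral>\<^sup>+ z. ennreal ?c * ennreal ((1 + 2 * norm (z :: real ^ 'n)) ^ (m + 2)) \<partial>gaussian)"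
  proof (rule nn_integral_mono)
    fix z :: "real ^ 'n"
    have "(1 - accept \<eta> x (x + step \<eta> x z)) * norm (step \<eta> x z) ^ m
        \<le> (2 * L * \<eta> * ((1 + norm (g x)) * (1 + 2 * norm z))^2) * (sqrt \<eta> * ((1 + norm (g x)) * (1 + 2 * norm z))) ^ m"
      using L_pos \<eta> accept_range(2)
      by (intro mult_mono power_mono one_minus_accept_le norm_step_le) auto
    also have "\<dots> = ?c * (1 + 2 * norm z) ^ (m + 2)"
      by (simp add: power_mult_distrib power_add power2_eq_square mult_ac)
    finally show "ennreal (1 - accept \<eta> x (x + step \<eta> x z)) * ennreal (norm (step \<eta> x z) ^ m)
        \<le> ennreal ?c * ennreal ((1 + 2 * norm z) ^ (m + 2))"
      using c accept_range(2) by (simp flip: ennreal_mult)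
  qed
  also have "\<dots> = ennreal ?c * ennreal (gmoment TYPE('n) (m + 2))"
    unfolding gmoment_def
    by (subst nn_integral_cmult, simp) (subst nn_integral_eq_integral[OF integrable_gaussian_moment], simp_all)
  also have "\<dots> = ennreal (?c * gmoment TYPE('n) (m + 2))"
    by (rule ennreal_mult[symmetric, OF c gmoment_nonneg])
  finally show ?thesis .
qed

lemma integrable_noise_polynomial:
  fixes f :: "(real ^ 'n) \<times> real \<Rightarrow> 'b :: {banach, second_countable_topology}"
  assumes "f \<in> borel_measurable (borel \<Otimes>\<^sub>M borel)" "\<And>r. norm (f r) \<le> C * (1 + 2 * norm (fst r)) ^ m"
  shows "integrable noise f"
proof (rule Bochner_Integration.integrable_bound)
  show "integrable noise (\<lambda>r :: (real ^ 'n) \<times> real. C * (1 + 2 * norm (fst r)) ^ m)"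
    by (intro integrable_mult_right integrable_noise_fst(1)[OF integrable_gaussian_moment]) auto
  show "f \<in> borel_measurable noise"
    using assms(1) by measurable
  show "AE r in noise. norm (f r) \<le> norm (C * (1 + 2 * norm (fst r)) ^ m)"
    using order.trans[OF assms(2) abs_ge_self] by (intro AE_I2) simp
qed

lemma integrable_norm_step_power:
  assumes "0 < \<eta>" "\<eta> \<le> 1"
  shows "integrable noise (\<lambda>r. norm (step \<eta> x (fst r)) ^ m)"
proof (rule integrable_noise_polynomial[where C = "(sqrt \<eta> * (1 + norm (g x))) ^ m" and m = m])
  show "norm (norm (step \<eta> x (fst r)) ^ m) \<le> (sqrt \<eta> * (1 + norm (g x))) ^ m * (1 + 2 * norm (fst r)) ^ m" for r :: "(real ^ 'n) \<times> real"
    using power_mono[OF norm_step_le[OF assms, of x "fst r"], of m]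
    by (simp add: power_mult_distrib mult_ac)
qed measurable

text \<open>Expanded exactly, with the cross term gone because the Gaussian is centred. The leading
  term \<open>2 * \<eta> * CARD('n)\<close> reaches the final constants, for which
  \<open>norm_step_le\<close> would be too rough.\<close>

lemma integral_norm_step_square_le:
  assumes "0 < \<eta>"
  shows "integral\<^sup>L noise (\<lambda>r. (norm (step \<eta> x (fst r)))^2) \<le> 2 * \<eta> * CARD('n) + \<eta>^2 * (norm (g x))^2"
proof -
  have expand: "(norm (step \<eta> x z))^2 = \<eta>^2 * (norm (g x))^2 - 2 * \<eta> * sqrt (2 * \<eta>) * (g x \<bullet> z) + 2 * \<eta> * (norm z)^2" for z
  proof -
    have "(norm (step \<eta> x z))^2 = \<eta>^2 * (norm (g x))^2 - 2 * \<eta> * sqrt (2 * \<eta>) * (g x \<bullet> z) + (sqrt (2 * \<eta>))^2 * (norm z)^2"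
      unfolding step_def power2_norm_eq_inner
      by (simp add: inner_add_left inner_add_right inner_commute power2_eq_square algebra_simps)
    then show ?thesis
      using assms by simp
  qed
  have lin: "integrable gaussian (\<lambda>z. g x \<bullet> z)" "integral\<^sup>L gaussian (\<lambda>z. g x \<bullet> z) = 0"
  proof -
    show "integrable gaussian (\<lambda>z. g x \<bullet> z)"
      by (intro integrable_inner_right integrable_gaussian_id)
    have "integral\<^sup>L gaussian (\<lambda>z. g x \<bullet> z) = g x \<bullet> integral\<^sup>L gaussian (\<lambda>z. z)"
      by (rule integral_inner_right) (rule integrable_gaussian_id)
    then show "integral\<^sup>L gaussian (\<lambda>z. g x \<bullet> z) = 0"
      by (simp add: integral_gaussian_id)
  qed
  have int: "integrable gaussian (\<lambda>z. (norm (step \<eta> x z))^2)"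
    unfolding expand
    by (intro Bochner_Integration.integrable_add Bochner_Integration.integrable_diff integrable_mult_right
        lin integral_gaussian_norm_square_le(1)) auto
  have "integral\<^sup>L noise (\<lambda>r. (norm (step \<eta> x (fst r)))^2) = integral\<^sup>L gaussian (\<lambda>z. (norm (step \<eta> x z))^2)"
    by (rule integrable_noise_fst(2)[OF int])
  also have "\<dots> = \<eta>^2 * (norm (g x))^2 + 2 * \<eta> * integral\<^sup>L gaussian (\<lambda>z :: real ^ 'n. (norm z)^2)"
    unfolding expand using lin integral_gaussian_norm_square_le(1)
    by (subst Bochner_Integration.integral_add Bochner_Integration.integral_diff
        | (intro Bochner_Integration.integrable_diff integrable_mult_right; simp)
        | simp add: gaussian.prob_space[simplified])+
  also have "\<dots> \<le> \<eta>^2 * (norm (g x))^2 + 2 * \<eta> * CARD('n)"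
    using assms integral_gaussian_norm_square_le(2)[where 'n = 'n] by (intro add_mono mult_left_mono) auto
  finally show ?thesis
    by simp
qed

end

section \<open>Increment of the error over one MALA step\<close>

context langevin
begin

text \<open>\<open>err1\<close> and \<open>err2\<close> are the coefficients of the terms of order
  \<open>\<eta> * sqrt \<eta>\<close> and \<open>\<eta>^2\<close> in one fine step, kept apart
  because they disappear in the limit. Their Gaussian moments stem from rejections.\<close>

definition err1 :: "real \<Rightarrow> real" where
  "err1 h = h * M2 / 2 + (h * L + 1) * (2 * L * gmoment TYPE('n) 3)"

definition err2 :: "real \<Rightarrow> real" where
  "err2 h = 2 * h^2 * L^2 + 4 * L * gmoment TYPE('n) 4"

lemma err_nonneg: "0 \<le> h \<Longrightarrow> 0 \<le> err1 h" "0 \<le> err2 h"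
  using L_pos M2_nonneg gmoment_nonneg[of "TYPE('n)"] by (auto simp: err1_def err2_def)

text \<open>Here \<kappa> stands for the time left in the current LMC step. The increment splits
  into \<open>n\<close>, the Hessian applied to the Gaussian part of the move, which is centred, and
  a remainder \<rho> of small expected norm. The leading part of that norm comes from the Hessian
  applied to the drift, giving \<open>L * norm (g x)\<close>, and from the Taylor error,
  \<open>M2 / 2\<close> times a mean square step of about
  \<open>2 * \<eta> * CARD('n)\<close>.\<close>

lemma mala_step_square_le:
  fixes v x :: "real ^ 'n"
  assumes \<eta>: "0 < \<eta>" "\<eta> \<le> 1" "\<eta> * L \<le> 1" and \<kappa>: "0 \<le> \<kappa>" "\<kappa> \<le> h"
  defines "G \<equiv> 1 + norm (g x)"
  shows "(\<integral>\<^sup>+ r. ennreal ((norm (v + (\<kappa> *\<^sub>R (g (mala \<eta> x r) - g x) - rejection \<eta> x r)))^2) \<partial>noise)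
    \<le> ennreal ((norm v + (\<kappa> * \<eta> * (L * norm (g x) + M2 * CARD('n)) + err1 h * (\<eta> * sqrt \<eta>) * G ^ 3))^2
        + (4 * h^2 * L^2 * CARD('n) * \<eta> + err2 h * \<eta>^2 * G ^ 4))"
proof -
  define s where "s = (\<lambda>r :: (real ^ 'n) \<times> real. norm (step \<eta> x (fst r)))"
  define e where "e = (\<lambda>r. norm (rejection \<eta> x r))"
  define n where "n = (\<lambda>r :: (real ^ 'n) \<times> real. H x ((\<kappa> * sqrt (2 * \<eta>)) *\<^sub>R fst r))"
  define \<theta> where "\<theta> = (\<lambda>r. \<kappa> *\<^sub>R (g (mala \<eta> x r) - g x) - rejection \<eta> x r)"
  define \<rho> where "\<rho> = (\<lambda>r. \<theta> r - n r)"
  interpret H: bounded_linear "H x"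
    by (rule H_linear)
  have h: "0 \<le> h"
    using \<kappa> by simp
  have G: "1 \<le> G" "norm (g x) \<le> G"
    by (auto simp: G_def)
  have sq: "0 \<le> sqrt \<eta>" "sqrt \<eta> \<le> 1" "sqrt \<eta> * sqrt \<eta> = \<eta>"
    using \<eta> by auto
  have s_int: "integrable noise (\<lambda>r. s r ^ m)" for m
    unfolding s_def by (rule integrable_norm_step_power[OF \<eta>(1,2)])
  have s2: "integral\<^sup>L noise (\<lambda>r. (s r)^2) \<le> 2 * \<eta> * CARD('n) + \<eta>^2 * (norm (g x))^2"
    unfolding s_def by (rule integral_norm_step_square_le[OF \<eta>(1)])
  have es: "e r \<le> s r" for r
    unfolding e_def s_def by (rule norm_rejection_le)
  have e_int: "integrable noise (\<lambda>r. e r ^ m)" for m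
    by (rule Bochner_Integration.integrable_bound[OF s_int[of m]])
      (auto simp: e_def s_def intro!: AE_I2 power_mono norm_rejection_le)
  have e_le: "integral\<^sup>L noise (\<lambda>r. e r ^ m) \<le> 2 * L * \<eta> * sqrt \<eta> ^ m * G ^ (m + 2) * gmoment TYPE('n) (m + 2)"
    if "m \<noteq> 0" for m
  proof (rule integral_le_of_nn_integral[OF e_int])
    show "0 \<le> 2 * L * \<eta> * sqrt \<eta> ^ m * G ^ (m + 2) * gmoment TYPE('n) (m + 2)"
      using L_pos \<eta> G gmoment_nonneg by (intro mult_nonneg_nonneg zero_le_power) auto
    show "(\<integral>\<^sup>+ r. ennreal (e r ^ m) \<partial>noise)
        \<le> ennreal (2 * L * \<eta> * sqrt \<eta> ^ m * G ^ (m + 2) * gmoment TYPE('n) (m + 2))"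
      unfolding e_def G_def by (rule nn_integral_rejection_power_le[OF \<eta> that])
  qed (simp add: e_def)
  have diff_le: "norm (mala \<eta> x r - x) \<le> s r" for r
    unfolding s_def by (rule norm_mala_diff_le)
  \<comment> \<open>The summands stem, in this order, from the Hessian at the rejection, the Hessian
    at the drift, the Taylor error of the gradient, and the rejection itself.\<close>
  define b where "b = (\<lambda>r. \<kappa> * (L * e r + \<eta> * L * norm (g x) + M2 / 2 * (s r)^2) + e r)"
  have \<rho>_le: "norm (\<rho> r) \<le> b r" for r
  proof -
    define R where "R = g (mala \<eta> x r) - g x - H x (mala \<eta> x r - x)"
    have "norm R \<le> M2 / 2 * (norm (mala \<eta> x r - x))^2"
      unfolding R_def by (rule taylor)
    also have "\<dots> \<le> M2 / 2 * (s r)^2"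
      using M2_nonneg diff_le by (intro mult_left_mono power_mono) auto
    finally have R: "norm R \<le> M2 / 2 * (s r)^2" .
    have "mala \<eta> x r - x = rejection \<eta> x r - \<eta> *\<^sub>R g x + sqrt (2 * \<eta>) *\<^sub>R fst r"
      by (simp add: rejection_def step_def)
    then have "H x (mala \<eta> x r - x) = H x (rejection \<eta> x r) - \<eta> *\<^sub>R H x (g x) + sqrt (2 * \<eta>) *\<^sub>R H x (fst r)"
      by (simp add: H.add H.diff H.scaleR)
    then have "\<rho> r = \<kappa> *\<^sub>R (H x (rejection \<eta> x r) - \<eta> *\<^sub>R H x (g x) + R) - rejection \<eta> x r"
      by (simp add: \<rho>_def \<theta>_def n_def R_def H.scaleR algebra_simps)
    also have "norm \<dots> \<le> \<kappa> * norm (H x (rejection \<eta> x r) - \<eta> *\<^sub>R H x (g x) + R) + e r"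
      unfolding e_def using \<kappa> by (intro order.trans[OF norm_triangle_ineq4]) simp
    also have "\<dots> \<le> \<kappa> * (L * e r + \<eta> * L * norm (g x) + M2 / 2 * (s r)^2) + e r"
    proof -
      have "norm (H x (rejection \<eta> x r) - \<eta> *\<^sub>R H x (g x) + R)
          \<le> norm (H x (rejection \<eta> x r)) + norm (\<eta> *\<^sub>R H x (g x)) + norm R"
        by (intro order.trans[OF norm_triangle_ineq] add_mono norm_triangle_ineq4) auto
      also have "\<dots> \<le> L * e r + \<eta> * (L * norm (g x)) + M2 / 2 * (s r)^2"
        using \<eta> H_bound R unfolding e_def by (intro add_mono) auto
      finally show ?thesis
        using \<kappa> by (intro add_mono mult_left_mono) (auto simp: mult.assoc)
    qed
    finally show ?thesis
      by (simp add: b_def)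
  qed
  have b_int: "integrable noise b"
    unfolding b_def using e_int[of 1] s_int[of 2] by auto
  have meas: "\<rho> \<in> borel_measurable noise" "n \<in> borel_measurable noise"
  proof -
    have "H x \<in> borel_measurable borel"
      using H.continuous_on[OF continuous_on_id] by (intro borel_measurable_continuous_onI) simp
    then have "(\<lambda>r. H x ((\<kappa> * sqrt (2 * \<eta>)) *\<^sub>R fst r)) \<in> borel_measurable noise"
      by (rule measurable_compose[rotated]) measurable
    then show "n \<in> borel_measurable noise"
      by (simp add: n_def)
    then show "\<rho> \<in> borel_measurable noise"
      unfolding \<rho>_def \<theta>_def by measurable
  qed
  have n_int: "integrable noise n" "integral\<^sup>L noise n = 0"
  proof -
    have i: "integrable gaussian (\<lambda>z. H x ((\<kappa> * sqrt (2 * \<eta>)) *\<^sub>R z))"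
      by (intro integrable_bounded_linear[OF H_linear] integrable_scaleR_right integrable_gaussian_id)
    show "integrable noise n"
      unfolding n_def by (rule integrable_noise_fst(1)[OF i])
    have "integral\<^sup>L noise n = integral\<^sup>L gaussian (\<lambda>z. H x ((\<kappa> * sqrt (2 * \<eta>)) *\<^sub>R z))"
      unfolding n_def by (rule integrable_noise_fst(2)[OF i])
    also have "\<dots> = H x (integral\<^sup>L gaussian (\<lambda>z. (\<kappa> * sqrt (2 * \<eta>)) *\<^sub>R z))"
      by (intro integral_bounded_linear[OF H_linear] integrable_scaleR_right integrable_gaussian_id)
    also have "\<dots> = 0"
      by (subst integral_scaleR_right) (simp add: integral_gaussian_id H.zero)
    finally show "integral\<^sup>L noise n = 0" .
  qed
  have b_nonneg: "0 \<le> b r" for r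
    using \<rho>_le[of r] norm_ge_zero order.trans by blast
  have \<rho>_int: "integrable noise \<rho>"
    by (rule Bochner_Integration.integrable_bound[OF b_int meas(1)])
      (use \<rho>_le b_nonneg in \<open>auto intro!: AE_I2\<close>)
  let ?B = "\<kappa> * \<eta> * (L * norm (g x) + M2 * CARD('n)) + err1 h * (\<eta> * sqrt \<eta>) * G ^ 3"
  let ?T = "4 * h^2 * L^2 * CARD('n) * \<eta> + err2 h * \<eta>^2 * G ^ 4"
  have \<rho>_B: "integral\<^sup>L noise (\<lambda>r. norm (\<rho> r)) \<le> ?B"
  proof -
    define E where "E = 2 * L * gmoment TYPE('n) 3 * (\<eta> * sqrt \<eta>) * G ^ 3"
    have "0 \<le> E"
      unfolding E_def using L_pos \<eta> G gmoment_nonneg by (intro mult_nonneg_nonneg zero_le_power) auto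
    moreover have "integral\<^sup>L noise e \<le> E"
      using e_le[of 1] by (simp add: E_def numeral_3_eq_3 mult_ac)
    ultimately have E: "integral\<^sup>L noise e \<le> E" "0 \<le> E"
      by auto
    have "integral\<^sup>L noise (\<lambda>r. norm (\<rho> r)) \<le> integral\<^sup>L noise b"
      using \<rho>_int b_int \<rho>_le by (intro integral_mono) auto
    also have "\<dots> = \<kappa> * (L * integral\<^sup>L noise e + \<eta> * L * norm (g x) + M2 / 2 * integral\<^sup>L noise (\<lambda>r. (s r)^2)) + integral\<^sup>L noise e"
      unfolding b_def using e_int[of 1] s_int[of 2] by (simp add: noise.prob_space)
    also have "\<dots> \<le> \<kappa> * (L * E + \<eta> * L * norm (g x) + M2 / 2 * (2 * \<eta> * CARD('n) + \<eta>^2 * (norm (g x))^2)) + E"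
      using \<kappa> \<eta> L_pos M2_nonneg E s2 by (intro add_mono mult_left_mono) auto
    also have "\<dots> = \<kappa> * \<eta> * (L * norm (g x) + M2 * CARD('n)) + (\<kappa> * (M2 / 2 * (\<eta>^2 * (norm (g x))^2)) + (\<kappa> * L + 1) * E)"
      by (simp add: field_simps)
    also have "\<dots> \<le> \<kappa> * \<eta> * (L * norm (g x) + M2 * CARD('n)) + (h * (M2 / 2 * ((\<eta> * sqrt \<eta>) * G ^ 3)) + (h * L + 1) * E)"
    proof (intro add_mono mult_mono mult_left_mono mult_right_mono)
      have "\<eta> \<le> sqrt \<eta>"
        using sq by (metis mult_left_le)
      then show "\<eta>^2 \<le> \<eta> * sqrt \<eta>"
        using \<eta> by (simp add: power2_eq_square)
      have "(norm (g x))^2 \<le> G^2"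
        using G by (intro power_mono) auto
      also have "\<dots> \<le> G ^ 3"
        using G by (intro power_increasing) auto
      finally show "(norm (g x))^2 \<le> G ^ 3" .
    qed (use \<kappa> h M2_nonneg L_pos \<eta> E G in auto)
    also have "\<dots> = ?B"
      by (simp add: E_def err1_def algebra_simps)
    finally show ?thesis .
  qed
  \<comment> \<open>The second moment is bounded without the splitting, by Lipschitz continuity and
    \<open>(a + b)^2 \<le> 2 * a^2 + 2 * b^2\<close>. This 2 and the one in the mean square step
    make up the 4 in \<open>?T\<close>.\<close>
  have \<theta>_le: "(norm (\<theta> r))^2 \<le> 2 * h^2 * L^2 * (s r)^2 + 2 * (e r)^2" for r
  proof -
    have "norm (\<theta> r) \<le> \<kappa> * norm (g (mala \<eta> x r) - g x) + e r"
      unfolding \<theta>_def e_def using \<kappa> by (intro order.trans[OF norm_triangle_ineq4]) simp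
    also have "\<dots> \<le> h * (L * s r) + e r"
      using \<kappa> h L_pos by (intro add_mono mult_mono order.trans[OF lipschitz] mult_left_mono diff_le) auto
    finally have "(norm (\<theta> r))^2 \<le> (h * (L * s r) + e r)^2"
      by (intro power_mono) auto
    also have "\<dots> \<le> 2 * (h * (L * s r))^2 + 2 * (e r)^2"
      using zero_le_power2[of "h * (L * s r) - e r"] by (simp add: power2_sum power2_diff)
    finally show ?thesis
      by (simp add: power_mult_distrib)
  qed
  have bound_int: "integrable noise (\<lambda>r. 2 * h^2 * L^2 * (s r)^2 + 2 * (e r)^2)"
    using s_int[of 2] e_int[of 2] by auto
  have \<theta>_int: "integrable noise (\<lambda>r. (norm (\<theta> r))^2)"
  proof (rule Bochner_Integration.integrable_bound[OF bound_int])
    show "(\<lambda>r. (norm (\<theta> r))^2) \<in> borel_measurable noise"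
      unfolding \<theta>_def by measurable
    show "AE r in noise. norm ((norm (\<theta> r))^2) \<le> norm (2 * h^2 * L^2 * (s r)^2 + 2 * (e r)^2)"
      using order.trans[OF \<theta>_le abs_ge_self] by (intro AE_I2) simp
  qed
  have \<theta>_T: "integral\<^sup>L noise (\<lambda>r. (norm (\<theta> r))^2) \<le> ?T"
  proof -
    have "integral\<^sup>L noise (\<lambda>r. (norm (\<theta> r))^2) \<le> integral\<^sup>L noise (\<lambda>r. 2 * h^2 * L^2 * (s r)^2 + 2 * (e r)^2)"
      using \<theta>_int bound_int \<theta>_le by (intro integral_mono) auto
    also have "\<dots> = 2 * h^2 * L^2 * integral\<^sup>L noise (\<lambda>r. (s r)^2) + 2 * integral\<^sup>L noise (\<lambda>r. (e r)^2)"
      using s_int[of 2] e_int[of 2] by simp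
    also have "\<dots> \<le> 2 * h^2 * L^2 * (2 * \<eta> * CARD('n) + \<eta>^2 * G ^ 4) + 2 * (2 * L * \<eta> * \<eta> * G ^ 4 * gmoment TYPE('n) 4)"
    proof (intro add_mono mult_left_mono)
      have "(norm (g x))^2 \<le> G^2"
        using G by (intro power_mono) auto
      also have "\<dots> \<le> G ^ 4"
        using G by (intro power_increasing) auto
      finally have "\<eta>^2 * (norm (g x))^2 \<le> \<eta>^2 * G ^ 4"
        by (intro mult_left_mono) auto
      then show "integral\<^sup>L noise (\<lambda>r. (s r)^2) \<le> 2 * \<eta> * CARD('n) + \<eta>^2 * G ^ 4"
        using s2 by linarith
      show "integral\<^sup>L noise (\<lambda>r. (e r)^2) \<le> 2 * L * \<eta> * \<eta> * G ^ 4 * gmoment TYPE('n) 4"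
        using e_le[of 2] \<eta> by simp
    qed auto
    also have "\<dots> = ?T"
      by (simp add: err2_def algebra_simps power2_eq_square)
    finally show ?thesis .
  qed
  have eq: "n r + \<rho> r = \<theta> r" for r
    by (simp add: \<rho>_def)
  have "(\<integral>\<^sup>+ r. ennreal ((norm (v + (n r + \<rho> r)))^2) \<partial>noise) \<le> ennreal ((norm v + ?B)^2 + ?T)"
    by (rule noise.nn_integral_norm_add_square_le[OF n_int \<rho>_int \<rho>_B]) (simp_all only: eq \<theta>_int \<theta>_T)
  then show ?thesis
    unfolding eq by (simp only: \<theta>_def)
qed

text \<open>Minkowski's inequality in mean square over \<open>gibbs\<close>:
  \<open>norm (g x)\<close> contributes \<open>sqrt (L * CARD('n))\<close>, and the cube accounts
  for the sixth moment \<open>S^2\<close>.\<close>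

lemma drift_bound:
  assumes "0 \<le> c" "0 \<le> d" "0 \<le> S" "(\<integral>\<^sup>+ x. ennreal ((1 + norm (g x)) ^ 6) \<partial>gibbs) \<le> ennreal (S^2)"
  shows "(\<integral>\<^sup>+ x. ennreal ((c * (L * norm (g x) + M2 * CARD('n)) + d * (1 + norm (g x)) ^ 3)^2) \<partial>gibbs)
    \<le> ennreal ((c * (L * sqrt (L * CARD('n)) + M2 * CARD('n)) + d * S)^2)"
proof (rule nn_integral_square_add_le)
  have scale: "(\<integral>\<^sup>+ x. ennreal ((a * f x)^2) \<partial>gibbs) \<le> ennreal ((a * b)^2)"
    if [measurable]: "f \<in> borel_measurable gibbs" and "(\<integral>\<^sup>+ x. ennreal ((f x)^2) \<partial>gibbs) \<le> ennreal (b^2)" for a b f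
  proof -
    have "(\<integral>\<^sup>+ x. ennreal ((a * f x)^2) \<partial>gibbs) = ennreal (a^2) * (\<integral>\<^sup>+ x. ennreal ((f x)^2) \<partial>gibbs)"
      by (subst nn_integral_cmult[symmetric]) (auto simp: power_mult_distrib ennreal_mult)
    also have "\<dots> \<le> ennreal (a^2) * ennreal (b^2)"
      by (intro mult_left_mono that) auto
    finally show ?thesis
      by (simp add: power_mult_distrib ennreal_mult)
  qed
  show "(\<integral>\<^sup>+ x. ennreal ((c * (L * norm (g x) + M2 * CARD('n)))^2) \<partial>gibbs)
      \<le> ennreal ((c * (L * sqrt (L * CARD('n)) + M2 * CARD('n)))^2)"
  proof (rule scale)
    show "(\<integral>\<^sup>+ x. ennreal ((L * norm (g x) + M2 * CARD('n))^2) \<partial>gibbs)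
        \<le> ennreal ((L * sqrt (L * CARD('n)) + M2 * CARD('n))^2)"
    proof (rule nn_integral_square_add_le)
      show "(\<integral>\<^sup>+ x. ennreal ((L * norm (g x))^2) \<partial>gibbs) \<le> ennreal ((L * sqrt (L * CARD('n)))^2)"
        using nn_integral_norm_gradient_square_le L_pos by (intro scale) (auto simp: mult.commute)
      show "(\<integral>\<^sup>+ x. ennreal ((M2 * CARD('n))^2) \<partial>gibbs) \<le> ennreal ((M2 * CARD('n))^2)"
        by (simp add: emeasure_space_1[simplified])
    qed (use L_pos M2_nonneg in auto)
  qed measurable
  show "(\<integral>\<^sup>+ x. ennreal ((d * (1 + norm (g x)) ^ 3)^2) \<partial>gibbs) \<le> ennreal ((d * S)^2)"
    using assms(4) by (intro scale) (auto simp flip: power_mult)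
qed (use assms L_pos M2_nonneg in auto)

end

section \<open>Coupling of the two chains\<close>

text \<open>Keeps the error in the shape root of accumulated variance plus accumulated bias: a new
  variance \<open>T\<close> moves under the root, while the bias \<open>b\<close> stays
  outside.\<close>

lemma sqrt_add_square_le:
  fixes u b T :: real
  assumes "0 \<le> u" "0 \<le> b" "0 \<le> T"
  shows "(sqrt u + b)^2 + T \<le> (sqrt (u + T) + b)^2"
proof -
  have "sqrt u * b \<le> sqrt (u + T) * b"
    using assms by (intro mult_right_mono) auto
  then show ?thesis
    using assms by (simp add: power2_sum)
qed

context langevin
begin

text \<open>The first marginal is left open; it follows the LMC iterates and is recorded separately
  wherever such a coupling is built.\<close>

definition gibbs_coupling :: "((real ^ 'n) \<times> (real ^ 'n)) measure \<Rightarrow> real \<Rightarrow> bool" where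
  "gibbs_coupling \<gamma> D \<longleftrightarrow> sets \<gamma> = sets (borel \<Otimes>\<^sub>M borel) \<and> prob_space \<gamma> \<and> 0 \<le> D \<and>
    (\<forall>F. F \<in> borel_measurable borel \<longrightarrow> (\<integral>\<^sup>+ s. F (snd s) \<partial>\<gamma>) = (\<integral>\<^sup>+ x. F x \<partial>gibbs)) \<and>
    (\<integral>\<^sup>+ s. ennreal ((norm (fst s - snd s))^2) \<partial>\<gamma>) \<le> ennreal (D^2)"

lemma gibbs_couplingD:
  assumes "gibbs_coupling \<gamma> D"
  shows "sets \<gamma> = sets (borel \<Otimes>\<^sub>M borel)" "prob_space \<gamma>" "0 \<le> D"
    "\<And>F. F \<in> borel_measurable borel \<Longrightarrow> (\<integral>\<^sup>+ s. F (snd s) \<partial>\<gamma>) = (\<integral>\<^sup>+ x. F x \<partial>gibbs)"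
    "(\<integral>\<^sup>+ s. ennreal ((norm (fst s - snd s))^2) \<partial>\<gamma>) \<le> ennreal (D^2)"
  using assms by (auto simp: gibbs_coupling_def)

definition fine_step where
  "fine_step \<eta> s r = (fst s, fst (snd s) - \<eta> *\<^sub>R g (fst s) + sqrt (2 * \<eta>) *\<^sub>R fst r, mala \<eta> (snd (snd s)) r)"

lemma fine_step_measurable [measurable]:
  assumes [measurable]: "a \<in> measurable M (borel \<Otimes>\<^sub>M (borel \<Otimes>\<^sub>M borel))" "b \<in> measurable M (borel \<Otimes>\<^sub>M borel)"
  shows "(\<lambda>x. fine_step \<eta> (a x) (b x)) \<in> measurable M (borel \<Otimes>\<^sub>M (borel \<Otimes>\<^sub>M borel))"
  unfolding fine_step_def by measurable

lemma nn_integral_fine_step: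
  fixes \<mu> :: "((real ^ 'n) \<times> (real ^ 'n) \<times> (real ^ 'n)) measure" and \<eta> :: real
  assumes sets_eq [measurable_cong]: "sets \<mu> = sets (borel \<Otimes>\<^sub>M (borel \<Otimes>\<^sub>M borel))" and "prob_space \<mu>"
    and [measurable]: "F \<in> borel_measurable (borel \<Otimes>\<^sub>M (borel \<Otimes>\<^sub>M borel))"
  defines "\<Phi> \<equiv> \<lambda>(s, r). fine_step \<eta> s r"
  shows "(\<integral>\<^sup>+ s. F s \<partial>distr (\<mu> \<Otimes>\<^sub>M noise) (borel \<Otimes>\<^sub>M (borel \<Otimes>\<^sub>M borel)) \<Phi>)
      = (\<integral>\<^sup>+ s. \<integral>\<^sup>+ r. F (fine_step \<eta> s r) \<partial>noise \<partial>\<mu>)"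
    "prob_space (distr (\<mu> \<Otimes>\<^sub>M noise) (borel \<Otimes>\<^sub>M (borel \<Otimes>\<^sub>M borel)) \<Phi>)"
proof -
  have [measurable]: "\<Phi> \<in> measurable (\<mu> \<Otimes>\<^sub>M noise) (borel \<Otimes>\<^sub>M (borel \<Otimes>\<^sub>M borel))"
    unfolding \<Phi>_def by measurable
  show "(\<integral>\<^sup>+ s. F s \<partial>distr (\<mu> \<Otimes>\<^sub>M noise) (borel \<Otimes>\<^sub>M (borel \<Otimes>\<^sub>M borel)) \<Phi>)
      = (\<integral>\<^sup>+ s. \<integral>\<^sup>+ r. F (fine_step \<eta> s r) \<partial>noise \<partial>\<mu>)"
    by (subst nn_integral_distr, measurable, subst noise.nn_integral_fst[symmetric]) (simp_all add: \<Phi>_def)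
  show "prob_space (distr (\<mu> \<Otimes>\<^sub>M noise) (borel \<Otimes>\<^sub>M (borel \<Otimes>\<^sub>M borel)) \<Phi>)"
    by (intro prob_space.prob_space_distr prob_space_pair noise.prob_space_axioms \<open>prob_space \<mu>\<close>) measurable
qed

text \<open>
  One LMC step of size \<open>h = N \<eta>\<close> against \<open>N\<close> MALA steps of size \<open>\<eta>\<close> driven by the same
  Gaussian vectors. The state \<open>(t, w, x)\<close> consists of the LMC iterate frozen at the start of
  the step, its interpolation and the MALA chain. The error is tracked through
  \<open>w - x + (N - j) \<eta> (g x - g t)\<close>, whose increments have a conditional mean of order \<open>\<eta>^2\<close>.
\<close>

lemma fine_chain:
  fixes \<gamma> :: "((real ^ 'n) \<times> (real ^ 'n)) measure" and a D h \<eta> S S' :: real and N j :: nat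
  assumes \<gamma>: "gibbs_coupling \<gamma> D"
    and a: "0 \<le> a" "\<And>x y. norm ((x - h *\<^sub>R g x) - (y - h *\<^sub>R g y)) \<le> a * norm (x - y)"
    and h: "h = real N * \<eta>" and \<eta>: "0 < \<eta>" "\<eta> \<le> 1" "\<eta> * L \<le> 1"
    and S: "0 \<le> S" "(\<integral>\<^sup>+ x. ennreal ((1 + norm (g x)) ^ 6) \<partial>gibbs) \<le> ennreal (S^2)"
    and S': "0 \<le> S'" "(\<integral>\<^sup>+ x. ennreal ((1 + norm (g x)) ^ 4) \<partial>gibbs) \<le> ennreal S'"
  defines "T \<equiv> 4 * h^2 * L^2 * CARD('n) * \<eta> + err2 h * \<eta>^2 * S'"
    and "\<beta> \<equiv> \<lambda>i. ((real N - real (Suc i)) * \<eta>) * \<eta> * (L * sqrt (L * CARD('n)) + M2 * CARD('n)) + err1 h * (\<eta> * sqrt \<eta>) * S"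
  assumes "j \<le> N"
  shows "\<exists>\<mu>. sets \<mu> = sets (borel \<Otimes>\<^sub>M (borel \<Otimes>\<^sub>M borel)) \<and> prob_space \<mu> \<and>
    (\<forall>F. case_prod F \<in> borel_measurable (borel \<Otimes>\<^sub>M borel) \<longrightarrow>
      (\<integral>\<^sup>+ s. F (fst s) (fst (snd s)) \<partial>\<mu>)
        = (\<integral>\<^sup>+ s. \<integral>\<^sup>+ z. F (fst s) (fst s - (real j * \<eta>) *\<^sub>R g (fst s) + sqrt (2 * (real j * \<eta>)) *\<^sub>R z) \<partial>gaussian \<partial>\<gamma>)) \<and>
    (\<forall>F. F \<in> borel_measurable borel \<longrightarrow> (\<integral>\<^sup>+ s. F (snd (snd s)) \<partial>\<mu>) = (\<integral>\<^sup>+ x. F x \<partial>gibbs)) \<and>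
    (\<integral>\<^sup>+ s. ennreal ((norm (fst (snd s) - snd (snd s)
        + ((real N - real j) * \<eta>) *\<^sub>R (g (snd (snd s)) - g (fst s))))^2) \<partial>\<mu>)
      \<le> ennreal ((sqrt ((a * D)^2 + real j * T) + (\<Sum>i<j. \<beta> i))^2)"
    (is "\<exists>\<mu>. ?P j \<mu>")
  using \<open>j \<le> N\<close>
proof (induction j)
  note sets_eq [measurable_cong] = gibbs_couplingD(1)[OF \<gamma>] and D = gibbs_couplingD(5,3)[OF \<gamma>]
  case 0
  interpret \<gamma>: prob_space \<gamma> by (rule gibbs_couplingD(2)[OF \<gamma>])
  let ?\<mu> = "distr \<gamma> (borel \<Otimes>\<^sub>M (borel \<Otimes>\<^sub>M borel)) (\<lambda>s. (fst s, fst s, snd s))"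
  \<comment> \<open>At \<open>j = 0\<close> the tracked quantity is the difference of two gradient
    steps of size \<open>h\<close>. The contraction factor \<open>a\<close> enters here, once per
    LMC step.\<close>
  have "(\<integral>\<^sup>+ s. ennreal ((norm (fst s - snd s + h *\<^sub>R (g (snd s) - g (fst s))))^2) \<partial>\<gamma>) \<le> ennreal ((a * D)^2)"
  proof -
    have "(\<integral>\<^sup>+ s. ennreal ((norm (fst s - snd s + h *\<^sub>R (g (snd s) - g (fst s))))^2) \<partial>\<gamma>)
        \<le> (\<integral>\<^sup>+ s. ennreal (a^2) * ennreal ((norm (fst s - snd s))^2) \<partial>\<gamma>)"
    proof (rule nn_integral_mono)
      fix s
      have "norm (fst s - snd s + h *\<^sub>R (g (snd s) - g (fst s))) \<le> a * norm (fst s - snd s)"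
        using a(2)[of "fst s" "snd s"] by (simp add: algebra_simps)
      then have "(norm (fst s - snd s + h *\<^sub>R (g (snd s) - g (fst s))))^2 \<le> a^2 * (norm (fst s - snd s))^2"
        by (metis norm_ge_zero power_mono power_mult_distrib)
      then show "ennreal ((norm (fst s - snd s + h *\<^sub>R (g (snd s) - g (fst s))))^2) \<le> ennreal (a^2) * ennreal ((norm (fst s - snd s))^2)"
        by (simp flip: ennreal_mult)
    qed
    also have "\<dots> = ennreal (a^2) * (\<integral>\<^sup>+ s. ennreal ((norm (fst s - snd s))^2) \<partial>\<gamma>)"
      by (rule nn_integral_cmult) measurable
    also have "\<dots> \<le> ennreal (a^2) * ennreal (D^2)"
      by (intro mult_left_mono D) auto
    finally show ?thesis
      by (simp add: power_mult_distrib ennreal_mult)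
  qed
  moreover have "prob_space ?\<mu>"
    by (rule \<gamma>.prob_space_distr) measurable
  ultimately show ?case
    using D(2) a(1) h
    by (intro exI[of _ ?\<mu>]) (auto simp: nn_integral_distr gibbs_couplingD(4)[OF \<gamma>] gaussian.emeasure_space_1[simplified] real_sqrt_unique)
next
  note sets_eq [measurable_cong] = gibbs_couplingD(1)[OF \<gamma>]
  case (Suc j)
  then obtain \<mu> where IH: "?P j \<mu>"
    by auto
  note sets_\<mu> [measurable_cong] = IH[THEN conjunct1] and prob_\<mu> = IH[THEN conjunct2, THEN conjunct1]
    and \<mu>_tw = IH[THEN conjunct2, THEN conjunct2, THEN conjunct1, rule_format]
    and \<mu>_x = IH[THEN conjunct2, THEN conjunct2, THEN conjunct2, THEN conjunct1, rule_format]
    and \<mu>_D = IH[THEN conjunct2, THEN conjunct2, THEN conjunct2, THEN conjunct2]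
  let ?S = "borel \<Otimes>\<^sub>M (borel \<Otimes>\<^sub>M borel) :: ((real ^ 'n) \<times> (real ^ 'n) \<times> (real ^ 'n)) measure"
  define \<mu>' where "\<mu>' = distr (\<mu> \<Otimes>\<^sub>M noise) ?S (\<lambda>(s, r). fine_step \<eta> s r)"
  note \<mu>'_int = nn_integral_fine_step(1)[OF sets_\<mu> prob_\<mu>, where \<eta> = \<eta>, folded \<mu>'_def]
  have prob_\<mu>': "prob_space \<mu>'"
    using nn_integral_fine_step(2)[OF sets_\<mu> prob_\<mu>, where F = "\<lambda>_. 0"] by (simp add: \<mu>'_def)
  \<comment> \<open>Given its start, the interpolation is exactly Gaussian: \<open>j\<close>
    increments and one more merge into variance \<open>2 * (real (Suc j) * \<eta>)\<close> per
    coordinate. At \<open>j = N\<close> this is the law of one LMC step.\<close>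
  have \<mu>'_tw: "(\<integral>\<^sup>+ s. F (fst s) (fst (snd s)) \<partial>\<mu>')
      = (\<integral>\<^sup>+ s. \<integral>\<^sup>+ z. F (fst s) (fst s - (real (Suc j) * \<eta>) *\<^sub>R g (fst s) + sqrt (2 * (real (Suc j) * \<eta>)) *\<^sub>R z) \<partial>gaussian \<partial>\<gamma>)"
    if [measurable]: "case_prod F \<in> borel_measurable (borel \<Otimes>\<^sub>M borel)" for F
  proof -
    have "(\<integral>\<^sup>+ s. F (fst s) (fst (snd s)) \<partial>\<mu>')
        = (\<integral>\<^sup>+ s. \<integral>\<^sup>+ r. F (fst s) (fst (snd s) - \<eta> *\<^sub>R g (fst s) + sqrt (2 * \<eta>) *\<^sub>R fst r) \<partial>noise \<partial>\<mu>)"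
      by (subst \<mu>'_int) (simp_all add: fine_step_def)
    also have "\<dots> = (\<integral>\<^sup>+ s. \<integral>\<^sup>+ z. F (fst s) (fst (snd s) - \<eta> *\<^sub>R g (fst s) + sqrt (2 * \<eta>) *\<^sub>R z) \<partial>gaussian \<partial>\<mu>)"
      by (subst distr_noise_fst[symmetric], subst nn_integral_distr) simp_all
    also have "\<dots> = (\<integral>\<^sup>+ s. \<integral>\<^sup>+ z'. \<integral>\<^sup>+ z. F (fst s) ((fst s - (real j * \<eta>) *\<^sub>R g (fst s) + sqrt (2 * (real j * \<eta>)) *\<^sub>R z')
        - \<eta> *\<^sub>R g (fst s) + sqrt (2 * \<eta>) *\<^sub>R z) \<partial>gaussian \<partial>gaussian \<partial>\<gamma>)"
      by (subst \<mu>_tw[of "\<lambda>t w. \<integral>\<^sup>+ z. F t (w - \<eta> *\<^sub>R g t + sqrt (2 * \<eta>) *\<^sub>R z) \<partial>gaussian"]) simp_all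
    also have "\<dots> = (\<integral>\<^sup>+ s. \<integral>\<^sup>+ z'. \<integral>\<^sup>+ z. F (fst s) ((fst s - (real (Suc j) * \<eta>) *\<^sub>R g (fst s)) + sqrt (2 * (real j * \<eta>)) *\<^sub>R z'
        + sqrt (2 * \<eta>) *\<^sub>R z) \<partial>gaussian \<partial>gaussian \<partial>\<gamma>)"
      by (simp add: algebra_simps)
    also have "\<dots> = (\<integral>\<^sup>+ s. \<integral>\<^sup>+ z. F (fst s) (fst s - (real (Suc j) * \<eta>) *\<^sub>R g (fst s) + sqrt (2 * (real (Suc j) * \<eta>)) *\<^sub>R z) \<partial>gaussian \<partial>\<gamma>)"
    proof (rule nn_integral_cong)
      fix s
      show "(\<integral>\<^sup>+ z'. \<integral>\<^sup>+ z. F (fst s) ((fst s - (real (Suc j) * \<eta>) *\<^sub>R g (fst s)) + sqrt (2 * (real j * \<eta>)) *\<^sub>R z'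
          + sqrt (2 * \<eta>) *\<^sub>R z) \<partial>gaussian \<partial>gaussian)
        = (\<integral>\<^sup>+ z. F (fst s) (fst s - (real (Suc j) * \<eta>) *\<^sub>R g (fst s) + sqrt (2 * (real (Suc j) * \<eta>)) *\<^sub>R z) \<partial>gaussian)"
        using \<eta>(1) by (intro nn_integral_gaussian_add[where F = "F (fst s)"]) (auto simp: algebra_simps intro!: add_pos_nonneg)
    qed
    finally show ?thesis .
  qed
  have \<mu>'_x: "(\<integral>\<^sup>+ s. F (snd (snd s)) \<partial>\<mu>') = (\<integral>\<^sup>+ x. F x \<partial>gibbs)" if [measurable]: "F \<in> borel_measurable borel" for F
  proof -
    have "(\<integral>\<^sup>+ s. F (snd (snd s)) \<partial>\<mu>') = (\<integral>\<^sup>+ s. \<integral>\<^sup>+ r. F (mala \<eta> (snd (snd s)) r) \<partial>noise \<partial>\<mu>)"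
      by (subst \<mu>'_int) (simp_all add: fine_step_def)
    also have "\<dots> = (\<integral>\<^sup>+ x. \<integral>\<^sup>+ r. F (mala \<eta> x r) \<partial>noise \<partial>gibbs)"
      by (rule \<mu>_x[of "\<lambda>x. \<integral>\<^sup>+ r. F (mala \<eta> x r) \<partial>noise"]) measurable
    also have "\<dots> = (\<integral>\<^sup>+ x. F x \<partial>gibbs)"
      by (rule nn_integral_mala_invariant[OF that \<eta>(1)])
    finally show ?thesis .
  qed
  define \<kappa> where "\<kappa> = (real N - real (Suc j)) * \<eta>"
  have \<kappa>: "0 \<le> \<kappa>" "\<kappa> \<le> h"
    using Suc.prems \<eta> h by (auto simp: \<kappa>_def intro!: mult_right_mono)
  have h0: "0 \<le> h"
    using h \<eta> by simp
  define \<Lambda> where "\<Lambda> = (\<lambda>s :: (real ^ 'n) \<times> (real ^ 'n) \<times> (real ^ 'n). fst (snd s) - snd (snd s)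
    + ((real N - real j) * \<eta>) *\<^sub>R (g (snd (snd s)) - g (fst s)))"
  have [measurable]: "\<Lambda> \<in> borel_measurable ?S"
    unfolding \<Lambda>_def by measurable
  define B where "B = (\<lambda>x. \<kappa> * \<eta> * (L * norm (g x) + M2 * CARD('n)) + err1 h * (\<eta> * sqrt \<eta>) * (1 + norm (g x)) ^ 3)"
  define T0 where "T0 = (\<lambda>x. 4 * h^2 * L^2 * CARD('n) * \<eta> + err2 h * \<eta>^2 * (1 + norm (g x)) ^ 4)"
  have [measurable]: "B \<in> borel_measurable borel" "T0 \<in> borel_measurable borel"
    unfolding B_def T0_def by measurable
  have nn: "0 \<le> B x" "0 \<le> T0 x" for x
    unfolding B_def T0_def using \<kappa> \<eta> L_pos M2_nonneg err_nonneg h0 by (auto intro!: add_nonneg_nonneg mult_nonneg_nonneg)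
  \<comment> \<open>The Gaussian terms cancel. The difference of the drifts, \<eta> times a gradient
    difference, is absorbed by the weight dropping from \<open>N - j\<close> to
    \<open>N - Suc j\<close>. What remains is the change of the gradient along the MALA move and the
    rejection.\<close>
  have step_eq: "fst (snd s) - \<eta> *\<^sub>R g (fst s) + sqrt (2 * \<eta>) *\<^sub>R fst r - mala \<eta> (snd (snd s)) r
        + ((real N - real (Suc j)) * \<eta>) *\<^sub>R (g (mala \<eta> (snd (snd s)) r) - g (fst s))
      = \<Lambda> s + (\<kappa> *\<^sub>R (g (mala \<eta> (snd (snd s)) r) - g (snd (snd s))) - rejection \<eta> (snd (snd s)) r)" for s r
    by (simp add: \<Lambda>_def \<kappa>_def rejection_def step_def algebra_simps)
  let ?l = "sqrt ((a * D)^2 + real j * T)" and ?b = "\<Sum>i<j. \<beta> i"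
  have T: "0 \<le> T"
    unfolding T_def using \<eta> S' err_nonneg by auto
  have \<beta>: "0 \<le> \<beta> i" if "i < N" for i
    unfolding \<beta>_def using that \<eta> L_pos M2_nonneg err_nonneg h0 S by (auto intro!: add_nonneg_nonneg mult_nonneg_nonneg)
  have b: "0 \<le> ?b"
    using Suc.prems by (intro sum_nonneg \<beta>) auto
  have "(\<integral>\<^sup>+ s. ennreal ((norm (fst (snd s) - snd (snd s) + ((real N - real (Suc j)) * \<eta>) *\<^sub>R (g (snd (snd s)) - g (fst s))))^2) \<partial>\<mu>')
      = (\<integral>\<^sup>+ s. \<integral>\<^sup>+ r. ennreal ((norm (\<Lambda> s + (\<kappa> *\<^sub>R (g (mala \<eta> (snd (snd s)) r) - g (snd (snd s))) - rejection \<eta> (snd (snd s)) r)))^2) \<partial>noise \<partial>\<mu>)"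
    by (subst \<mu>'_int, measurable) (simp only: fine_step_def fst_conv snd_conv step_eq)
  also have "\<dots> \<le> (\<integral>\<^sup>+ s. ennreal ((norm (\<Lambda> s) + B (snd (snd s)))^2 + T0 (snd (snd s))) \<partial>\<mu>)"
    unfolding B_def T0_def by (intro nn_integral_mono mala_step_square_le \<eta> \<kappa>)
  also have "\<dots> = (\<integral>\<^sup>+ s. ennreal ((norm (\<Lambda> s) + B (snd (snd s)))^2) \<partial>\<mu>) + (\<integral>\<^sup>+ s. ennreal (T0 (snd (snd s))) \<partial>\<mu>)"
    using nn by (subst nn_integral_add[symmetric]) auto
  also have "\<dots> \<le> ennreal ((?l + ?b + \<beta> j)^2) + ennreal T"
  proof (rule add_mono)
    have "(\<integral>\<^sup>+ s. ennreal ((B (snd (snd s)))^2) \<partial>\<mu>) = (\<integral>\<^sup>+ x. ennreal ((B x)^2) \<partial>gibbs)"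
      by (rule \<mu>_x) measurable
    also have "\<dots> \<le> ennreal ((\<beta> j)^2)"
      unfolding B_def \<beta>_def \<kappa>_def[symmetric] using \<kappa> \<eta> err_nonneg h0 S
      by (intro drift_bound) (auto intro!: mult_nonneg_nonneg)
    finally show "(\<integral>\<^sup>+ s. ennreal ((norm (\<Lambda> s) + B (snd (snd s)))^2) \<partial>\<mu>) \<le> ennreal ((?l + ?b + \<beta> j)^2)"
      using \<mu>_D Suc.prems \<beta>[of j] b T nn by (intro nn_integral_square_add_le) (auto simp: \<Lambda>_def)
    have "(\<integral>\<^sup>+ s. ennreal (T0 (snd (snd s))) \<partial>\<mu>) = (\<integral>\<^sup>+ x. ennreal (T0 x) \<partial>gibbs)"
      by (rule \<mu>_x) measurable
    also have "\<dots> = (\<integral>\<^sup>+ x. ennreal (4 * h^2 * L^2 * CARD('n) * \<eta>) + ennreal (err2 h * \<eta>^2) * ennreal ((1 + norm (g x)) ^ 4) \<partial>gibbs)"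
      using \<eta> err_nonneg L_pos unfolding T0_def
      by (intro nn_integral_cong) (subst ennreal_mult[symmetric], auto simp flip: ennreal_plus)
    also have "\<dots> = ennreal (4 * h^2 * L^2 * CARD('n) * \<eta>) + ennreal (err2 h * \<eta>^2) * (\<integral>\<^sup>+ x. ennreal ((1 + norm (g x)) ^ 4) \<partial>gibbs)"
      by (simp add: nn_integral_add nn_integral_cmult emeasure_space_1[simplified])
    also have "\<dots> \<le> ennreal (4 * h^2 * L^2 * CARD('n) * \<eta>) + ennreal (err2 h * \<eta>^2) * ennreal S'"
      by (intro add_mono mult_left_mono S') auto
    also have "\<dots> = ennreal T"
      unfolding T_def using \<eta> err_nonneg S' by (subst ennreal_mult[symmetric]) (auto simp flip: ennreal_plus)
    finally show "(\<integral>\<^sup>+ s. ennreal (T0 (snd (snd s))) \<partial>\<mu>) \<le> ennreal T" .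
  qed
  also have "\<dots> = ennreal ((?l + (?b + \<beta> j))^2 + T)"
    using T by (simp add: add.assoc)
  also have "\<dots> \<le> ennreal ((sqrt ((a * D)^2 + real j * T + T) + (?b + \<beta> j))^2)"
    using T b \<beta>[of j] Suc.prems by (intro ennreal_leI sqrt_add_square_le) auto
  also have "(a * D)^2 + real j * T + T = (a * D)^2 + real (Suc j) * T"
    by (simp add: algebra_simps)
  also have "?b + \<beta> j = (\<Sum>i<Suc j. \<beta> i)"
    by simp
  finally show ?case
    using \<mu>'_tw \<mu>'_x prob_\<mu>' by (intro exI[of _ \<mu>']) (auto simp: \<mu>'_def)
qed

end

text \<open>With \<open>s = sqrt (v / (1 - a))\<close> and any \<open>u \<ge> s\<close>, the root of
  \<open>(a * u)^2 + v\<close> is at most \<open>a * u + (1 - a) * s\<close>, so the recursion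
  contracts towards \<open>s\<close> up to \<open>c\<close>. The bias is thus divided by
  \<open>1 - a\<close>, but the deviation \<open>sqrt v\<close> only by its root.\<close>

lemma sqrt_recursion_bound:
  fixes E :: "nat \<Rightarrow> real" and a c v :: real
  assumes a: "0 \<le> a" "a < 1" and c: "0 \<le> c" and v: "0 \<le> v" and E0: "0 \<le> E 0"
    and E: "\<And>k. E (Suc k) = sqrt ((a * E k)^2 + v) + c"
  shows "0 \<le> E k \<and> E k \<le> a ^ k * E 0 + c / (1 - a) + sqrt (v / (1 - a))"
proof (induction k)
  case 0
  then show ?case
    using a c v E0 by simp
next
  case (Suc k)
  define s where "s = sqrt (v / (1 - a))"
  have s: "0 \<le> s" "s^2 * (1 - a) = v"
    using a v by (auto simp: s_def)
  define u where "u = a ^ k * E 0 + c / (1 - a) + s"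
  have u: "E k \<le> u" "s \<le> u" "0 \<le> E k"
    using Suc a c E0 by (auto simp: u_def s_def)
  \<comment> \<open>Besides \<open>E k \<le> u\<close> this rests on \<open>s \<le> u\<close>:
    \<open>v\<close> equals \<open>a * (1 - a) * s^2 + ((1 - a) * s)^2\<close>, and the mixed term
    of the square covers the first summand.\<close>
  have "(a * E k)^2 + v \<le> (a * u + (1 - a) * s)^2"
  proof -
    have "(a * E k)^2 \<le> (a * u)^2"
      using a u by (intro power_mono mult_left_mono) auto
    moreover have "v \<le> 2 * (a * u) * ((1 - a) * s) + ((1 - a) * s)^2"
    proof -
      have "a * (1 - a) * s * s \<le> a * (1 - a) * s * u"
        using a s u by (intro mult_left_mono) auto
      moreover have "v = a * (1 - a) * s * s + ((1 - a) * s)^2"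
        unfolding s(2)[symmetric] by (simp add: power2_eq_square algebra_simps)
      moreover have "0 \<le> a * (1 - a) * s * u"
        using a s u by auto
      moreover have "2 * (a * u) * ((1 - a) * s) = 2 * (a * (1 - a) * s * u)"
        by (simp only: mult_ac)
      ultimately show ?thesis
        by linarith
    qed
    ultimately show ?thesis
      by (simp add: power2_sum)
  qed
  then have "sqrt ((a * E k)^2 + v) \<le> a * u + (1 - a) * s"
    using a s u by (intro real_le_lsqrt) auto
  then have "E (Suc k) \<le> a * u + (1 - a) * s + c"
    using E by simp
  also have "\<dots> = a ^ Suc k * E 0 + c / (1 - a) + s"
    using a by (simp add: u_def field_simps)
  finally show ?case
    using E[of k] c v by (simp add: s_def)
qed

section \<open>Whole LMC steps and the limit of vanishing fine steps\<close>

context langevin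
begin

text \<open>Here and in \<open>step_variance\<close> the errors of all \<open>N\<close> fine steps
  are totalled, with \<open>h = real N * \<eta>\<close>; the first summand of each survives the
  limit \<eta> = 0.\<close>

definition step_bias :: "real \<Rightarrow> real \<Rightarrow> real \<Rightarrow> real" where
  "step_bias h S \<eta> = h^2 / 2 * (L * sqrt (L * CARD('n)) + M2 * CARD('n)) + err1 h * h * sqrt \<eta> * S"

definition step_variance :: "real \<Rightarrow> real \<Rightarrow> real \<Rightarrow> real" where
  "step_variance h S \<eta> = 4 * h ^ 3 * L^2 * CARD('n) + err2 h * h * \<eta> * S"

text \<open>\<open>fine_chain\<close> at \<open>j = N\<close>, where the weight of the gradient
  correction is 0 and the tracked quantity is the plain difference of the two chains.\<close>

lemma lmc_step_coupling:
  fixes \<gamma> :: "((real ^ 'n) \<times> (real ^ 'n)) measure" and a D h \<eta> S S' :: real and N :: nat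
  assumes \<gamma>: "gibbs_coupling \<gamma> D"
    and a: "0 \<le> a" "\<And>x y. norm ((x - h *\<^sub>R g x) - (y - h *\<^sub>R g y)) \<le> a * norm (x - y)"
    and h: "h = real N * \<eta>" and \<eta>: "0 < \<eta>" "\<eta> \<le> 1" "\<eta> * L \<le> 1"
    and S: "0 \<le> S" "(\<integral>\<^sup>+ x. ennreal ((1 + norm (g x)) ^ 6) \<partial>gibbs) \<le> ennreal (S^2)"
    and S': "0 \<le> S'" "(\<integral>\<^sup>+ x. ennreal ((1 + norm (g x)) ^ 4) \<partial>gibbs) \<le> ennreal S'"
  obtains \<gamma>' where "gibbs_coupling \<gamma>' (sqrt ((a * D)^2 + step_variance h S' \<eta>) + step_bias h S \<eta>)"
    "\<And>F. F \<in> borel_measurable borel \<Longrightarrow> (\<integral>\<^sup>+ s. F (fst s) \<partial>\<gamma>')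
        = (\<integral>\<^sup>+ s. \<integral>\<^sup>+ z. F (fst s - h *\<^sub>R g (fst s) + sqrt (2 * h) *\<^sub>R z) \<partial>gaussian \<partial>\<gamma>)"
proof -
  let ?A = "L * sqrt (L * CARD('n)) + M2 * CARD('n)"
  let ?T = "4 * h^2 * L^2 * CARD('n) * \<eta> + err2 h * \<eta>^2 * S'"
  let ?\<beta> = "\<lambda>i. ((real N - real (Suc i)) * \<eta>) * \<eta> * ?A + err1 h * (\<eta> * sqrt \<eta>) * S"
  have h0: "0 \<le> h"
    using h \<eta> by simp
  obtain \<mu> where sets_\<mu> [measurable_cong]: "sets \<mu> = sets (borel \<Otimes>\<^sub>M (borel \<Otimes>\<^sub>M borel))"
    and prob_\<mu>: "prob_space \<mu>"
    and \<mu>_tw: "\<And>F. case_prod F \<in> borel_measurable (borel \<Otimes>\<^sub>M borel) \<Longrightarrow>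
      (\<integral>\<^sup>+ s. F (fst s) (fst (snd s)) \<partial>\<mu>)
        = (\<integral>\<^sup>+ s. \<integral>\<^sup>+ z. F (fst s) (fst s - (real N * \<eta>) *\<^sub>R g (fst s) + sqrt (2 * (real N * \<eta>)) *\<^sub>R z) \<partial>gaussian \<partial>\<gamma>)"
    and \<mu>_x: "\<And>F. F \<in> borel_measurable borel \<Longrightarrow> (\<integral>\<^sup>+ s. F (snd (snd s)) \<partial>\<mu>) = (\<integral>\<^sup>+ x. F x \<partial>gibbs)"
    and \<mu>_D: "(\<integral>\<^sup>+ s. ennreal ((norm (fst (snd s) - snd (snd s)
        + ((real N - real N) * \<eta>) *\<^sub>R (g (snd (snd s)) - g (fst s))))^2) \<partial>\<mu>)
      \<le> ennreal ((sqrt ((a * D)^2 + real N * ?T) + (\<Sum>i<N. ?\<beta> i))^2)"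
    using fine_chain[OF \<gamma> a h \<eta> S S' order.refl] by auto
  \<comment> \<open>The last fine step has weight 0, so for \<open>j = N\<close> the weights sum to
    \<open>N * (N - 1) / 2\<close>, at most half of \<open>N^2\<close>. This is the 1 / 2 in
    \<open>step_bias\<close>.\<close>
  have gauss_sum: "(\<Sum>i<j. real N - real (Suc i)) = j * real N - real j * (real j + 1) / 2" for j
    by (induction j) (auto simp: field_simps)
  have "(\<Sum>i<N. ?\<beta> i) = (\<Sum>i<N. (real N - real (Suc i)) * (\<eta> * \<eta> * ?A) + err1 h * (\<eta> * sqrt \<eta>) * S)"
    by (intro sum.cong) (simp_all only: mult.assoc)
  also have "\<dots> = (\<Sum>i<N. real N - real (Suc i)) * (\<eta> * \<eta> * ?A) + N * (err1 h * (\<eta> * sqrt \<eta>) * S)"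
    unfolding sum.distrib sum_distrib_right[symmetric] by simp
  also have "\<dots> \<le> (real N)^2 / 2 * (\<eta> * \<eta> * ?A) + N * (err1 h * (\<eta> * sqrt \<eta>) * S)"
    using \<eta> L_pos M2_nonneg unfolding gauss_sum
    by (intro add_right_mono mult_right_mono) (auto simp: power2_eq_square field_simps)
  also have "\<dots> = step_bias h S \<eta>"
    by (simp add: step_bias_def h power2_eq_square mult_ac)
  finally have bias: "(\<Sum>i<N. ?\<beta> i) \<le> step_bias h S \<eta>" .
  have bias0: "0 \<le> (\<Sum>i<N. ?\<beta> i)"
    using \<eta> L_pos M2_nonneg err_nonneg h0 S by (intro sum_nonneg) (auto intro!: add_nonneg_nonneg mult_nonneg_nonneg)
  have var: "real N * ?T = step_variance h S' \<eta>"
    by (simp add: step_variance_def h power2_eq_square power3_eq_cube algebra_simps)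
  have var0: "0 \<le> step_variance h S' \<eta>"
    unfolding step_variance_def using h0 \<eta> S' err_nonneg by auto
  let ?\<gamma>' = "distr \<mu> (borel \<Otimes>\<^sub>M borel) snd"
  show thesis
  proof
    have "prob_space ?\<gamma>'"
      by (intro prob_space.prob_space_distr prob_\<mu>) measurable
    moreover have "(\<integral>\<^sup>+ s. F (snd s) \<partial>?\<gamma>') = (\<integral>\<^sup>+ x. F x \<partial>gibbs)" if [measurable]: "F \<in> borel_measurable borel" for F
      using \<mu>_x[of F] by (subst nn_integral_distr) simp_all
    moreover have "(\<integral>\<^sup>+ s. ennreal ((norm (fst s - snd s))^2) \<partial>?\<gamma>') \<le> ennreal ((sqrt ((a * D)^2 + real N * ?T) + (\<Sum>i<N. ?\<beta> i))^2)"
      using \<mu>_D by (subst nn_integral_distr) simp_all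
    moreover have "\<dots> \<le> ennreal ((sqrt ((a * D)^2 + step_variance h S' \<eta>) + step_bias h S \<eta>)^2)"
      unfolding var using bias bias0 var0 by (intro ennreal_leI power_mono add_mono) auto
    moreover have "0 \<le> sqrt ((a * D)^2 + step_variance h S' \<eta>) + step_bias h S \<eta>"
      using bias bias0 var0 by (intro add_nonneg_nonneg) auto
    ultimately show "gibbs_coupling ?\<gamma>' (sqrt ((a * D)^2 + step_variance h S' \<eta>) + step_bias h S \<eta>)"
      unfolding gibbs_coupling_def by (meson order.trans sets_distr)
    show "(\<integral>\<^sup>+ s. F (fst s) \<partial>?\<gamma>') = (\<integral>\<^sup>+ s. \<integral>\<^sup>+ z. F (fst s - h *\<^sub>R g (fst s) + sqrt (2 * h) *\<^sub>R z) \<partial>gaussian \<partial>\<gamma>)"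
      if [measurable]: "F \<in> borel_measurable borel" for F
      using \<mu>_tw[of "\<lambda>_. F"] by (subst nn_integral_distr) (simp_all add: h)
  qed
qed

text \<open>Iterates \<open>lmc_step_coupling\<close> for fixed \<eta>, solves the recursion for the
  error by \<open>sqrt_recursion_bound\<close>, and removes the fine corrections by letting
  \<open>\<eta> = h / real N\<close> tend to 0. The chain enters only through its one-step
  laws.\<close>

lemma wasserstein_lmc_le:
  fixes \<nu> :: "nat \<Rightarrow> (real ^ 'n) measure" and a h q D :: real
  assumes sets_\<nu>: "\<And>k. sets (\<nu> k) = sets borel"
    and \<nu>_0: "\<And>F. F \<in> borel_measurable borel \<Longrightarrow> (\<integral>\<^sup>+ x. F x \<partial>\<nu> 0) = F 0"
    and \<nu>_Suc: "\<And>F k. F \<in> borel_measurable borel \<Longrightarrow>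
      (\<integral>\<^sup>+ x. F x \<partial>\<nu> (Suc k)) = (\<integral>\<^sup>+ x. \<integral>\<^sup>+ z. F (x - h *\<^sub>R g x + sqrt (2 * h) *\<^sub>R z) \<partial>gaussian \<partial>\<nu> k)"
    and D: "(\<integral>\<^sup>+ x. ennreal ((norm x)^2) \<partial>gibbs) \<le> ennreal (D^2)" "0 \<le> D"
    and a: "0 \<le> a" "a < 1" "\<And>x y. norm ((x - h *\<^sub>R g x) - (y - h *\<^sub>R g y)) \<le> a * norm (x - y)"
    and h: "0 < h" and q: "1 \<le> q" "q \<le> 2"
  shows "wasserstein dist q (\<nu> K) gibbs
    \<le> ennreal (a ^ K * D + h^2 / 2 * (L * sqrt (L * CARD('n)) + M2 * CARD('n)) / (1 - a)
        + sqrt (4 * h ^ 3 * L^2 * CARD('n) / (1 - a)))"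
proof -
  obtain S6 where S6: "0 < S6" "(\<integral>\<^sup>+ x. ennreal ((1 + norm (g x)) ^ 6) \<partial>gibbs) \<le> ennreal S6"
    by (rule norm_gradient_moment_bound)
  obtain S' where S': "0 < S'" "(\<integral>\<^sup>+ x. ennreal ((1 + norm (g x)) ^ 4) \<partial>gibbs) \<le> ennreal S'"
    by (rule norm_gradient_moment_bound)
  define S where "S = sqrt S6"
  have S: "0 \<le> S" "(\<integral>\<^sup>+ x. ennreal ((1 + norm (g x)) ^ 6) \<partial>gibbs) \<le> ennreal (S^2)"
    using S6 by (auto simp: S_def)
  define bound where "bound = (\<lambda>\<eta>. a ^ K * D + step_bias h S \<eta> / (1 - a) + sqrt (step_variance h S' \<eta> / (1 - a)))"
  have le: "wasserstein dist q (\<nu> K) gibbs \<le> ennreal (bound \<eta>)"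
    if N: "h = real N * \<eta>" and \<eta>: "0 < \<eta>" "\<eta> \<le> 1" "\<eta> * L \<le> 1" for N \<eta>
  proof -
    let ?v = "step_variance h S' \<eta>" and ?c = "step_bias h S \<eta>"
    \<comment> \<open>Strict positivity makes \<open>bound \<eta>\<close> positive, as the passage
      from squares to the exponent \<open>q\<close> requires.\<close>
    have v: "0 < ?v"
      unfolding step_variance_def using h \<eta> S' L_pos err_nonneg by (intro add_pos_nonneg) auto
    have c: "0 \<le> ?c"
      unfolding step_bias_def using h \<eta> S L_pos M2_nonneg err_nonneg by auto
    define E where "E = rec_nat D (\<lambda>_ e. sqrt ((a * e)^2 + ?v) + ?c)"
    have E: "E 0 = D" "\<And>k. E (Suc k) = sqrt ((a * E k)^2 + ?v) + ?c"
      by (simp_all add: E_def)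
    have E_bound: "0 \<le> E k" "E k \<le> a ^ k * D + ?c / (1 - a) + sqrt (?v / (1 - a))" for k
      using sqrt_recursion_bound[of a ?c ?v E k] a c v D(2) E by auto
    have "\<exists>\<gamma>. gibbs_coupling \<gamma> (E k) \<and>
      (\<forall>F. F \<in> borel_measurable borel \<longrightarrow> (\<integral>\<^sup>+ s. F (fst s) \<partial>\<gamma>) = (\<integral>\<^sup>+ x. F x \<partial>\<nu> k))" for k
    proof (induction k)
      case 0
      \<comment> \<open>The LMC chain starts from the point mass at 0, so the initial mean square
        distance is the second moment of \<open>gibbs\<close>.\<close>
      let ?\<gamma> = "distr gibbs (borel \<Otimes>\<^sub>M borel) (\<lambda>x. (0 :: real ^ 'n, x))"
      have "prob_space ?\<gamma>"
        by (rule prob_space_distr) measurable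
      then show ?case
        using D unfolding gibbs_coupling_def
        by (intro exI[of _ ?\<gamma>]) (auto simp: nn_integral_distr \<nu>_0 E emeasure_space_1[simplified])
    next
      case (Suc k)
      then obtain \<gamma> where \<gamma>: "gibbs_coupling \<gamma> (E k)"
        and fst: "\<And>F. F \<in> borel_measurable borel \<Longrightarrow> (\<integral>\<^sup>+ s. F (fst s) \<partial>\<gamma>) = (\<integral>\<^sup>+ x. F x \<partial>\<nu> k)"
        by auto
      obtain \<gamma>' where \<gamma>': "gibbs_coupling \<gamma>' (E (Suc k))"
        and fst': "\<And>F. F \<in> borel_measurable borel \<Longrightarrow> (\<integral>\<^sup>+ s. F (fst s) \<partial>\<gamma>')
          = (\<integral>\<^sup>+ s. \<integral>\<^sup>+ z. F (fst s - h *\<^sub>R g (fst s) + sqrt (2 * h) *\<^sub>R z) \<partial>gaussian \<partial>\<gamma>)"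
        using lmc_step_coupling[OF \<gamma> a(1,3) N \<eta> S less_imp_le[OF S'(1)] S'(2)] unfolding E by blast
      have "(\<integral>\<^sup>+ s. F (fst s) \<partial>\<gamma>') = (\<integral>\<^sup>+ x. F x \<partial>\<nu> (Suc k))" if [measurable]: "F \<in> borel_measurable borel" for F
        using fst[of "\<lambda>x. \<integral>\<^sup>+ z. F (x - h *\<^sub>R g x + sqrt (2 * h) *\<^sub>R z) \<partial>gaussian"]
        by (simp add: fst' \<nu>_Suc)
      with \<gamma>' show ?case
        by blast
    qed
    from this[of K] obtain \<gamma> where \<gamma>: "gibbs_coupling \<gamma> (E K)"
      and fst: "\<And>F. F \<in> borel_measurable borel \<Longrightarrow> (\<integral>\<^sup>+ s. F (fst s) \<partial>\<gamma>) = (\<integral>\<^sup>+ x. F x \<partial>\<nu> K)"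
      by auto
    note [measurable_cong] = gibbs_couplingD(1)[OF \<gamma>]
    have pos: "0 < bound \<eta>"
      unfolding bound_def using a c v D(2) by (intro add_nonneg_pos add_nonneg_nonneg) auto
    have "(\<integral>\<^sup>+ s. ennreal ((norm (fst s - snd s))^2) \<partial>\<gamma>) \<le> ennreal ((bound \<eta>)^2)"
      using E_bound[of K] by (intro order.trans[OF gibbs_couplingD(5)[OF \<gamma>]] ennreal_leI power_mono) (auto simp: bound_def)
    then have "(\<integral>\<^sup>+ s. ennreal (dist (fst s) (snd s) powr q) \<partial>\<gamma>) \<le> ennreal (bound \<eta> powr q)"
      using gibbs_couplingD(2)[OF \<gamma>] q pos unfolding dist_norm by (intro nn_integral_powr_le_of_square) auto
    then show ?thesis
      using q pos by (intro wasserstein_le[OF couplingsI[OF gibbs_couplingD(1)[OF \<gamma>] sets_\<nu> sets_gibbs fst gibbs_couplingD(4)[OF \<gamma>]]]) auto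
  qed
  have lim: "(\<lambda>N. h / real N) \<longlonglongrightarrow> 0"
    by (rule lim_const_over_n)
  have "(\<lambda>N. ennreal (bound (h / real N))) \<longlonglongrightarrow> ennreal (bound 0)"
    unfolding bound_def step_bias_def step_variance_def using a by (intro tendsto_ennrealI tendsto_intros lim) auto
  moreover have "eventually (\<lambda>N. wasserstein dist q (\<nu> K) gibbs \<le> ennreal (bound (h / real N))) sequentially"
  proof -
    have ev: "eventually (\<lambda>N. h / real N < min 1 (1 / L)) sequentially"
      using lim L_pos by (intro order_tendstoD(2)[OF lim]) auto
    show ?thesis
      using ev eventually_gt_at_top[of 0]
    proof eventually_elim
      case (elim N)
      then show ?case
        using h L_pos by (intro le[of N]) (auto simp: field_simps)
    qed
  qed
  ultimately have "wasserstein dist q (\<nu> K) gibbs \<le> ennreal (bound 0)"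
    by (intro tendsto_lowerbound[of _ "ennreal (bound 0)" sequentially]) auto
  then show ?thesis
    by (simp add: bound_def step_bias_def step_variance_def)
qed

end

section \<open>Convex functions with Lipschitz gradient\<close>

lemma GDERIV_along_line:
  assumes "GDERIV f (x + t *\<^sub>R v) :> d"
  shows "((\<lambda>t. f (x + t *\<^sub>R v)) has_real_derivative d \<bullet> v) (at t)"
proof -
  have "((\<lambda>t. x + t *\<^sub>R v) has_derivative (\<lambda>s. s *\<^sub>R v)) (at t)"
    by (auto intro!: derivative_eq_intros)
  from has_derivative_compose[OF this assms[unfolded gderiv_def]]
  show ?thesis
    by (simp add: has_field_derivative_def inner_commute mult_commute_abs)
qed

lemma convex_on_gradient_lower:
  assumes f: "convex_on UNIV f" and d: "GDERIV f x :> d"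
  shows "f x + d \<bullet> (y - x) \<le> f y"
proof -
  let ?\<phi> = "\<lambda>t. f (x + t *\<^sub>R (y - x))"
  have "(?\<phi> has_real_derivative d \<bullet> (y - x)) (at 0)"
    by (rule GDERIV_along_line) (simp add: d)
  then have "((\<lambda>t. (?\<phi> t - ?\<phi> 0) / t) \<longlongrightarrow> d \<bullet> (y - x)) (at 0)"
    by (simp add: DERIV_def)
  then have "((\<lambda>t. (?\<phi> t - ?\<phi> 0) / t) \<longlongrightarrow> d \<bullet> (y - x)) (at_right 0)"
    by (rule filterlim_mono) (auto simp: at_le)
  moreover have "eventually (\<lambda>t. (?\<phi> t - ?\<phi> 0) / t \<le> f y - f x) (at_right 0)"
    using eventually_at_right_real[OF zero_less_one]
  proof eventually_elim
    case (elim t)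
    have "?\<phi> t = f ((1 - t) *\<^sub>R x + t *\<^sub>R y)"
      by (simp add: algebra_simps)
    also have "\<dots> \<le> (1 - t) * f x + t * f y"
      using elim by (intro convex_onD[OF f]) auto
    finally show ?case
      using elim by (simp add: field_simps)
  qed
  ultimately have "d \<bullet> (y - x) \<le> f y - f x"
    by (intro tendsto_upperbound[of _ "d \<bullet> (y - x)" "at_right (0 :: real)"]) auto
  then show ?thesis
    by simp
qed

text \<open>The descent lemma: along the segment the excess \<open>?\<psi>\<close> has nonpositive
  derivative, by the Cauchy-Schwarz inequality and the Lipschitz bound.\<close>

lemma lipschitz_gradient_upper:
  fixes f :: "'a :: real_inner \<Rightarrow> real"
  assumes d: "\<And>x. GDERIV f x :> g x" and lip: "\<And>x y. norm (g x - g y) \<le> M * norm (x - y)"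
  shows "f y \<le> f x + g x \<bullet> (y - x) + M / 2 * (norm (y - x))^2"
proof -
  define v where "v = y - x"
  let ?\<psi> = "\<lambda>t. f (x + t *\<^sub>R v) - t * (g x \<bullet> v) - M / 2 * t^2 * (norm v)^2"
  have "?\<psi> 1 \<le> ?\<psi> 0"
  proof (rule DERIV_nonpos_imp_nonincreasing[where f = ?\<psi> and a = 0 and b = 1])
    fix t :: real assume t: "0 \<le> t" "t \<le> 1"
    let ?D = "g (x + t *\<^sub>R v) \<bullet> v - g x \<bullet> v - M * t * (norm v)^2"
    have "(?\<psi> has_real_derivative ?D) (at t)"
      by (rule derivative_eq_intros GDERIV_along_line d refl | simp)+
    moreover have "?D \<le> 0"
    proof -
      have "(g (x + t *\<^sub>R v) - g x) \<bullet> v \<le> norm (g (x + t *\<^sub>R v) - g x) * norm v"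
        by (rule norm_cauchy_schwarz)
      also have "\<dots> \<le> M * norm (x + t *\<^sub>R v - x) * norm v"
        by (intro mult_right_mono lip) auto
      also have "\<dots> = M * t * (norm v)^2"
        using t by (simp add: power2_eq_square)
      finally show ?thesis
        by (simp add: inner_diff_left)
    qed
    ultimately show "\<exists>D. (?\<psi> has_real_derivative D) (at t) \<and> D \<le> 0"
      by blast
  qed simp
  then show ?thesis
    by (simp add: v_def)
qed

text \<open>The Baillon-Haddad inequality. The tangent at \<open>x\<close> and the quadratic upper
  bound at \<open>y\<close> are compared at \<open>z\<close>, where the upper bound minus the
  tangent is smallest; adding the outcome to its mirror image gives the claim.\<close>

lemma convex_gradient_cocoercive:
  fixes f :: "'a :: real_inner \<Rightarrow> real"
  assumes f: "convex_on UNIV f" and d: "\<And>x. GDERIV f x :> g x"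
    and lip: "\<And>x y. norm (g x - g y) \<le> M * norm (x - y)" and M: "0 < M"
  shows "(norm (g x - g y))^2 / M \<le> (g x - g y) \<bullet> (x - y)"
proof -
  have half: "f x + g x \<bullet> (y - x) + (norm (g y - g x))^2 / (2 * M) \<le> f y" for x y
  proof -
    define w where "w = g y - g x"
    define z where "z = y - (1 / M) *\<^sub>R w"
    have "f x + g x \<bullet> (z - x) \<le> f z"
      by (rule convex_on_gradient_lower[OF f d])
    also have "f z \<le> f y + g y \<bullet> (z - y) + M / 2 * (norm (z - y))^2"
      by (rule lipschitz_gradient_upper[OF d lip])
    also have "M / 2 * (norm (z - y))^2 = (norm w)^2 / (2 * M)"
      using M by (simp add: z_def power2_eq_square field_simps)
    finally have "f x + g x \<bullet> (z - x) \<le> f y + g y \<bullet> (z - y) + (norm w)^2 / (2 * M)" .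
    moreover have "g x \<bullet> (z - x) = g x \<bullet> (y - x) - (g x \<bullet> w) / M" "g y \<bullet> (z - y) = - (g y \<bullet> w) / M"
      by (simp_all add: z_def inner_diff_right)
    moreover have "(g y \<bullet> w) / M - (g x \<bullet> w) / M = (norm w)^2 / M"
      by (simp add: w_def power2_norm_eq_inner inner_diff_left flip: diff_divide_distrib)
    moreover have "(norm w)^2 / M = (norm w)^2 / (2 * M) + (norm w)^2 / (2 * M)"
      using M by (simp add: field_simps)
    ultimately show ?thesis
      unfolding w_def by linarith
  qed
  have "(norm (g x - g y))^2 / M = (norm (g x - g y))^2 / (2 * M) + (norm (g x - g y))^2 / (2 * M)"
    using M by (simp add: field_simps)
  moreover have "(g x - g y) \<bullet> (x - y) = - (g x \<bullet> (y - x)) - g y \<bullet> (x - y)"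
    by (simp add: inner_diff_left inner_diff_right)
  ultimately show ?thesis
    using half[of x y] half[of y x] unfolding norm_minus_commute[of "g y" "g x"] by linarith
qed

text \<open>With \<open>A = 1 - \<alpha> * h\<close> the difference of the two steps is
  \<open>A *\<^sub>R ?d - h *\<^sub>R ?V\<close>. In its square the cross term pays for
  \<open>h^2 * (norm ?V)^2\<close> by cocoercivity, since \<open>h * M \<le> A\<close>, which is the
  step size condition rewritten.\<close>

lemma gradient_step_contraction:
  fixes f :: "'a :: real_inner \<Rightarrow> real"
  assumes f: "convex_on UNIV f" and d: "\<And>x. GDERIV f x :> g x"
    and lip: "\<And>x y. norm (g x - g y) \<le> M * norm (x - y)" and M: "0 < M"
    and h: "0 \<le> h" "0 \<le> \<alpha>" "h * (M + \<alpha>) \<le> 1"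
  shows "norm ((x - h *\<^sub>R (g x + \<alpha> *\<^sub>R x)) - (y - h *\<^sub>R (g y + \<alpha> *\<^sub>R y))) \<le> (1 - \<alpha> * h) * norm (x - y)"
proof -
  define A where "A = 1 - \<alpha> * h"
  have A: "h * M \<le> A" "0 \<le> A"
    using h M by (auto simp: A_def algebra_simps intro: order.trans[of _ "1 - h * M"])
  let ?d = "x - y" and ?V = "g x - g y"
  have "(x - h *\<^sub>R (g x + \<alpha> *\<^sub>R x)) - (y - h *\<^sub>R (g y + \<alpha> *\<^sub>R y)) = A *\<^sub>R ?d - h *\<^sub>R ?V"
    by (simp add: A_def algebra_simps)
  moreover have "(norm (A *\<^sub>R ?d - h *\<^sub>R ?V))^2 \<le> (A * norm ?d)^2"
  proof -
    have "(norm (A *\<^sub>R ?d - h *\<^sub>R ?V))^2 = (A * norm ?d)^2 - 2 * (A * h) * (?V \<bullet> ?d) + h^2 * (norm ?V)^2"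
      unfolding power_mult_distrib power2_norm_eq_inner
      by (simp add: inner_diff_left inner_diff_right inner_commute power2_eq_square algebra_simps)
    moreover have "h^2 * (norm ?V)^2 \<le> 2 * (A * h) * (?V \<bullet> ?d)"
    proof -
      have "h^2 * (norm ?V)^2 = (h * M) * h * ((norm ?V)^2 / M)"
        using M by (simp add: power2_eq_square)
      also have "\<dots> \<le> (2 * A) * h * (?V \<bullet> ?d)"
      proof (rule mult_mono[OF _ convex_gradient_cocoercive[OF f d lip M]])
        show "h * M * h \<le> 2 * A * h"
          using A h by (intro mult_right_mono) auto
      qed (use A h M in auto)
      finally show ?thesis
        by (simp add: mult.assoc)
    qed
    ultimately show ?thesis
      by linarith
  qed
  then have "norm (A *\<^sub>R ?d - h *\<^sub>R ?V) \<le> A * norm ?d"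
    by (rule power2_le_imp_le) (use A in auto)
  ultimately show ?thesis
    by (simp add: A_def)
qed

text \<open>Testing the difference quotient against \<open>D v\<close> makes it scalar: the limit is
  \<open>(norm (D v))^2\<close>, the Lipschitz bound holds before the limit, and one factor
  \<open>norm (D v)\<close> cancels.\<close>

lemma has_derivative_norm_le_lipschitz:
  fixes F :: "'a :: real_inner \<Rightarrow> 'b :: real_inner"
  assumes D: "(F has_derivative D) (at x)" and lip: "\<And>x y. norm (F x - F y) \<le> M * norm (x - y)"
  shows "norm (D v) \<le> M * norm v"
proof -
  interpret D: bounded_linear D
    using D by (rule has_derivative_bounded_linear)
  have "((\<lambda>t. x + t *\<^sub>R v) has_derivative (\<lambda>s. s *\<^sub>R v)) (at 0)"
    by (auto intro!: derivative_eq_intros)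
  from has_derivative_compose[OF this, of F D] D
  have "((\<lambda>t. F (x + t *\<^sub>R v)) has_derivative (\<lambda>s. D (s *\<^sub>R v))) (at 0)"
    by simp
  then have "((\<lambda>t. F (x + t *\<^sub>R v) \<bullet> D v) has_real_derivative (D v \<bullet> D v)) (at 0)"
    unfolding has_field_derivative_def D.scaleR
    by (auto intro!: derivative_eq_intros simp: mult.commute)
  then have lim: "((\<lambda>t. (F (x + t *\<^sub>R v) \<bullet> D v - F x \<bullet> D v) / t) \<longlongrightarrow> D v \<bullet> D v) (at 0)"
    by (simp add: DERIV_def)
  have "(F (x + t *\<^sub>R v) \<bullet> D v - F x \<bullet> D v) / t \<le> M * norm v * norm (D v)" if "t \<noteq> 0" for t
  proof -
    have "\<bar>(F (x + t *\<^sub>R v) - F x) \<bullet> D v\<bar> \<le> norm (F (x + t *\<^sub>R v) - F x) * norm (D v)"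
      by (rule Cauchy_Schwarz_ineq2)
    also have "\<dots> \<le> (M * norm (x + t *\<^sub>R v - x)) * norm (D v)"
      by (intro mult_right_mono lip) auto
    finally have "\<bar>(F (x + t *\<^sub>R v) - F x) \<bullet> D v\<bar> / \<bar>t\<bar> \<le> M * norm v * norm (D v)"
      using that by (simp add: field_simps)
    moreover have "(F (x + t *\<^sub>R v) \<bullet> D v - F x \<bullet> D v) / t \<le> \<bar>(F (x + t *\<^sub>R v) - F x) \<bullet> D v\<bar> / \<bar>t\<bar>"
      by (simp add: inner_diff_left flip: abs_divide)
    ultimately show ?thesis
      by linarith
  qed
  then have "eventually (\<lambda>t. (F (x + t *\<^sub>R v) \<bullet> D v - F x \<bullet> D v) / t \<le> M * norm v * norm (D v)) (at 0)"
    by (auto simp: eventually_at_filter)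
  from tendsto_upperbound[OF lim this] have "norm (D v) * norm (D v) \<le> M * norm v * norm (D v)"
    by (simp add: dot_square_norm power2_eq_square)
  moreover have "0 \<le> M * norm v"
    using order.trans[OF norm_ge_zero lip[of "v" 0]] by simp
  ultimately show ?thesis
    by (cases "D v = 0") auto
qed

text \<open>Mean value inequality along the segment, with majorant
  \<open>M / 2 * (norm v)^2 * t^2\<close> for the path minus its linear part.\<close>

lemma lipschitz_derivative_taylor:
  fixes F :: "'a :: real_normed_vector \<Rightarrow> 'b :: real_normed_vector"
  assumes D: "\<And>x. (F has_derivative D x) (at x)"
    and lip: "\<And>x y v. norm (D x v - D y v) \<le> M * norm (x - y) * norm v"
  shows "norm (F y - F x - D x (y - x)) \<le> M / 2 * (norm (y - x))^2"
proof -
  define v where "v = y - x"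
  interpret D: bounded_linear "D z" for z
    using D by (rule has_derivative_bounded_linear)
  let ?G = "\<lambda>t. F (x + t *\<^sub>R v) - t *\<^sub>R D x v"
  let ?\<phi> = "\<lambda>t :: real. M / 2 * (norm v)^2 * t^2"
  have line: "((\<lambda>t. F (x + t *\<^sub>R v)) has_derivative (\<lambda>s. D (x + t *\<^sub>R v) (s *\<^sub>R v))) (at t)" for t
  proof -
    have "((\<lambda>t. x + t *\<^sub>R v) has_derivative (\<lambda>s. s *\<^sub>R v)) (at t)"
      by (auto intro!: derivative_eq_intros)
    from has_derivative_compose[OF this D] show ?thesis .
  qed
  have G: "(?G has_vector_derivative (D (x + t *\<^sub>R v) v - D x v)) (at t)" for t
    unfolding has_vector_derivative_def
    by (rule derivative_eq_intros line refl | simp add: D.scaleR scaleR_diff_right)+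
  have \<phi>: "(?\<phi> has_vector_derivative (M * (norm v)^2 * t)) (at t)" for t
    unfolding has_real_derivative_iff_has_vector_derivative[symmetric]
    by (rule derivative_eq_intros refl | simp)+
  have "norm (?G 1 - ?G 0) \<le> ?\<phi> 1 - ?\<phi> 0"
  proof (rule differentiable_bound_general[where f' = "\<lambda>t. D (x + t *\<^sub>R v) v - D x v" and \<phi>' = "\<lambda>t. M * (norm v)^2 * t"])
    show "continuous_on {0..1} ?G"
      using G by (intro continuous_at_imp_continuous_on ballI) (rule has_vector_derivative_continuous)
    show "norm (D (x + t *\<^sub>R v) v - D x v) \<le> M * (norm v)^2 * t" if "0 < t" "t < 1" for t
      using lip[of "x + t *\<^sub>R v" v x] that by (simp add: power2_eq_square mult_ac)
  qed (use G \<phi> in \<open>auto intro!: continuous_intros\<close>)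
  then show ?thesis
    by (simp add: v_def algebra_simps)
qed

text \<open>Chebyshev's association inequality: \<open>u\<close> and
  \<open>exp (- \<alpha> * u)\<close> are oppositely ordered, hence negatively correlated. For the
  squared norm it shows that the Gaussian tilt does not increase the second moment.\<close>

lemma tilted_second_moment_le:
  fixes u :: "'a \<Rightarrow> real" and \<alpha> :: real
  assumes "prob_space \<mu>" and [measurable]: "u \<in> borel_measurable \<mu>" and u: "\<And>x. 0 \<le> u x" and \<alpha>: "0 \<le> \<alpha>"
    and fin: "(\<integral>\<^sup>+ x. ennreal (u x) \<partial>\<mu>) < \<top>"
  shows "(\<integral>\<^sup>+ x. ennreal (u x * exp (- \<alpha> * u x)) \<partial>\<mu>)
    \<le> (\<integral>\<^sup>+ x. ennreal (u x) \<partial>\<mu>) * (\<integral>\<^sup>+ x. ennreal (exp (- \<alpha> * u x)) \<partial>\<mu>)"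
proof -
  interpret prob_space \<mu> by fact
  have u_int: "integrable \<mu> u"
    using u fin by (intro integrableI_nonneg) auto
  define c where "c = integral\<^sup>L \<mu> u"
  have w: "integrable \<mu> (\<lambda>x. exp (- \<alpha> * u x))"
    using u \<alpha> by (intro integrable_const_bound[of _ 1]) auto
  have uw: "integrable \<mu> (\<lambda>x. u x * exp (- \<alpha> * u x))"
    using u \<alpha> by (intro Bochner_Integration.integrable_bound[OF u_int]) (auto simp: mult_left_le)
  \<comment> \<open>Comparison with the mean \<open>c\<close> takes the place of the usual two
    independent copies.\<close>
  have "0 \<ge> integral\<^sup>L \<mu> (\<lambda>x. (u x - c) * (exp (- \<alpha> * u x) - exp (- \<alpha> * c)))"
  proof -
    have "(u x - c) * (exp (- \<alpha> * u x) - exp (- \<alpha> * c)) \<le> 0" for x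
    proof (cases "u x \<le> c")
      case True
      then have "\<alpha> * u x \<le> \<alpha> * c"
        using \<alpha> by (intro mult_left_mono)
      then show ?thesis
        using True by (intro mult_nonpos_nonneg) auto
    next
      case False
      then have "\<alpha> * c \<le> \<alpha> * u x"
        using \<alpha> by (intro mult_left_mono) auto
      then show ?thesis
        using False by (intro mult_nonneg_nonpos) auto
    qed
    then have "0 \<le> integral\<^sup>L \<mu> (\<lambda>x. - ((u x - c) * (exp (- \<alpha> * u x) - exp (- \<alpha> * c))))"
      by (intro Bochner_Integration.integral_nonneg) (simp only: neg_0_le_iff_le)
    then show ?thesis
      by (simp only: Bochner_Integration.integral_minus neg_0_le_iff_le)
  qed
  also have "integral\<^sup>L \<mu> (\<lambda>x. (u x - c) * (exp (- \<alpha> * u x) - exp (- \<alpha> * c)))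
      = integral\<^sup>L \<mu> (\<lambda>x. u x * exp (- \<alpha> * u x)) - c * integral\<^sup>L \<mu> (\<lambda>x. exp (- \<alpha> * u x))"
  proof -
    have "(u x - c) * (exp (- \<alpha> * u x) - exp (- \<alpha> * c))
        = u x * exp (- \<alpha> * u x) - c * exp (- \<alpha> * u x) - exp (- \<alpha> * c) * (u x - c)" for x
      by (simp add: algebra_simps)
    then show ?thesis
      using uw w u_int by (simp add: c_def prob_space)
  qed
  finally have "integral\<^sup>L \<mu> (\<lambda>x. u x * exp (- \<alpha> * u x)) \<le> c * integral\<^sup>L \<mu> (\<lambda>x. exp (- \<alpha> * u x))"
    by simp
  moreover have "0 \<le> c" "0 \<le> integral\<^sup>L \<mu> (\<lambda>x. exp (- \<alpha> * u x))"
    using u by (auto simp: c_def)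
  ultimately show ?thesis
    using u_int w uw u
    by (simp add: nn_integral_eq_integral c_def flip: ennreal_mult)
qed

section \<open>Transfer to \<open>real ^ 'n\<close> and the main theorem\<close>

text \<open>Exhibits iterate \<open>k\<close> as a function of the first \<open>k\<close> noise
  vectors, from which its independence of the next one is deduced.\<close>

lemma lmc_restrict:
  assumes "{1..k} \<subseteq> J"
  shows "lmc \<alpha> h G \<xi> k \<omega> = lmc \<alpha> h G (\<lambda>i f. f i) k (\<lambda>i\<in>J. \<xi> i \<omega>)"
  using assms
proof (induction k)
  case (Suc k)
  then have "{1..k} \<subseteq> J" "Suc k \<in> J"
    by (simp_all add: atLeastAtMostSuc_conv)
  then show ?case
    using Suc.IH by simp
qed simp

lemma lmc_measurable_PiM:
  assumes [measurable]: "G \<in> borel_measurable borel" and "{1..k} \<subseteq> J"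
  shows "lmc \<alpha> h G (\<lambda>i f. f i) k \<in> borel_measurable (PiM J (\<lambda>_. borel :: (real ^ 'n) measure))"
  using assms(2)
proof (induction k)
  case (Suc k)
  then have [measurable]: "lmc \<alpha> h G (\<lambda>i f. f i) k \<in> borel_measurable (PiM J (\<lambda>_. borel :: (real ^ 'n) measure))"
    by (simp add: atLeastAtMostSuc_conv)
  have [measurable]: "(\<lambda>f. f (Suc k)) \<in> borel_measurable (PiM J (\<lambda>_. borel :: (real ^ 'n) measure))"
    using Suc.prems by (intro measurable_component_singleton) auto
  show ?case
    by simp
qed simp

text \<open>The shrinkage is read as part of the gradient, \<open>(1 - \<alpha> * h) *\<^sub>R x - h
  *\<^sub>R G x = x - h *\<^sub>R (G x + \<alpha> *\<^sub>R x)\<close>: the algorithm is the plain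
  Langevin scheme for the tilted potential.\<close>

lemma (in prob_space) distr_lmc_Suc:
  fixes \<xi> :: "nat \<Rightarrow> 'a \<Rightarrow> real ^ 'n"
  assumes G [measurable]: "G \<in> borel_measurable borel"
    and indep: "indep_vars (\<lambda>_. borel) \<xi> {1..}"
    and gauss: "\<And>k. k \<ge> 1 \<Longrightarrow> distributed M lborel (\<xi> k) (\<lambda>x. ennreal (std_gaussian_density x))"
    and F [measurable]: "F \<in> borel_measurable borel"
  shows "(\<integral>\<^sup>+ x. F x \<partial>distr M borel (lmc \<alpha> h G \<xi> (Suc k)))
    = (\<integral>\<^sup>+ x. \<integral>\<^sup>+ z. F (x - h *\<^sub>R (G x + \<alpha> *\<^sub>R x) + sqrt (2 * h) *\<^sub>R z) \<partial>gaussian \<partial>distr M borel (lmc \<alpha> h G \<xi> k))"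
proof -
  have "indep_var borel (lmc \<alpha> h G (\<lambda>i f. f i) k \<circ> (\<lambda>\<omega>. \<lambda>i\<in>{1..k}. \<xi> i \<omega>))
      borel ((\<lambda>f. f (Suc k)) \<circ> (\<lambda>\<omega>. \<lambda>i\<in>{Suc k}. \<xi> i \<omega>))"
    by (intro indep_var_compose[OF indep_var_restrict[OF indep]] lmc_measurable_PiM G) auto
  also have "lmc \<alpha> h G (\<lambda>i f. f i) k \<circ> (\<lambda>\<omega>. \<lambda>i\<in>{1..k}. \<xi> i \<omega>) = lmc \<alpha> h G \<xi> k"
    by (auto simp: fun_eq_iff intro!: lmc_restrict[symmetric])
  also have "(\<lambda>f. f (Suc k)) \<circ> (\<lambda>\<omega>. \<lambda>i\<in>{Suc k}. \<xi> i \<omega>) = \<xi> (Suc k)"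
    by auto
  finally have ind: "indep_var borel (lmc \<alpha> h G \<xi> k) borel (\<xi> (Suc k))" .
  note [measurable] = indep_var_rv1[OF ind] indep_var_rv2[OF ind]
  have "distr M borel (\<xi> (Suc k)) = distr M lborel (\<xi> (Suc k))"
    by (rule distr_cong) auto
  also have "\<dots> = gaussian"
    using gauss[of "Suc k"] by (simp add: distributed_def gaussian_def)
  finally have law: "distr M borel (\<xi> (Suc k)) = gaussian" .
  let ?\<nu> = "distr M borel (lmc \<alpha> h G \<xi> k)"
  let ?f = "\<lambda>(x, z). F (x - h *\<^sub>R (G x + \<alpha> *\<^sub>R x) + sqrt (2 * h) *\<^sub>R z)"
  have "(\<integral>\<^sup>+ x. F x \<partial>distr M borel (lmc \<alpha> h G \<xi> (Suc k))) = (\<integral>\<^sup>+ \<omega>. F (lmc \<alpha> h G \<xi> (Suc k) \<omega>) \<partial>M)"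
    by (rule nn_integral_distr) simp_all
  also have "\<dots> = (\<integral>\<^sup>+ \<omega>. ?f (lmc \<alpha> h G \<xi> k \<omega>, \<xi> (Suc k) \<omega>) \<partial>M)"
    by (simp add: algebra_simps)
  also have "\<dots> = (\<integral>\<^sup>+ s. ?f s \<partial>distr M (borel \<Otimes>\<^sub>M borel) (\<lambda>\<omega>. (lmc \<alpha> h G \<xi> k \<omega>, \<xi> (Suc k) \<omega>)))"
    by (rule nn_integral_distr[symmetric]) measurable
  also have "\<dots> = (\<integral>\<^sup>+ s. ?f s \<partial>(?\<nu> \<Otimes>\<^sub>M gaussian))"
    using ind unfolding indep_var_distribution_eq law by simp
  also have "\<dots> = (\<integral>\<^sup>+ x. \<integral>\<^sup>+ z. ?f (x, z) \<partial>gaussian \<partial>?\<nu>)"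
    by (rule gaussian.nn_integral_fst[symmetric]) measurable
  finally show ?thesis
    by simp
qed

text \<open>Applying \<open>f\<close> to both components of a coupling gives a coupling of the
  images with the same cost.\<close>

lemma wasserstein_distr_le:
  assumes f [measurable]: "f \<in> measurable \<mu> N" "f \<in> measurable \<nu> N"
    and d: "\<And>x y. d x y = d' (f x) (f y)"
    and d' [measurable]: "case_prod d' \<in> borel_measurable (N \<Otimes>\<^sub>M N)"
  shows "wasserstein d' q (distr \<mu> N f) (distr \<nu> N f) \<le> wasserstein d q \<mu> \<nu>"
proof -
  have "wasserstein d' q (distr \<mu> N f) (distr \<nu> N f)
      \<le> (\<integral>\<^sup>+ z. ennreal (d (fst z) (snd z) powr q) \<partial>\<gamma>) epowr (1 / q)"
    if \<gamma>: "\<gamma> \<in> couplings \<mu> \<nu>" for \<gamma>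
  proof -
    note [measurable_cong] = couplingsD(1)[OF \<gamma>]
    let ?\<gamma>' = "distr \<gamma> (distr \<mu> N f \<Otimes>\<^sub>M distr \<nu> N f) (\<lambda>z. (f (fst z), f (snd z)))"
    have [measurable_cong]: "sets (distr \<mu> N f \<Otimes>\<^sub>M distr \<nu> N f) = sets (N \<Otimes>\<^sub>M N)"
      by (intro sets_pair_measure_cong) auto
    have 1: "distr ?\<gamma>' (distr \<mu> N f) fst = distr \<mu> N f"
    proof -
      have "distr ?\<gamma>' (distr \<mu> N f) fst = distr \<gamma> N (\<lambda>z. f (fst z))"
        by (subst distr_distr) (auto simp: comp_def intro!: distr_cong)
      also have "\<dots> = distr (distr \<gamma> \<mu> fst) N f"
        by (subst distr_distr) (auto simp: comp_def)
      finally show ?thesis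
        by (simp add: couplingsD(2)[OF \<gamma>])
    qed
    have 2: "distr ?\<gamma>' (distr \<nu> N f) snd = distr \<nu> N f"
    proof -
      have "distr ?\<gamma>' (distr \<nu> N f) snd = distr \<gamma> N (\<lambda>z. f (snd z))"
        by (subst distr_distr) (auto simp: comp_def intro!: distr_cong)
      also have "\<dots> = distr (distr \<gamma> \<nu> snd) N f"
        by (subst distr_distr) (auto simp: comp_def)
      finally show ?thesis
        by (simp add: couplingsD(3)[OF \<gamma>])
    qed
    have "?\<gamma>' \<in> couplings (distr \<mu> N f) (distr \<nu> N f)"
      using 1 2 by (simp add: couplings_def)
    moreover have "(\<integral>\<^sup>+ z. ennreal (d' (fst z) (snd z) powr q) \<partial>?\<gamma>') = (\<integral>\<^sup>+ z. ennreal (d (fst z) (snd z) powr q) \<partial>\<gamma>)"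
    proof -
      have [measurable]: "(\<lambda>z. d' (fst z) (snd z)) \<in> borel_measurable (N \<Otimes>\<^sub>M N)"
        using d' by (simp add: split_beta')
      have 1: "(\<lambda>z. (f (fst z), f (snd z))) \<in> measurable \<gamma> (distr \<mu> N f \<Otimes>\<^sub>M distr \<nu> N f)"
        by measurable
      have 2: "(\<lambda>z. ennreal (d' (fst z) (snd z) powr q)) \<in> borel_measurable ?\<gamma>'"
        by measurable
      show ?thesis
        unfolding nn_integral_distr[OF 1 2] by (simp add: d)
    qed
    ultimately show ?thesis
      unfolding wasserstein_def by (metis (no_types, lifting) INF_lower)
  qed
  then show ?thesis
    unfolding wasserstein_def[of d] by (rule INF_greatest)
qed

text \<open>\<open>C_const\<close> has the dimension as a number, the theorem has it in a type.
  Relabelling coordinates along a bijection of \<open>'n\<close> with \<open>{..<CARD('n)}\<close>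
  bridges the two; the image of Lebesgue measure is identified on boxes.\<close>

lemma leb_transfer:
  obtains T :: "(nat \<Rightarrow> real) \<Rightarrow> real ^ 'n"
  where "T \<in> measurable (leb CARD('n)) borel" "distr (leb CARD('n)) borel T = lborel"
    "\<And>x y. dst CARD('n) x y = dist (T x) (T y)" "\<And>x. nrm CARD('n) x = norm (T x)"
    "\<And>x y t. T (\<lambda>i\<in>{..<CARD('n)}. (1 - t) * x i + t * y i) = (1 - t) *\<^sub>R T x + t *\<^sub>R T y"
proof -
  obtain e :: "'n \<Rightarrow> nat" where e: "bij_betw e UNIV {..<CARD('n)}"
    using ex_bij_betw_finite_nat[of "UNIV :: 'n set"] by (auto simp: lessThan_atLeast0)
  have e_less: "e i < CARD('n)" for i
    using bij_betwE[OF e] by auto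
  define T where "T = (\<lambda>x :: nat \<Rightarrow> real. \<chi> i. x (e i))"
  have T [measurable]: "T \<in> measurable (leb CARD('n)) borel"
  proof (subst borel_measurable_euclidean_space, rule ballI)
    fix b :: "real ^ 'n" assume "b \<in> Basis"
    then obtain i where "b = axis i 1"
      by (auto simp: Basis_vec_def)
    then show "(\<lambda>x. T x \<bullet> b) \<in> borel_measurable (leb CARD('n))"
      using e_less[of i] unfolding leb_def T_def by (simp add: inner_axis)
  qed
  interpret product_sigma_finite "\<lambda>_ :: nat. lborel :: real measure" ..
  have lborel: "distr (leb CARD('n)) borel T = lborel"
  proof (rule lborel_eqI[symmetric])
    fix l u :: "real ^ 'n" assume lu: "\<And>b. b \<in> Basis \<Longrightarrow> l \<bullet> b \<le> u \<bullet> b"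
    have lu': "l $ i \<le> u $ i" for i
    proof -
      have "axis i (1 :: real) \<in> Basis"
        by (auto simp: Basis_vec_def)
      from lu[OF this] show ?thesis
        by (simp add: inner_axis)
    qed
    define c where "c = inv_into UNIV e"
    have ce: "c (e i) = i" for i
      unfolding c_def using e by (simp add: bij_betw_def)
    have ec: "e (c j) = j" if "j < CARD('n)" for j
      unfolding c_def using e that by (intro f_inv_into_f) (auto simp: bij_betw_def)
    have "T -` box l u \<inter> space (leb CARD('n)) = PiE {..<CARD('n)} (\<lambda>j. {l $ c j <..< u $ c j})"
    proof (rule set_eqI)
      fix x :: "nat \<Rightarrow> real"
      have "T x \<in> box l u \<longleftrightarrow> (\<forall>i. l $ i < x (e i) \<and> x (e i) < u $ i)"
        by (simp add: mem_box_cart T_def)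
      also have "\<dots> \<longleftrightarrow> (\<forall>j<CARD('n). l $ c j < x j \<and> x j < u $ c j)"
        using ce ec e_less by metis
      finally show "x \<in> T -` box l u \<inter> space (leb CARD('n)) \<longleftrightarrow> x \<in> PiE {..<CARD('n)} (\<lambda>j. {l $ c j <..< u $ c j})"
        by (auto simp: leb_def space_PiM PiE_iff)
    qed
    then have "emeasure (distr (leb CARD('n)) borel T) (box l u)
        = emeasure (leb CARD('n)) (PiE {..<CARD('n)} (\<lambda>j. {l $ c j <..< u $ c j}))"
      by (subst emeasure_distr) auto
    also have "\<dots> = (\<Prod>j<CARD('n). emeasure lborel {l $ c j <..< u $ c j})"
      unfolding leb_def by (rule emeasure_PiM) auto
    also have "\<dots> = ennreal (\<Prod>j<CARD('n). (u - l) $ c j)"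
      using lu' by (subst prod_ennreal[symmetric]) auto
    also have "(\<Prod>j<CARD('n). (u - l) $ c j) = (\<Prod>i\<in>UNIV. (u - l) $ i)"
      using prod.reindex_bij_betw[OF e, of "\<lambda>j. (u - l) $ c j"] by (simp add: ce)
    also have "\<dots> = (\<Prod>b\<in>Basis. (u - l) \<bullet> b)"
    proof -
      have Basis: "Basis = range (\<lambda>i :: 'n. axis i (1 :: real))" and inj: "inj (\<lambda>i :: 'n. axis i (1 :: real))"
        by (auto simp: Basis_vec_def inj_on_def axis_eq_axis)
      show ?thesis
        unfolding Basis by (simp add: prod.reindex[OF inj] inner_axis)
    qed
    finally show "emeasure (distr (leb CARD('n)) borel T) (box l u) = ennreal (\<Prod>b\<in>Basis. (u - l) \<bullet> b)" .
  qed simp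
  have dst: "dst CARD('n) x y = dist (T x) (T y)" for x y
    using sum.reindex_bij_betw[OF e, of "\<lambda>j. (x j - y j)^2"]
    by (simp add: dst_def dist_vec_def L2_set_def T_def dist_real_def)
  have nrm: "nrm CARD('n) x = norm (T x)" for x
    using sum.reindex_bij_betw[OF e, of "\<lambda>j. (x j)^2"]
    by (simp add: nrm_def norm_vec_def L2_set_def T_def)
  have "T (\<lambda>i\<in>{..<CARD('n)}. (1 - t) * x i + t * y i) = (1 - t) *\<^sub>R T x + t *\<^sub>R T y" for x y t
    by (simp add: T_def vec_eq_iff e_less)
  with T lborel dst nrm show thesis
    by (rule that)
qed

section \<open>Normalised densities and the use of \<open>C_const\<close>\<close>

lemma proportional_lborel:
  fixes u :: "'a :: euclidean_space \<Rightarrow> real"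
  assumes [measurable]: "u \<in> borel_measurable borel" and pos: "\<And>x. 0 < u x"
    and fin: "(\<integral>\<^sup>+ x. ennreal (u x) \<partial>lborel) < \<top>"
  obtains c where "0 < c" "(\<integral>\<^sup>+ x. ennreal (c * u x) \<partial>lborel) = 1"
    "proportional lborel u = density lborel (\<lambda>x. ennreal (c * u x))"
proof -
  obtain Z where Z: "(\<integral>\<^sup>+ x. ennreal (u x) \<partial>lborel) = ennreal Z" "0 \<le> Z"
    using fin by (cases "\<integral>\<^sup>+ x. ennreal (u x) \<partial>lborel") auto
  have "(\<integral>\<^sup>+ x. ennreal (u x) \<partial>lborel) \<noteq> 0"
  proof
    assume "(\<integral>\<^sup>+ x. ennreal (u x) \<partial>lborel) = 0"
    then have "AE x in lborel. ennreal (u x) = 0"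
      by (subst (asm) nn_integral_0_iff_AE) auto
    moreover have "ennreal (u x) \<noteq> 0" for x
      using pos[of x] by simp
    ultimately have "AE x in (lborel :: 'a measure). False"
      by simp
    then show False
      by (simp add: AE_iff_null null_sets_def)
  qed
  with Z have Z0: "0 < Z"
    by (cases "Z = 0") auto
  have eq: "ennreal (u x) / ennreal Z = ennreal (1 / Z * u x)" for x
    using Z0 pos[of x] by (simp add: divide_ennreal less_imp_le)
  show thesis
  proof (rule that[of "1 / Z"])
    show "(\<integral>\<^sup>+ x. ennreal (1 / Z * u x) \<partial>lborel) = 1"
      unfolding eq[symmetric] using Z Z0 by (subst nn_integral_divide) (auto simp: divide_ennreal)
    show "proportional lborel u = density lborel (\<lambda>x. ennreal (1 / Z * u x))"
      unfolding proportional_def Z eq ..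
  qed (use Z0 in simp)
qed

text \<open>Division by \<open>a\<close> turns the claim into the defining property of
  \<open>Inf\<close>. It allows the infimum in \<open>C_const\<close> to serve as a constant
  itself.\<close>

lemma ennreal_le_Inf_mult:
  fixes a w :: ennreal
  assumes "a \<noteq> 0" "a \<noteq> \<top>" and le: "\<And>C. C \<in> S \<Longrightarrow> w \<le> C * a"
  shows "w \<le> Inf S * a"
proof -
  have "w / a \<le> Inf S"
    using assms(1) le by (intro Inf_greatest divide_le_posI_ennreal) (auto simp: mult.commute zero_less_iff_neq_zero)
  then have "w / a * a \<le> Inf S * a"
    by (rule mult_right_mono) simp
  then show ?thesis
    using assms by (simp add: ennreal_divide_times less_top)
qed

lemma proportional_scale:
  assumes c: "0 < c" and [measurable]: "u \<in> borel_measurable L"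
  shows "proportional L (\<lambda>x. c * u x) = proportional L u"
proof -
  have "ennreal (c * u x) / (\<integral>\<^sup>+ v. ennreal (c * u v) \<partial>L) = ennreal (u x) / (\<integral>\<^sup>+ v. ennreal (u v) \<partial>L)" for x
  proof -
    have eq: "ennreal (c * u v) = ennreal (u v) * ennreal c" for v
      using c by (metis ennreal_mult'' less_imp_le mult.commute)
    show ?thesis
      unfolding eq using c by (subst nn_integral_multc) (auto intro!: divide_mult_eq)
  qed
  then show ?thesis
    unfolding proportional_def by simp
qed

text \<open>A vanishing moment would force the measure onto the origin, a Lebesgue null set. This
  excludes \<open>a = 0\<close> in \<open>ennreal_le_Inf_mult\<close>.\<close>

lemma moment2_density_nonzero:
  fixes u :: "real ^ 'n \<Rightarrow> real"
  assumes [measurable]: "u \<in> borel_measurable borel" and pos: "\<And>x. 0 < u x"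
  shows "moment2 norm (density lborel (\<lambda>x. ennreal (u x))) \<noteq> 0"
proof
  assume "moment2 norm (density lborel (\<lambda>x. ennreal (u x))) = 0"
  then have "(\<integral>\<^sup>+ \<theta>. ennreal ((norm \<theta>)^2) \<partial>density lborel (\<lambda>x. ennreal (u x))) \<le> ennreal (0^2)"
    by (subst epowr_half_le_iff[symmetric]) (auto simp: moment2_def)
  then have "(\<integral>\<^sup>+ \<theta>. ennreal (u \<theta>) * ennreal ((norm \<theta>)^2) \<partial>lborel) = 0"
    by (simp add: nn_integral_density)
  then have "AE \<theta> in lborel. ennreal (u \<theta>) * ennreal ((norm \<theta>)^2) = 0"
    by (subst (asm) nn_integral_0_iff_AE) auto
  moreover have "AE \<theta> in lborel. \<theta> \<noteq> (0 :: real ^ 'n)"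
    by (rule AE_lborel_singleton)
  ultimately have "AE \<theta> in (lborel :: (real ^ 'n) measure). False"
  proof eventually_elim
    case (elim \<theta>)
    then show ?case
      using pos[of \<theta>] by simp
  qed
  then show False
    by (simp add: AE_iff_null null_sets_def)
qed

lemma wasserstein_tilt_le:
  fixes f :: "real ^ 'n \<Rightarrow> real" and \<alpha> q :: real
  assumes conv: "convex_on UNIV f" and [measurable]: "f \<in> borel_measurable borel"
    and fin: "(\<integral>\<^sup>+ x. ennreal (exp (- f x)) \<partial>lborel) < \<top>"
    and \<alpha>: "0 < \<alpha>" and q: "0 < q"
  defines "\<pi> \<equiv> proportional lborel (\<lambda>\<theta>. exp (- f \<theta>))"
  assumes moment: "moment2 norm \<pi> \<noteq> \<top>"
  shows "wasserstein dist q \<pi> (proportional lborel (\<lambda>\<theta>. exp (- (f \<theta> + \<alpha> / 2 * (norm \<theta>)^2))))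
    \<le> (C_const q * ennreal \<alpha> * moment2 norm \<pi> epowr (q + 2)) epowr (1 / q)"
proof -
  let ?\<pi>\<^sub>\<alpha> = "proportional lborel (\<lambda>\<theta>. exp (- (f \<theta> + \<alpha> / 2 * (norm \<theta>)^2)))"
  let ?p = "CARD('n)"
  obtain T :: "(nat \<Rightarrow> real) \<Rightarrow> real ^ 'n"
    where T [measurable]: "T \<in> measurable (leb ?p) borel" and lborel: "distr (leb ?p) borel T = lborel"
      and dst: "\<And>x y. dst ?p x y = dist (T x) (T y)" and nrm: "\<And>x. nrm ?p x = norm (T x)"
      and T_convex: "\<And>x y t. T (\<lambda>i\<in>{..<?p}. (1 - t) * x i + t * y i) = (1 - t) *\<^sub>R T x + t *\<^sub>R T y"
    by (rule leb_transfer[where 'n = 'n], rule that, assumption+)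
  have int_T: "(\<integral>\<^sup>+ x. F (T x) \<partial>leb ?p) = (\<integral>\<^sup>+ x. F x \<partial>lborel)" if "F \<in> borel_measurable borel" for F
    using that by (subst lborel[symmetric]) (simp add: nn_integral_distr)
  have density_T: "distr (density (leb ?p) (\<lambda>x. D (T x))) borel T = density lborel D"
    if "D \<in> borel_measurable borel" for D
    using density_distr[of D borel T "leb ?p"] that by (simp add: lborel)
  obtain c where c: "0 < c" "(\<integral>\<^sup>+ x. ennreal (c * exp (- f x)) \<partial>lborel) = 1"
    and \<pi>: "\<pi> = density lborel (\<lambda>x. ennreal (c * exp (- f x)))"
    unfolding \<pi>_def by (rule proportional_lborel[OF _ _ fin]) auto
  define g where "g = (\<lambda>x. c * exp (- f (T x)))"
  \<comment> \<open>The factor \<open>c\<close> is there because \<open>log_concave_density\<close>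
    asks for total mass 1; \<open>proportional_scale\<close> removes it from the tilted
    measure.\<close>
  define w where "w = (\<lambda>\<theta> :: real ^ 'n. c * exp (- f \<theta>) * exp (- \<alpha> * (norm \<theta>)^2 / 2))"
  have [measurable]: "w \<in> borel_measurable borel"
    unfolding w_def by measurable
  define \<pi>' where "\<pi>' = density (leb ?p) (\<lambda>\<theta>. ennreal (g \<theta>))"
  define \<pi>'\<^sub>\<alpha> where "\<pi>'\<^sub>\<alpha> = proportional (leb ?p) (\<lambda>\<theta>. g \<theta> * exp (- \<alpha> * (nrm ?p \<theta>)^2 / 2))"
  have distr_\<pi>': "distr \<pi>' borel T = \<pi>"
    unfolding \<pi>'_def g_def \<pi> by (rule density_T) measurable
  have distr_\<pi>'\<^sub>\<alpha>: "distr \<pi>'\<^sub>\<alpha> borel T = ?\<pi>\<^sub>\<alpha>"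
  proof -
    have "\<pi>'\<^sub>\<alpha> = density (leb ?p) (\<lambda>x. ennreal (w (T x)) / (\<integral>\<^sup>+ v. ennreal (w v) \<partial>lborel))"
      unfolding \<pi>'\<^sub>\<alpha>_def proportional_def using int_T[of "\<lambda>v. ennreal (w v)"]
      by (simp add: w_def g_def nrm)
    then have "distr \<pi>'\<^sub>\<alpha> borel T = proportional lborel w"
      unfolding proportional_def using density_T[of "\<lambda>x. ennreal (w x) / (\<integral>\<^sup>+ v. ennreal (w v) \<partial>lborel)"] by simp
    also have "w = (\<lambda>\<theta>. c * exp (- (f \<theta> + \<alpha> / 2 * (norm \<theta>)^2)))"
      by (simp add: w_def fun_eq_iff mult.assoc flip: exp_add)
    also have "proportional lborel \<dots> = ?\<pi>\<^sub>\<alpha>"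
      by (rule proportional_scale[OF c(1)]) measurable
    finally show ?thesis .
  qed
  have log_concave: "log_concave_density ?p g"
    unfolding log_concave_density_def
  proof (intro conjI ballI)
    show "g \<in> borel_measurable (leb ?p)"
      unfolding g_def by measurable
    show "(\<integral>\<^sup>+ x. ennreal (g x) \<partial>leb ?p) = 1"
      using int_T[of "\<lambda>x. ennreal (c * exp (- f x))"] c(2) by (simp add: g_def)
    fix x y and t :: real assume t: "t \<in> {0<..<1}"
    have "f ((1 - t) *\<^sub>R T x + t *\<^sub>R T y) \<le> (1 - t) * f (T x) + t * f (T y)"
      using t by (intro convex_onD[OF conv]) auto
    then have "exp (- ((1 - t) * f (T x) + t * f (T y))) \<le> exp (- f ((1 - t) *\<^sub>R T x + t *\<^sub>R T y))"
      by simp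
    moreover have "g x powr (1 - t) * g y powr t = c * exp (- ((1 - t) * f (T x) + t * f (T y)))"
    proof -
      have "g x powr (1 - t) * g y powr t = (c powr (1 - t) * c powr t) * (exp (- f (T x)) powr (1 - t) * exp (- f (T y)) powr t)"
        using c(1) by (simp add: g_def powr_mult)
      also have "c powr (1 - t) * c powr t = c"
        using c(1) by (simp flip: powr_add)
      also have "exp (- f (T x)) powr (1 - t) * exp (- f (T y)) powr t = exp (- ((1 - t) * f (T x) + t * f (T y)))"
        by (simp add: powr_def flip: exp_add)
      finally show ?thesis .
    qed
    ultimately show "g x powr (1 - t) * g y powr t \<le> g (\<lambda>i\<in>{..<?p}. (1 - t) * x i + t * y i)"
      using c(1) by (simp add: g_def T_convex)
  qed (use c in \<open>simp add: g_def\<close>)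
  have moment_T: "moment2 (nrm ?p) \<pi>' = moment2 norm \<pi>"
  proof -
    have "(\<integral>\<^sup>+ \<theta>. ennreal ((nrm ?p \<theta>)^2) \<partial>\<pi>') = (\<integral>\<^sup>+ \<theta>. ennreal ((norm (T \<theta>))^2) \<partial>\<pi>')"
      by (simp add: nrm)
    also have "\<dots> = (\<integral>\<^sup>+ \<theta>. ennreal ((norm \<theta>)^2) \<partial>distr \<pi>' borel T)"
      by (rule nn_integral_distr[symmetric]) (auto simp: \<pi>'_def)
    finally show ?thesis
      unfolding moment2_def distr_\<pi>' by simp
  qed
  define a where "a = ennreal \<alpha> * moment2 norm \<pi> epowr (q + 2)"
  have "moment2 norm \<pi> \<noteq> 0"
    unfolding \<pi> using c(1) by (intro moment2_density_nonzero) auto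
  with moment obtain m where m: "moment2 norm \<pi> = ennreal m" "0 < m"
    by (cases "moment2 norm \<pi>") (auto simp: less_le)
  have a: "a \<noteq> 0" "a \<noteq> \<top>"
    using \<alpha> m by (auto simp: a_def ennreal_epowr ennreal_mult_eq_top_iff)
  have "wasserstein (dst ?p) q \<pi>' \<pi>'\<^sub>\<alpha> epowr q \<le> C_const q * a"
    unfolding C_const_def
  proof (rule ennreal_le_Inf_mult[OF a], goal_cases)
    case (1 C)
    have "1 \<le> ?p"
      by (simp add: Suc_leI)
    from 1[unfolded mem_Collect_eq Let_def, rule_format, OF this less_imp_le[OF \<alpha>] log_concave] show ?case
      unfolding a_def moment_T[symmetric] \<pi>'_def \<pi>'\<^sub>\<alpha>_def by (simp add: mult.assoc)
  qed
  then have "wasserstein (dst ?p) q \<pi>' \<pi>'\<^sub>\<alpha> \<le> (C_const q * a) epowr (1 / q)"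
    by (rule le_epowr_inverse[OF q])
  moreover have "wasserstein dist q (distr \<pi>' borel T) (distr \<pi>'\<^sub>\<alpha> borel T) \<le> wasserstein (dst ?p) q \<pi>' \<pi>'\<^sub>\<alpha>"
    by (rule wasserstein_distr_le) (auto simp: \<pi>'_def \<pi>'\<^sub>\<alpha>_def proportional_def dst split_beta')
  ultimately show ?thesis
    unfolding distr_\<pi>' distr_\<pi>'\<^sub>\<alpha> a_def by (simp add: mult.assoc)
qed

theorem theorem2:
  fixes f :: "real ^ 'n \<Rightarrow> real"
    and grad :: "real ^ 'n \<Rightarrow> real ^ 'n"
    and hess :: "real ^ 'n \<Rightarrow> real ^ 'n ^ 'n"
    and M M\<^sub>2 q \<alpha> h :: real
    and P :: "'w measure"
    and \<xi> :: "nat \<Rightarrow> 'w \<Rightarrow> real ^ 'n"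
    and K :: nat
  defines "\<pi> \<equiv> proportional lborel (\<lambda>\<theta>. exp (- f \<theta>))"
  defines "\<mu>\<^sub>2 \<equiv> moment2 norm \<pi>"
  defines "p \<equiv> real CARD('n)"
  assumes "convex_on UNIV f"
    and "\<And>\<theta>. GDERIV f \<theta> :> grad \<theta>"
    and "\<And>\<theta>. (grad has_derivative (\<lambda>v. hess \<theta> *v v)) (at \<theta>)"
    and "integrable lborel (\<lambda>\<theta>. exp (- f \<theta>))"
    and "M > 0" and "M\<^sub>2 > 0"
    and "\<And>\<theta> \<theta>'. norm (grad \<theta> - grad \<theta>') \<le> M * norm (\<theta> - \<theta>')"
    and "\<And>\<theta> \<theta>'. onorm (\<lambda>v. (hess \<theta> - hess \<theta>') *v v) \<le> M\<^sub>2 * norm (\<theta> - \<theta>')"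
    and "1 \<le> q" and "q \<le> 2"
    and "0 < \<alpha>" and "\<alpha> \<le> M / 20"
    and "0 < h" and "h \<le> 1 / (M + \<alpha>)"
    and "prob_space P"
    and "prob_space.indep_vars P (\<lambda>_. borel) \<xi> {1..}"
    and "\<And>k. k \<ge> 1 \<Longrightarrow> distributed P lborel (\<xi> k) (\<lambda>x. ennreal (std_gaussian_density x))"
  shows "wasserstein dist q (distr P borel (lmc \<alpha> h grad \<xi> K)) \<pi>
    \<le> \<mu>\<^sub>2 * ennreal ((1 - \<alpha> * h) ^ K)
      + ennreal (M\<^sub>2 * h * p / (2 * \<alpha>))
      + ennreal (2.8 * M powr (3 / 2) * h * p powr (1 / 2) / \<alpha>)
      + (C_const q * ennreal \<alpha> * \<mu>\<^sub>2 epowr (q + 2)) epowr (1 / q)"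
proof -
  note conv = assms(4) and gderiv = assms(5) and hess = assms(6) and int = assms(7) and M = assms(8)
    and M2 = assms(9) and lip = assms(10) and hess_lip = assms(11) and q = assms(12,13)
    and \<alpha> = assms(14,15) and h = assms(16,17)
  \<comment> \<open>Lipschitz constant for the gradient of the tilted potential \<open>U\<close>, to
    which all chain estimates are applied.\<close>
  define L where "L = M + \<alpha>"
  have L: "0 < L" "h * L \<le> 1"
    using M \<alpha> h by (auto simp: L_def field_simps)
  have \<alpha>h: "0 < \<alpha> * h" "\<alpha> * h < 1"
  proof -
    show "0 < \<alpha> * h"
      using \<alpha> h by simp
    have "\<alpha> * h < L * h"
      using M h by (simp add: L_def)
    then show "\<alpha> * h < 1"
      using L by (simp add: mult.commute)
  qed
  let ?B = "M\<^sub>2 * h * p / (2 * \<alpha>)" and ?C = "2.8 * M powr (3 / 2) * h * p powr (1 / 2) / \<alpha>"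
  let ?bias = "\<mu>\<^sub>2 * ennreal ((1 - \<alpha> * h) ^ K) + ennreal ?B + ennreal ?C"
  let ?tilt = "(C_const q * ennreal \<alpha> * \<mu>\<^sub>2 epowr (q + 2)) epowr (1 / q)"
  show ?thesis
  proof (cases "\<mu>\<^sub>2 = \<top>")
    \<comment> \<open>The first summand on the right is infinite, because
      \<open>1 - \<alpha> * h\<close> is strictly positive.\<close>
    case True
    have "0 < (1 - \<alpha> * h) ^ K"
      using \<alpha>h by simp
    moreover have "\<top> * ennreal a = \<top>" if "0 < a" for a
      using that by (simp add: ennreal_top_mult)
    ultimately have "\<mu>\<^sub>2 * ennreal ((1 - \<alpha> * h) ^ K) = \<top>"
      unfolding True by blast
    then show ?thesis
      by simp
  next
    case False
    interpret P: prob_space P by fact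
    define D where "D = enn2real \<mu>\<^sub>2"
    have D: "0 \<le> D" "\<mu>\<^sub>2 = ennreal D"
      using False by (auto simp: D_def less_top)
    define U where "U = (\<lambda>\<theta>. f \<theta> + \<alpha> / 2 * (norm \<theta>)^2)"
    define g where "g = (\<lambda>\<theta>. grad \<theta> + \<alpha> *\<^sub>R \<theta>)"
    define H where "H = (\<lambda>\<theta> v. hess \<theta> *v v + \<alpha> *\<^sub>R v)"
    have "continuous_on UNIV grad"
      by (rule has_derivative_continuous_on) (use hess in auto)
    then have grad_meas [measurable]: "grad \<in> borel_measurable borel"
      by (rule borel_measurable_continuous_onI)
    have "continuous_on UNIV f"
      by (rule has_derivative_continuous_on) (use gderiv in \<open>auto simp: gderiv_def\<close>)
    then have f_meas [measurable]: "f \<in> borel_measurable borel"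
      by (rule borel_measurable_continuous_onI)
    have fin: "(\<integral>\<^sup>+ x. ennreal (exp (- f x)) \<partial>lborel) < \<top>"
      using int by (simp add: integrable_iff_bounded)
    have fin_U: "(\<integral>\<^sup>+ x. ennreal (exp (- U x)) \<partial>lborel) < \<top>"
      using \<alpha> by (intro order.strict_trans1[OF _ fin] nn_integral_mono ennreal_leI) (auto simp: U_def)
    have [measurable]: "U \<in> borel_measurable borel"
      unfolding U_def by measurable
    obtain k where k: "0 < k" "(\<integral>\<^sup>+ x. ennreal (k * exp (- U x)) \<partial>lborel) = 1"
      and \<pi>\<^sub>\<alpha>: "proportional lborel (\<lambda>x. exp (- U x)) = density lborel (\<lambda>x. ennreal (k * exp (- U x)))"
      by (rule proportional_lborel[OF _ _ fin_U]) auto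
    obtain c where c: "0 < c" "(\<integral>\<^sup>+ x. ennreal (c * exp (- f x)) \<partial>lborel) = 1"
      and \<pi>: "\<pi> = density lborel (\<lambda>x. ennreal (c * exp (- f x)))"
      unfolding \<pi>_def by (rule proportional_lborel[OF _ _ fin]) auto
    interpret langevin U g L k H M\<^sub>2
    proof (intro langevin.intro gibbs_measure.intro langevin_axioms.intro)
      show "U y \<le> U x + g x \<bullet> (y - x) + L / 2 * (norm (y - x))^2" for x y
      proof -
        have "(norm y)^2 = (norm x)^2 + 2 * (x \<bullet> (y - x)) + (norm (y - x))^2"
          unfolding power2_norm_eq_inner by (simp add: inner_diff_left inner_diff_right inner_commute)
        then have "\<alpha> / 2 * (norm y)^2 = \<alpha> / 2 * (norm x)^2 + \<alpha> * (x \<bullet> (y - x)) + \<alpha> / 2 * (norm (y - x))^2"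
          by (simp only: distrib_left)
        then show ?thesis
          using lipschitz_gradient_upper[OF gderiv lip, of y x]
          by (simp add: U_def g_def L_def inner_add_left add_divide_distrib distrib_right)
      qed
      show "norm (g y - g x) \<le> L * norm (y - x)" for x y
      proof -
        have "norm (g y - g x) = norm ((grad y - grad x) + \<alpha> *\<^sub>R (y - x))"
          by (simp add: g_def algebra_simps)
        also have "\<dots> \<le> M * norm (y - x) + \<alpha> * norm (y - x)"
          using \<alpha> by (intro order.trans[OF norm_triangle_ineq] add_mono lip) auto
        finally show ?thesis
          by (simp add: L_def distrib_right)
      qed
      show "bounded_linear (H x)" for x
        unfolding H_def by (intro bounded_linear_add bounded_linear_scaleR_right matrix_vector_mul_bounded_linear)
      show "norm (H x v) \<le> L * norm v" for x v
      proof -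
        have "norm (H x v) \<le> M * norm v + \<alpha> * norm v"
          unfolding H_def using \<alpha>
          by (intro order.trans[OF norm_triangle_ineq] add_mono has_derivative_norm_le_lipschitz[OF hess lip]) auto
        then show ?thesis
          by (simp add: L_def distrib_right)
      qed
      show "norm (g y - g x - H x (y - x)) \<le> M\<^sub>2 / 2 * (norm (y - x))^2" for x y
      proof -
        have "norm (hess x *v v - hess y *v v) \<le> M\<^sub>2 * norm (x - y) * norm v" for x y v
        proof -
          have "norm ((hess x - hess y) *v v) \<le> onorm (\<lambda>v. (hess x - hess y) *v v) * norm v"
            by (rule onorm[OF matrix_vector_mul_bounded_linear])
          also have "\<dots> \<le> M\<^sub>2 * norm (x - y) * norm v"
            by (intro mult_right_mono hess_lip) auto
          finally show ?thesis
            by (simp add: matrix_vector_mult_diff_rdistrib)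
        qed
        from lipschitz_derivative_taylor[OF hess this, of y x] show ?thesis
          by (simp add: g_def H_def algebra_simps)
      qed
    qed (use k L M2 in \<open>auto simp: g_def\<close>)
    have gibbs: "gibbs = proportional lborel (\<lambda>x. exp (- U x))"
      unfolding gibbs_def \<pi>\<^sub>\<alpha> ..
    have "(\<integral>\<^sup>+ x. ennreal ((norm x)^2) \<partial>\<pi>) \<le> ennreal (D^2)"
      using D unfolding \<mu>\<^sub>2_def moment2_def by (subst epowr_half_le_iff[symmetric]) auto
    \<comment> \<open>The initial distance is a moment of \<open>gibbs\<close>, while the theorem
      has that of \<pi>; \<open>gibbs\<close> is \<pi> reweighted by a decreasing function of the
      norm, so association applies.\<close>
    moreover have "(\<integral>\<^sup>+ x. ennreal ((norm x)^2) \<partial>gibbs) \<le> (\<integral>\<^sup>+ x. ennreal ((norm x)^2) \<partial>\<pi>)"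
    proof -
      let ?w = "\<lambda>x :: real ^ 'n. exp (- (\<alpha> / 2) * (norm x)^2)"
      have tilt: "(\<integral>\<^sup>+ x. ennreal (F x) \<partial>gibbs) = ennreal (k / c) * (\<integral>\<^sup>+ x. ennreal (F x * ?w x) \<partial>\<pi>)"
        if [measurable]: "F \<in> borel_measurable borel" and "\<And>x. 0 \<le> F x" for F
      proof -
        have "ennreal (k / c) * (\<integral>\<^sup>+ x. ennreal (F x * ?w x) \<partial>\<pi>)
            = (\<integral>\<^sup>+ x. ennreal (k / c) * (ennreal (c * exp (- f x)) * ennreal (F x * ?w x)) \<partial>lborel)"
          unfolding \<pi> by (subst nn_integral_density) (auto simp: nn_integral_cmult)
        also have "\<dots> = (\<integral>\<^sup>+ x. ennreal (k * exp (- U x)) * ennreal (F x) \<partial>lborel)"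
        proof (rule nn_integral_cong)
          fix x
          have "exp (- U x) = exp (- f x) * ?w x"
            by (simp add: U_def flip: exp_add)
          then have "k / c * (c * exp (- f x) * (F x * ?w x)) = k * exp (- U x) * F x"
            using c by simp
          then show "ennreal (k / c) * (ennreal (c * exp (- f x)) * ennreal (F x * ?w x)) = ennreal (k * exp (- U x)) * ennreal (F x)"
            using k c that(2)[of x] by (simp flip: ennreal_mult)
        qed
        also have "\<dots> = (\<integral>\<^sup>+ x. ennreal (F x) \<partial>gibbs)"
          by (subst nn_integral_gibbs) auto
        finally show ?thesis ..
      qed
      have "prob_space \<pi>"
        by standard (simp add: \<pi> emeasure_density c)
      have "(\<integral>\<^sup>+ x. ennreal ((norm x)^2) \<partial>gibbs) = ennreal (k / c) * (\<integral>\<^sup>+ x. ennreal ((norm x)^2 * ?w x) \<partial>\<pi>)"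
        by (rule tilt) auto
      also have "\<dots> \<le> ennreal (k / c) * ((\<integral>\<^sup>+ x. ennreal ((norm x)^2) \<partial>\<pi>) * (\<integral>\<^sup>+ x. ennreal (?w x) \<partial>\<pi>))"
      proof (intro mult_left_mono tilted_second_moment_le \<open>prob_space \<pi>\<close>)
        show "(\<integral>\<^sup>+ x. ennreal ((norm x)^2) \<partial>\<pi>) < \<top>"
          using \<open>_ \<le> ennreal (D^2)\<close> by (rule order.strict_trans1) simp
      qed (use \<alpha> in \<open>auto simp: \<pi>\<close>)
      also have "\<dots> = (\<integral>\<^sup>+ x. ennreal ((norm x)^2) \<partial>\<pi>) * (ennreal (k / c) * (\<integral>\<^sup>+ x. ennreal (?w x) \<partial>\<pi>))"
        by (simp only: mult.left_commute)
      also have "ennreal (k / c) * (\<integral>\<^sup>+ x. ennreal (?w x) \<partial>\<pi>) = (\<integral>\<^sup>+ x. ennreal 1 \<partial>gibbs)"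
        by (subst tilt) simp_all
      also have "\<dots> = 1"
        using emeasure_space_1 by simp
      finally show ?thesis
        by simp
    qed
    ultimately have D_gibbs: "(\<integral>\<^sup>+ x. ennreal ((norm x)^2) \<partial>gibbs) \<le> ennreal (D^2)"
      by (rule order.trans[rotated])
    define \<nu> where "\<nu> = (\<lambda>k. distr P borel (lmc \<alpha> h grad \<xi> k))"
    have \<nu>_0: "(\<integral>\<^sup>+ x. F x \<partial>\<nu> 0) = F 0" if "F \<in> borel_measurable borel" for F
      using that by (simp add: \<nu>_def nn_integral_return)
    have \<nu>_Suc: "(\<integral>\<^sup>+ x. F x \<partial>\<nu> (Suc k)) = (\<integral>\<^sup>+ x. \<integral>\<^sup>+ z. F (x - h *\<^sub>R g x + sqrt (2 * h) *\<^sub>R z) \<partial>gaussian \<partial>\<nu> k)"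
      if "F \<in> borel_measurable borel" for F k
      unfolding \<nu>_def g_def by (rule P.distr_lmc_Suc[OF grad_meas assms(19,20) that])
    have contr: "norm ((x - h *\<^sub>R g x) - (y - h *\<^sub>R g y)) \<le> (1 - \<alpha> * h) * norm (x - y)" for x y
      unfolding g_def using \<alpha> h L by (intro gradient_step_contraction[OF conv gderiv lip M]) (auto simp: L_def)
    \<comment> \<open>Accumulated bias and accumulated deviation, after division by
      \<open>1 - a = \<alpha> * h\<close>.\<close>
    define X Y where "X = h^2 / 2 * (L * sqrt (L * CARD('n)) + M\<^sub>2 * CARD('n)) / (\<alpha> * h)"
      and "Y = sqrt (4 * h ^ 3 * L^2 * CARD('n) / (\<alpha> * h))"
    have "wasserstein dist q (\<nu> K) gibbs \<le> ennreal ((1 - \<alpha> * h) ^ K * D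
        + h^2 / 2 * (L * sqrt (L * CARD('n)) + M\<^sub>2 * CARD('n)) / (1 - (1 - \<alpha> * h))
        + sqrt (4 * h ^ 3 * L^2 * CARD('n) / (1 - (1 - \<alpha> * h))))"
      using \<alpha>h h q D by (intro wasserstein_lmc_le \<nu>_0 \<nu>_Suc contr D_gibbs) (auto simp: \<nu>_def)
    also have "\<dots> = ennreal ((1 - \<alpha> * h) ^ K * D + (X + Y))"
      by (simp add: X_def Y_def add.assoc)
    also have "\<dots> \<le> ennreal ((1 - \<alpha> * h) ^ K * D + (?B + ?C))"
    proof (intro ennreal_leI add_left_mono)
      \<comment> \<open>The \<open>M\<^sub>2\<close> part of the bias is exactly \<open>?B\<close>.
        The rest of \<open>X\<close> and all of \<open>Y\<close> share the factor
        \<open>h * sqrt p / \<alpha>\<close> and have to fit into \<open>?C\<close>.\<close>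
      have X: "X = ?B + h * sqrt p / \<alpha> * (L * sqrt L / 2)"
        using h \<alpha> by (simp add: X_def p_def real_sqrt_mult power2_eq_square field_simps)
      have "(h * sqrt p / \<alpha> * (2 * (L * sqrt \<alpha>)))^2 = h^2 * p / \<alpha>^2 * (4 * L^2 * \<alpha>)"
        using \<alpha> by (simp add: power_mult_distrib power_divide p_def)
      also have "\<dots> = 4 * h ^ 3 * L^2 * CARD('n) / (\<alpha> * h)"
        using h \<alpha> by (simp add: p_def power2_eq_square power3_eq_cube)
      finally have "4 * h ^ 3 * L^2 * CARD('n) / (\<alpha> * h) = (h * sqrt p / \<alpha> * (2 * (L * sqrt \<alpha>)))^2" ..
      then have Y: "Y = h * sqrt p / \<alpha> * (2 * (L * sqrt \<alpha>))"
        unfolding Y_def using h \<alpha> L by (intro real_sqrt_unique) (auto simp: p_def)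
      have Mp: "M powr (3 / 2) = M * sqrt M" "p powr (1 / 2) = sqrt p"
        using M powr_add[of M 1 "1 / 2"] by (auto simp: powr_half_sqrt p_def)
      \<comment> \<open>From \<open>\<alpha> \<le> M / 20\<close>: \<open>L\<close> is at most
        \<open>1.05 * M\<close>, hence at most \<open>1.05^2 * M\<close>, whose root is rational in
        \<open>sqrt M\<close>; likewise 1 / 20 is rounded up to the square 1 / 16.\<close>
      have "L \<le> 1.05 * M"
        using \<alpha> by (simp add: L_def)
      moreover have "sqrt L \<le> 1.05 * sqrt M"
      proof -
        have "L \<le> 1.05^2 * M"
          using \<open>L \<le> 1.05 * M\<close> M by (simp add: power2_eq_square)
        then have "sqrt L \<le> sqrt (1.05^2 * M)"
          by (rule real_sqrt_le_mono)
        then show ?thesis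
          by (simp add: real_sqrt_mult)
      qed
      moreover have "sqrt \<alpha> \<le> sqrt M / 4"
      proof -
        have "\<alpha> \<le> M / 4^2"
          using \<alpha> M by simp
        then have "sqrt \<alpha> \<le> sqrt (M / 4^2)"
          by (rule real_sqrt_le_mono)
        then show ?thesis
          by (simp add: real_sqrt_divide)
      qed
      ultimately have le: "L * sqrt L \<le> 1.05 * M * (1.05 * sqrt M)" "L * sqrt \<alpha> \<le> 1.05 * M * (sqrt M / 4)"
        using L(1) M \<alpha>(1) by (intro mult_mono; simp)+
      have eq: "1.05 * M * (1.05 * sqrt M) = 441 / 400 * (M * sqrt M)" "1.05 * M * (sqrt M / 4) = 21 / 80 * (M * sqrt M)"
        by (simp_all add: power2_eq_square)
      \<comment> \<open>The actual constant is 441 / 800 + 42 / 80 = 1.07625.\<close>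
      have "A / 2 + 2 * B \<le> 2.8 * R" if "A \<le> 441 / 400 * R" "B \<le> 21 / 80 * R" "0 \<le> R" for A B R :: real
        using that by (simp add: field_simps)
      from this[OF le[unfolded eq]] have "L * sqrt L / 2 + 2 * (L * sqrt \<alpha>) \<le> 2.8 * (M * sqrt M)"
        using M by simp
      then have "h * sqrt p / \<alpha> * (L * sqrt L / 2 + 2 * (L * sqrt \<alpha>)) \<le> h * sqrt p / \<alpha> * (2.8 * (M * sqrt M))"
        using h \<alpha> by (intro mult_left_mono) (auto simp: p_def)
      then show "X + Y \<le> ?B + ?C"
        unfolding X Y Mp by (simp add: algebra_simps)
    qed
    also have "\<dots> = ?bias"
    proof -
      have "0 \<le> (1 - \<alpha> * h) ^ K" "0 \<le> ?B" "0 \<le> ?C"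
        using \<alpha>h \<alpha> h M2 by (auto simp: p_def)
      moreover have "ennreal (A * D + (B + C)) = ennreal D * ennreal A + ennreal B + ennreal C"
        if "0 \<le> A" "0 \<le> B" "0 \<le> C" for A B C
        using that D(1) by (simp add: ennreal_mult mult.commute add.assoc)
      ultimately show ?thesis
        unfolding D(2) by blast
    qed
    finally have main: "wasserstein dist q (\<nu> K) gibbs \<le> \<dots>" .
    have tilt: "wasserstein dist q \<pi> gibbs \<le> ?tilt"
    proof -
      have "gibbs = proportional lborel (\<lambda>\<theta>. exp (- (f \<theta> + \<alpha> / 2 * (norm \<theta>)^2)))"
        unfolding gibbs by (simp only: U_def)
      with wasserstein_tilt_le[OF conv f_meas fin \<alpha>(1), of q] False q show ?thesis
        unfolding \<mu>\<^sub>2_def \<pi>_def by simp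
    qed
    have "lmc \<alpha> h grad \<xi> K \<in> borel_measurable P"
    proof (induction K)
      case (Suc K)
      have "\<xi> (Suc K) \<in> borel_measurable P"
        using assms(20)[of "Suc K"] by (simp add: distributed_def)
      with Suc show ?case
        by simp
    qed simp
    then have "prob_space (\<nu> K)"
      unfolding \<nu>_def by (rule P.prob_space_distr)
    moreover have "prob_space \<pi>"
      by standard (simp add: \<pi> emeasure_density c)
    ultimately have "wasserstein dist q (\<nu> K) \<pi> \<le> wasserstein dist q (\<nu> K) gibbs + wasserstein dist q \<pi> gibbs"
      using q by (intro wasserstein_triangle) (auto simp: \<nu>_def \<pi>)
    also have "\<dots> \<le> ?bias
        + ?tilt"
      by (intro add_mono main tilt)
    finally show ?thesis
      unfolding \<nu>_def .
  qed
qed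

end
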